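(* Let $\Bbbk$ be a field and let $\mathcal{B}$ be a $\Bbbk$-linear pivotal bicategory which is monoidal with duals and such that $\mathcal{B}(\mathbb{O},\mathbb{O})\cong \mathrm{Vect}_{\Bbbk}$, where $\mathbb{O}\in\mathcal{B}$ is the monoidal unit object. For each object $\alpha$ and $\phi_1,\phi_2\in\mathrm{End}(1_\alpha)$ set $$\langle\phi_1,\phi_2\rangle_\alpha=\mathrm{tr}_{\mathrm{l}}(\widetilde\phi_1\widetilde\phi_2)\in\mathrm{End}(1_{\mathbb{O}})\cong\Bbbk,\qquad \langle\phi_1\rangle_\alpha=\langle\phi_1,1\rangle_\alpha,$$ where $\widetilde\phi_i\in\mathrm{End}(\widetilde 1_\alpha)$, $\widetilde 1_\alpha\in\mathcal{B}(\mathbb{O},\alpha\,\square\,\alpha^{\#})$, correspond to $\phi_i$ and $1_\alpha$ under duality in $\mathcal{B}$. Assume moreover that for all objects $\alpha,\beta$, every $D\in\mathcal{B}(\alpha,\beta)$ and every $\Psi\in\mathrm{End}(D)$, $$\big\langle\mathrm{tr}_{\mathrm{l}}(\Psi)\big\rangle_\alpha=\big\langle\mathrm{tr}_{\mathrm{r}}(\Psi)\big\rangle_\beta .$$ Then for every object $\alpha\in\mathcal{B}$: - $\mathrm{End}(1_\alpha)$, with composition as multiplication and pairing $\langle-,-\rangle_\alpha$, has the structure of a commutative Frobenius algebra; - $\mathcal{B}(\mathbb{O},\alpha)$ has the structure of a Calabi-Yau category, with Serre pairings $\langle-,-\rangle_{YX}:\mathrm{Hom}(X,Y)\otimes_{\Bbbk}\mathrm{Hom}(Y,X)\to\Bbbk$,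 $\langle\Phi,\Psi\rangle_{YX}=\mathrm{tr}_{\mathrm{l}}(\Psi\Phi)\in\mathrm{End}(1_{\mathbb{O}})\cong\Bbbk$, for $X,Y\in\mathcal{B}(\mathbb{O},\alpha)$; - the $\Bbbk$-linear maps, for $X\in\mathcal{B}(\mathbb{O},\alpha)$, $$\beta_X:\mathrm{End}(1_\alpha)\to\mathrm{End}(X),\ \ \beta_X(\phi)=\phi\otimes 1_X,\qquad \beta^X:\mathrm{End}(X)\to\mathrm{End}(1_\alpha),\ \ \beta^X(\Psi)=\mathrm{tr}_{\mathrm{r}}(\Psi)=\widetilde{\mathrm{ev}}_X\circ(\Psi\otimes 1_{X^\dagger})\circ\mathrm{coev}_X,$$ satisfy: (i) each $\beta_X$ is an algebra map with image in the centre of $\mathrm{End}(X)$; (ii) $\langle\beta^X(\Psi),\phi\rangle_\alpha=\langle\Psi,\beta_X(\phi)\rangle_{XX}$ for all $\phi\in\mathrm{End}(1_\alpha)$, $\Psi\in\mathrm{End}(X)$; (iii) (Cardy condition) for all $X,Y\in\mathcal{B}(\mathbb{O},\alpha)$, $\Phi\in\mathrm{End}(X)$ and $\Psi\in\mathrm{End}(Y)$, $$\mathrm{tr}\big({}_\Psi m_\Phi\big)=\big\langle\beta^Y(\Psi),\beta^X(\Phi)\big\rangle_\alpha,$$ where ${}_\Psi m_\Phi:\mathrm{Hom}(X,Y)\to\mathrm{Hom}(X,Y)$ is the linear map $\Omega\mapsto\Psi\Omega\Phi$ and $\mathrm{tr}$ is the ordinary trace of a linear operator.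
   Context: Conventions for 2-categories. Bicategories are treated as strict 2-categories (every pivotal bicategory is equivalent to a pivotal 2-category). For objects $\alpha,\beta$ of $\mathcal{B}$, $\mathcal{B}(\alpha,\beta)$ is the category of 1-morphisms $\alpha\to\beta$; its morphisms are the 2-morphisms, with composition $\circ$ (also written by juxtaposition), and $\mathrm{Hom}(X,Y)$ is the space of 2-morphisms $X\to Y$. Horizontal composition is $\otimes:\mathcal{B}(\beta,\gamma)\times\mathcal{B}(\alpha,\beta)\to\mathcal{B}(\alpha,\gamma)$, with unit 1-morphisms $1_\alpha$. $\Bbbk$-linear means that 2-morphism sets are $\Bbbk$-vector spaces and both compositions are $\Bbbk$-(bi)linear. Pivotal. A left adjoint of $X\in\mathcal{B}(\alpha,\beta)$ is ${}^\dagger X\in\mathcal{B}(\beta,\alpha)$ with 2-morphisms $\mathrm{ev}_X:{}^\dagger X\otimes X\to 1_\alpha$, $\mathrm{coev}_X:1_\beta\to X\otimes{}^\dagger X$ satisfying $(1_X\otimes\mathrm{ev}_X)\circ(\mathrm{coev}_X\otimes 1_X)=1_X$ and $(\mathrm{ev}_X\otimes 1_{{}^\dagger X})\circ(1_{{}^\dagger X}\otimes\mathrm{coev}_X)=1_{{}^\dagger X}$. A right adjoint is $X^\dagger\in\mathcal{B}(\beta,\alpha)$ with $\widetilde{\mathrm{ev}}_X:X\otimes X^\dagger\to 1_\beta$, $\widetilde{\mathrm{coev}}_X:1_\alpha\to X^\dagger\otimes X$ satisfying $(\widetilde{\mathrm{ev}}_X\otimes 1_X)\circ(1_X\otimes\widetilde{\mathrm{coev}}_X)=1_X$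 and $(1_{X^\dagger}\otimes\widetilde{\mathrm{ev}}_X)\circ(\widetilde{\mathrm{coev}}_X\otimes 1_{X^\dagger})=1_{X^\dagger}$. $\mathcal{B}$ is pivotal if every 1-morphism has chosen left and right adjoints with ${}^\dagger X=X^\dagger$, such that: (1) for every 2-morphism $\Phi:X\to Z$ one has $(\mathrm{ev}_Z\otimes 1)\circ(1\otimes\Phi\otimes 1)\circ(1_{{}^\dagger Z}\otimes\mathrm{coev}_X)=(1\otimes\widetilde{\mathrm{ev}}_Z)\circ(1\otimes\Phi\otimes 1)\circ(\widetilde{\mathrm{coev}}_X\otimes 1_{Z^\dagger})$ as maps $Z^\dagger\to X^\dagger$; (2) for composable $X:\alpha\to\beta$, $Y:\beta\to\gamma$, the two maps $(Y\otimes X)^\dagger\to X^\dagger\otimes Y^\dagger$ given by $(1\otimes\widetilde{\mathrm{ev}}_{Y\otimes X})\circ(1_{X^\dagger}\otimes\widetilde{\mathrm{coev}}_Y\otimes 1)\circ(\widetilde{\mathrm{coev}}_X\otimes 1)$ and by $(\mathrm{ev}_{Y\otimes X}\otimes 1)\circ(1\otimes\mathrm{coev}_X\otimes 1_{Y^\dagger})\circ(1\otimes\mathrm{coev}_Y)$ coincide. The left and right traces of $\Psi\in\mathrm{End}(X)$, $X\in\mathcal{B}(\alpha,\beta)$, are $\mathrm{tr}_{\mathrm{l}}(\Psi)=\mathrm{ev}_X\circ(1_{X^\dagger}\otimes\Psi)\circ\widetilde{\mathrm{coev}}_X\in\mathrm{End}(1_\alpha)$ and $\mathrm{tr}_{\mathrm{r}}(\Psi)=\widetilde{\mathrm{ev}}_X\circ(\Psi\otimes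 1_{X^\dagger})\circ\mathrm{coev}_X\in\mathrm{End}(1_\beta)$. Monoidal with duals. This means that $\mathcal{B}$ is the 2-category underlying a Gray category with duals with a single object (in the sense of Barrett–Meusburger–Schaumann). That is: there are a unit object $\mathbb{O}$ and, for each object $\alpha$, strict 2-functors $\alpha\,\square\,(-)$ and $(-)\,\square\,\alpha$ preserving the pivotal structure, strictly associative and unital, together with invertible, natural and coherent interchange 2-morphisms between $(X\,\square\,\beta')\otimes(\alpha\,\square\,Y)$ and $(\alpha'\,\square\,Y)\otimes(X\,\square\,\beta)$ for $X:\alpha\to\alpha'$, $Y:\beta\to\beta'$. Moreover each object $\alpha$ has a dual $\alpha^{\#}$ with $\alpha^{\#\#}=\alpha$, $\mathbb{O}^{\#}=\mathbb{O}$, $(\alpha\,\square\,\beta)^{\#}=\beta^{\#}\,\square\,\alpha^{\#}$, a fold 1-morphism $\eta_\alpha:\mathbb{O}\to\alpha\,\square\,\alpha^{\#}$ with $\eta_{\mathbb{O}}=1_{\mathbb{O}}$ and $\eta_{\alpha\square\beta}=(\alpha\,\square\,\eta_\beta\,\square\,\alpha^{\#})\otimes\eta_\alpha$, and an invertible triangulator 2-morphism $T_\alpha:(\eta_\alpha^\dagger\,\square\,\alpha)\otimes(\alpha\,\square\,\eta_{\alpha^{\#}})\to 1_\alpha$, compatible with $\square$ and units and satisfying the swallowtail identity. Duality in $\mathcal{B}$ gives equivalences $\mathcal{B}(\alpha,\beta)\to\mathcal{B}(\mathbb{O},\beta\,\square\,\alpha^{\#})$, $X\mapsto (X\,\square\,\alpha^{\#})\otimes\eta_\alpha$.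 Under the one with $\beta=\alpha$, $1_\alpha$ corresponds to $\widetilde 1_\alpha=\eta_\alpha$ and $\phi\in\mathrm{End}(1_\alpha)$ corresponds to $\widetilde\phi=(\phi\,\square\,\alpha^{\#})\otimes 1_{\eta_\alpha}$. $\mathrm{Vect}_{\Bbbk}$ is the category of finite-dimensional $\Bbbk$-vector spaces, and $\mathcal{B}(\mathbb{O},\mathbb{O})\cong\mathrm{Vect}_{\Bbbk}$ is an equivalence of $\Bbbk$-linear monoidal categories ($\otimes$ corresponding to $\otimes_{\Bbbk}$); in particular $\mathrm{End}(1_{\mathbb{O}})\cong\Bbbk$. A commutative Frobenius algebra is a commutative unital finite-dimensional $\Bbbk$-algebra $A$ with a nondegenerate bilinear pairing satisfying $\langle ab,c\rangle=\langle a,bc\rangle$. Calabi-Yau category. A Serre functor on a $\Bbbk$-linear category $\mathcal{C}$ is a functor $\Sigma:\mathcal{C}\to\mathcal{C}$ with isomorphisms $\eta_{ab}:\mathrm{Hom}(a,b)\to\mathrm{Hom}(b,\Sigma(a))^*$ natural in $a,b$. The associated nondegenerate Serre pairings are $\langle-,-\rangle_{ab}:\mathrm{Hom}(b,\Sigma(a))\otimes_{\Bbbk}\mathrm{Hom}(a,b)\to\Bbbk$, $\Psi\otimes\Phi\mapsto\eta_{aa}(1_a)(\Psi\Phi)$. A Calabi-Yau category is a $\Bbbk$-linear category with a trivial Serre functor $\Sigma=1_{\mathcal{C}}$. *)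

theory Defs
  imports Complex_Main "HOL-Library.Function_Algebras"
begin

section \<open>Linear algebra on subspaces\<close>

definition fin_dim_subspace :: "('k::field \<Rightarrow> 'v::ab_group_add \<Rightarrow> 'v) \<Rightarrow> 'v set \<Rightarrow> bool" where
  "fin_dim_subspace s V \<longleftrightarrow> module.subspace s V \<and> (\<exists>S. finite S \<and> module.span s S = V)"

definition linear_map_on ::
    "('k::field \<Rightarrow> 'v::ab_group_add \<Rightarrow> 'v) \<Rightarrow> ('k \<Rightarrow> 'w::ab_group_add \<Rightarrow> 'w)
      \<Rightarrow> 'v set \<Rightarrow> 'w set \<Rightarrow> ('v \<Rightarrow> 'w) \<Rightarrow> bool" where
  "linear_map_on s t V W f \<longleftrightarrow>
     (\<forall>x\<in>V. f x \<in> W) \<and> (\<forall>x\<in>V. \<forall>y\<in>V. f (x + y) = f x + f y) \<and> (\<forall>c. \<forall>x\<in>V. f (s c x) = t c (f x))"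

definition bilinear_map_on ::
    "('k::field \<Rightarrow> 'u::ab_group_add \<Rightarrow> 'u) \<Rightarrow> ('k \<Rightarrow> 'v::ab_group_add \<Rightarrow> 'v)
      \<Rightarrow> ('k \<Rightarrow> 'w::ab_group_add \<Rightarrow> 'w) \<Rightarrow> 'u set \<Rightarrow> 'v set \<Rightarrow> 'w set \<Rightarrow> ('u \<Rightarrow> 'v \<Rightarrow> 'w) \<Rightarrow> bool" where
  "bilinear_map_on s t r U V W b \<longleftrightarrow>
     (\<forall>x\<in>U. linear_map_on t r V W (b x)) \<and> (\<forall>y\<in>V. linear_map_on s r U W (\<lambda>x. b x y))"

text \<open>The trace of an endomorphism of the finite-dimensional space \<open>V\<close>: the sum of the diagonal
  entries of its matrix in a basis of \<open>V\<close> (the sum does not depend on the basis).\<close>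

definition trace_on :: "('k::field \<Rightarrow> 'v::ab_group_add \<Rightarrow> 'v) \<Rightarrow> 'v set \<Rightarrow> ('v \<Rightarrow> 'v) \<Rightarrow> 'k" where
  "trace_on s V f =
     (let S = (SOME S. \<not> module.dependent s S \<and> module.span s S = V)
      in \<Sum>b\<in>S. module.representation s S (f b) b)"


section \<open>Algebras and Frobenius algebras\<close>

locale algebra_on =
  fixes s :: "'k::field \<Rightarrow> 'c::ab_group_add \<Rightarrow> 'c"
    and A :: "'c set" and mul :: "'c \<Rightarrow> 'c \<Rightarrow> 'c" and one :: 'c
  assumes vector_space: "vector_space s"
    and subspace: "module.subspace s A"
    and mul_bilinear: "bilinear_map_on s s s A A A mul"
    and one_closed: "one \<in> A"
    and mul_assoc: "\<lbrakk>a \<in> A; b \<in> A; c \<in> A\<rbrakk> \<Longrightarrow> mul (mul a b) c = mul a (mul b c)"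
    and one_left: "a \<in> A \<Longrightarrow> mul one a = a"
    and one_right: "a \<in> A \<Longrightarrow> mul a one = a"

locale commutative_frobenius_algebra = algebra_on s A mul one
  for s :: "'k::field \<Rightarrow> 'c::ab_group_add \<Rightarrow> 'c" and A mul one +
  fixes pairing :: "'c \<Rightarrow> 'c \<Rightarrow> 'k"
  assumes finite_dimensional: "fin_dim_subspace s A"
    and mul_commute: "\<lbrakk>a \<in> A; b \<in> A\<rbrakk> \<Longrightarrow> mul a b = mul b a"
    and pairing_bilinear: "bilinear_map_on s s (*) A A UNIV pairing"
    and pairing_assoc:
      "\<lbrakk>a \<in> A; b \<in> A; c \<in> A\<rbrakk> \<Longrightarrow> pairing (mul a b) c = pairing a (mul b c)"
    and nondegenerate_left: "\<lbrakk>a \<in> A; \<And>b. b \<in> A \<Longrightarrow> pairing a b = 0\<rbrakk> \<Longrightarrow> a = 0"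
    and nondegenerate_right: "\<lbrakk>b \<in> A; \<And>a. a \<in> A \<Longrightarrow> pairing a b = 0\<rbrakk> \<Longrightarrow> b = 0"

definition algebra_hom_on ::
    "('k::field \<Rightarrow> 'c::ab_group_add \<Rightarrow> 'c) \<Rightarrow> ('c \<Rightarrow> 'c \<Rightarrow> 'c)
      \<Rightarrow> 'c set \<Rightarrow> 'c \<Rightarrow> 'c set \<Rightarrow> 'c \<Rightarrow> ('c \<Rightarrow> 'c) \<Rightarrow> bool" where
  "algebra_hom_on s mul A oneA C oneC f \<longleftrightarrow>
     algebra_on s A mul oneA \<and> algebra_on s C mul oneC \<and> linear_map_on s s A C f
     \<and> (\<forall>a\<in>A. \<forall>b\<in>A. f (mul a b) = mul (f a) (f b)) \<and> f oneA = oneC"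

definition centre_on :: "('c \<Rightarrow> 'c \<Rightarrow> 'c) \<Rightarrow> 'c set \<Rightarrow> 'c set" where
  "centre_on mul A = {z \<in> A. \<forall>a\<in>A. mul z a = mul a z}"


section \<open>Linear categories, Serre functors and Calabi-Yau categories\<close>

text \<open>\<open>H a b\<close> is \<open>Hom(a,b)\<close>, and \<open>cmp g f\<close> is \<open>g\<close> after \<open>f\<close>.  All morphism spaces are subspaces
  of one ambient vector space (for instance of the direct sum of all of them), which may be
  assumed for every small linear category.\<close>

locale linear_category =
  fixes s :: "'k::field \<Rightarrow> 'c::ab_group_add \<Rightarrow> 'c"
    and Ob :: "'m set" and H :: "'m \<Rightarrow> 'm \<Rightarrow> 'c set"
    and cmp :: "'c \<Rightarrow> 'c \<Rightarrow> 'c" and idt :: "'m \<Rightarrow> 'c"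
  assumes vector_space: "vector_space s"
    and subspace: "\<lbrakk>a \<in> Ob; b \<in> Ob\<rbrakk> \<Longrightarrow> module.subspace s (H a b)"
    and cmp_bilinear:
      "\<lbrakk>a \<in> Ob; b \<in> Ob; c \<in> Ob\<rbrakk> \<Longrightarrow> bilinear_map_on s s s (H b c) (H a b) (H a c) cmp"
    and idt_closed: "a \<in> Ob \<Longrightarrow> idt a \<in> H a a"
    and cmp_assoc:
      "\<lbrakk>a \<in> Ob; b \<in> Ob; c \<in> Ob; d \<in> Ob; f \<in> H a b; g \<in> H b c; h \<in> H c d\<rbrakk>
        \<Longrightarrow> cmp (cmp h g) f = cmp h (cmp g f)"
    and idt_left: "\<lbrakk>a \<in> Ob; b \<in> Ob; f \<in> H a b\<rbrakk> \<Longrightarrow> cmp (idt b) f = f"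
    and idt_right: "\<lbrakk>a \<in> Ob; b \<in> Ob; f \<in> H a b\<rbrakk> \<Longrightarrow> cmp f (idt a) = f"

text \<open>\<open>S0\<close> and \<open>S1\<close> are the object and morphism part of \<open>\<Sigma>\<close>, and \<open>ser a b \<Phi> \<Psi>\<close> is the value
  of the functional \<open>\<eta>\<^sub>a\<^sub>b(\<Phi>)\<close> on \<open>Hom(b,\<Sigma>(a))\<close> at \<open>\<Psi>\<close>.\<close>

locale serre_functor = linear_category s Ob H cmp idt
  for s :: "'k::field \<Rightarrow> 'c::ab_group_add \<Rightarrow> 'c" and Ob :: "'m set" and H cmp idt +
  fixes S0 :: "'m \<Rightarrow> 'm" and S1 :: "'m \<Rightarrow> 'm \<Rightarrow> 'c \<Rightarrow> 'c"
    and ser :: "'m \<Rightarrow> 'm \<Rightarrow> 'c \<Rightarrow> 'c \<Rightarrow> 'k"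
  assumes S0_closed: "a \<in> Ob \<Longrightarrow> S0 a \<in> Ob"
    and S1_closed: "\<lbrakk>a \<in> Ob; b \<in> Ob; f \<in> H a b\<rbrakk> \<Longrightarrow> S1 a b f \<in> H (S0 a) (S0 b)"
    and S1_idt: "a \<in> Ob \<Longrightarrow> S1 a a (idt a) = idt (S0 a)"
    and S1_cmp: "\<lbrakk>a \<in> Ob; b \<in> Ob; c \<in> Ob; f \<in> H a b; g \<in> H b c\<rbrakk>
        \<Longrightarrow> S1 a c (cmp g f) = cmp (S1 b c g) (S1 a b f)"
    and ser_bilinear:
      "\<lbrakk>a \<in> Ob; b \<in> Ob\<rbrakk> \<Longrightarrow> bilinear_map_on s s (*) (H a b) (H b (S0 a)) UNIV (ser a b)"
    and ser_bijective:
      "\<lbrakk>a \<in> Ob; b \<in> Ob; linear_map_on s (*) (H b (S0 a)) UNIV \<xi>\<rbrakk>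
        \<Longrightarrow> \<exists>!\<Phi>. \<Phi> \<in> H a b \<and> (\<forall>\<Psi>\<in>H b (S0 a). ser a b \<Phi> \<Psi> = \<xi> \<Psi>)"
    and ser_natural_left:
      "\<lbrakk>a \<in> Ob; a' \<in> Ob; b \<in> Ob; h \<in> H a' a; \<Phi> \<in> H a b; \<Psi> \<in> H b (S0 a')\<rbrakk>
        \<Longrightarrow> ser a' b (cmp \<Phi> h) \<Psi> = ser a b \<Phi> (cmp (S1 a' a h) \<Psi>)"
    and ser_natural_right:
      "\<lbrakk>a \<in> Ob; b \<in> Ob; b' \<in> Ob; g \<in> H b b'; \<Phi> \<in> H a b; \<Psi> \<in> H b' (S0 a)\<rbrakk>
        \<Longrightarrow> ser a b' (cmp g \<Phi>) \<Psi> = ser a b \<Phi> (cmp \<Psi> g)"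

definition serre_pairing ::
    "('c \<Rightarrow> 'c \<Rightarrow> 'c) \<Rightarrow> ('m \<Rightarrow> 'c) \<Rightarrow> ('m \<Rightarrow> 'm \<Rightarrow> 'c \<Rightarrow> 'c \<Rightarrow> 'k) \<Rightarrow> 'm \<Rightarrow> 'm \<Rightarrow> 'c \<Rightarrow> 'c \<Rightarrow> 'k" where
  "serre_pairing cmp idt ser a b \<Psi> \<Phi> = ser a a (idt a) (cmp \<Psi> \<Phi>)"

locale calabi_yau_category = serre_functor s Ob H cmp idt "\<lambda>a. a" "\<lambda>a b f. f" ser
  for s :: "'k::field \<Rightarrow> 'c::ab_group_add \<Rightarrow> 'c" and Ob :: "'m set" and H cmp idt ser


section \<open>Linear strict 2-categories\<close>

text \<open>Objects form the type \<open>'o\<close> and 1-morphisms the type \<open>'m\<close>.  As above, all spaces of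
  2-morphisms are subspaces of one ambient vector space \<open>'c\<close> over the field \<open>'k\<close>;
  only 2-morphisms between parallel 1-morphisms exist.  Both compositions are written in
  the classical order: \<open>g \<cdot> f\<close> is \<open>g\<close> after \<open>f\<close>, and \<open>X \<otimes> Y\<close> is \<open>X\<close> after \<open>Y\<close>.  The
  horizontal composition of 2-morphisms is written \<open>\<star>\<close>.\<close>

record ('o, 'm, 'c, 'k) two_category =
  src :: "'m \<Rightarrow> 'o"
  trg :: "'m \<Rightarrow> 'o"
  unit1 :: "'o \<Rightarrow> 'm" ("\<one>\<index>")
  hcomp1 :: "'m \<Rightarrow> 'm \<Rightarrow> 'm" (infixr "\<otimes>\<index>" 75)
  hom :: "'m \<Rightarrow> 'm \<Rightarrow> 'c set"
  scl :: "'k \<Rightarrow> 'c \<Rightarrow> 'c"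
  id2 :: "'m \<Rightarrow> 'c" ("\<^bold>1\<index>")
  vcomp :: "'c \<Rightarrow> 'c \<Rightarrow> 'c" (infixr "\<cdot>\<index>" 70)
  hcomp2 :: "'c \<Rightarrow> 'c \<Rightarrow> 'c" (infixr "\<star>\<index>" 75)

definition mor :: "('o, 'm, 'c, 'k, 'z) two_category_scheme \<Rightarrow> 'o \<Rightarrow> 'o \<Rightarrow> 'm set" where
  "mor B \<alpha> \<beta> = {X. src B X = \<alpha> \<and> trg B X = \<beta>}"

definition endo :: "('o, 'm, 'c, 'k, 'z) two_category_scheme \<Rightarrow> 'm \<Rightarrow> 'c set" where
  "endo B X = hom B X X"

definition invertible2 :: "('o, 'm, 'c, 'k, 'z) two_category_scheme \<Rightarrow> 'm \<Rightarrow> 'm \<Rightarrow> 'c \<Rightarrow> bool" where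
  "invertible2 B X Y f \<longleftrightarrow> f \<in> hom B X Y \<and> (\<exists>g\<in>hom B Y X. g \<cdot> f = \<^bold>1 X \<and> f \<cdot> g = \<^bold>1 Y)"
  for B (structure)

locale linear_two_category =
  fixes B :: "('o, 'm, 'c::ab_group_add, 'k::field, 'z) two_category_scheme" (structure)
  assumes src_unit1: "src B (\<one> \<alpha>) = \<alpha>"
    and trg_unit1: "trg B (\<one> \<alpha>) = \<alpha>"
    and src_hcomp1: "src B X = trg B Y \<Longrightarrow> src B (X \<otimes> Y) = src B Y"
    and trg_hcomp1: "src B X = trg B Y \<Longrightarrow> trg B (X \<otimes> Y) = trg B X"
    and hcomp1_assoc:
      "\<lbrakk>src B X = trg B Y; src B Y = trg B Z\<rbrakk> \<Longrightarrow> (X \<otimes> Y) \<otimes> Z = X \<otimes> (Y \<otimes> Z)"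
    and unit1_left: "\<one> (trg B X) \<otimes> X = X"
    and unit1_right: "X \<otimes> \<one> (src B X) = X"
    and vector_space: "vector_space (scl B)"
    and hom_parallel: "f \<in> hom B X Y \<Longrightarrow> src B X = src B Y \<and> trg B X = trg B Y"
    and hom_subspace:
      "\<lbrakk>src B X = src B Y; trg B X = trg B Y\<rbrakk> \<Longrightarrow> module.subspace (scl B) (hom B X Y)"
    and id2_closed: "\<^bold>1 X \<in> hom B X X"
    and vcomp_closed: "\<lbrakk>f \<in> hom B X Y; g \<in> hom B Y Z\<rbrakk> \<Longrightarrow> g \<cdot> f \<in> hom B X Z"
    and vcomp_assoc:
      "\<lbrakk>f \<in> hom B W X; g \<in> hom B X Y; h \<in> hom B Y Z\<rbrakk> \<Longrightarrow> (h \<cdot> g) \<cdot> f = h \<cdot> (g \<cdot> f)"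
    and id2_left: "f \<in> hom B X Y \<Longrightarrow> \<^bold>1 Y \<cdot> f = f"
    and id2_right: "f \<in> hom B X Y \<Longrightarrow> f \<cdot> \<^bold>1 X = f"
    and vcomp_bilinear:
      "\<lbrakk>X \<in> mor B \<alpha> \<beta>; Y \<in> mor B \<alpha> \<beta>; Z \<in> mor B \<alpha> \<beta>\<rbrakk> \<Longrightarrow>
        bilinear_map_on (scl B) (scl B) (scl B) (hom B Y Z) (hom B X Y) (hom B X Z) (vcomp B)"
    and hcomp2_closed:
      "\<lbrakk>f \<in> hom B X X'; g \<in> hom B Y Y'; src B X = trg B Y\<rbrakk>
        \<Longrightarrow> f \<star> g \<in> hom B (X \<otimes> Y) (X' \<otimes> Y')"
    and hcomp2_assoc:
      "\<lbrakk>f \<in> hom B X X'; g \<in> hom B Y Y'; h \<in> hom B Z Z'; src B X = trg B Y; src B Y = trg B Z\<rbrakk>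
        \<Longrightarrow> (f \<star> g) \<star> h = f \<star> (g \<star> h)"
    and hcomp2_unit_left: "f \<in> hom B X Y \<Longrightarrow> \<^bold>1 (\<one> (trg B X)) \<star> f = f"
    and hcomp2_unit_right: "f \<in> hom B X Y \<Longrightarrow> f \<star> \<^bold>1 (\<one> (src B X)) = f"
    and hcomp2_id2: "src B X = trg B Y \<Longrightarrow> \<^bold>1 X \<star> \<^bold>1 Y = \<^bold>1 (X \<otimes> Y)"
    and interchange:
      "\<lbrakk>f \<in> hom B X X'; f' \<in> hom B X' X''; g \<in> hom B Y Y'; g' \<in> hom B Y' Y''; src B X = trg B Y\<rbrakk>
        \<Longrightarrow> (f' \<cdot> f) \<star> (g' \<cdot> g) = (f' \<star> g') \<cdot> (f \<star> g)"
    and hcomp2_bilinear: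
      "\<lbrakk>X \<in> mor B \<beta> \<gamma>; X' \<in> mor B \<beta> \<gamma>; Y \<in> mor B \<alpha> \<beta>; Y' \<in> mor B \<alpha> \<beta>\<rbrakk> \<Longrightarrow>
        bilinear_map_on (scl B) (scl B) (scl B)
          (hom B X X') (hom B Y Y') (hom B (X \<otimes> Y) (X' \<otimes> Y')) (hcomp2 B)"


section \<open>Pivotal structure and traces\<close>

text \<open>\<open>X\<^sup>\<dagger>\<close> is both the left and the right adjoint of \<open>X\<close>; \<open>ev X\<close> and \<open>coev X\<close> exhibit it as left
  adjoint, \<open>evt X\<close> and \<open>coevt X\<close> (usually written with a tilde) as right adjoint.\<close>

record ('o, 'm, 'c, 'k) pivotal_two_category = "('o, 'm, 'c, 'k) two_category" +
  dag :: "'m \<Rightarrow> 'm" ("_\<^sup>\<dagger>\<index>" [1000] 1000)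
  left_ev :: "'m \<Rightarrow> 'c" ("ev\<index>")
  left_coev :: "'m \<Rightarrow> 'c" ("coev\<index>")
  right_ev :: "'m \<Rightarrow> 'c" ("evt\<index>")
  right_coev :: "'m \<Rightarrow> 'c" ("coevt\<index>")

text \<open>The comparison \<open>(Y \<otimes> X)\<^sup>\<dagger> \<rightarrow> X\<^sup>\<dagger> \<otimes> Y\<^sup>\<dagger>\<close> built from the right adjunctions.\<close>

definition dag_comp ::
    "('o, 'm, 'c, 'k, 'z) pivotal_two_category_scheme \<Rightarrow> 'm \<Rightarrow> 'm \<Rightarrow> 'c" where
  "dag_comp B Y X =
     (\<^bold>1 (X\<^sup>\<dagger> \<otimes> Y\<^sup>\<dagger>) \<star> evt (Y \<otimes> X))
       \<cdot> (\<^bold>1 (X\<^sup>\<dagger>) \<star> coevt Y \<star> \<^bold>1 (X \<otimes> (Y \<otimes> X)\<^sup>\<dagger>))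
       \<cdot> (coevt X \<star> \<^bold>1 ((Y \<otimes> X)\<^sup>\<dagger>))"
  for B (structure)

locale linear_pivotal_two_category = linear_two_category B
  for B :: "('o, 'm, 'c::ab_group_add, 'k::field, 'z) pivotal_two_category_scheme" (structure) +
  assumes src_dag: "src B (X\<^sup>\<dagger>) = trg B X"
    and trg_dag: "trg B (X\<^sup>\<dagger>) = src B X"
    and ev_closed: "ev X \<in> hom B (X\<^sup>\<dagger> \<otimes> X) (\<one> (src B X))"
    and coev_closed: "coev X \<in> hom B (\<one> (trg B X)) (X \<otimes> X\<^sup>\<dagger>)"
    and evt_closed: "evt X \<in> hom B (X \<otimes> X\<^sup>\<dagger>) (\<one> (trg B X))"
    and coevt_closed: "coevt X \<in> hom B (\<one> (src B X)) (X\<^sup>\<dagger> \<otimes> X)"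
    and zigzag_left1: "(\<^bold>1 X \<star> ev X) \<cdot> (coev X \<star> \<^bold>1 X) = \<^bold>1 X"
    and zigzag_left2: "(ev X \<star> \<^bold>1 (X\<^sup>\<dagger>)) \<cdot> (\<^bold>1 (X\<^sup>\<dagger>) \<star> coev X) = \<^bold>1 (X\<^sup>\<dagger>)"
    and zigzag_right1: "(evt X \<star> \<^bold>1 X) \<cdot> (\<^bold>1 X \<star> coevt X) = \<^bold>1 X"
    and zigzag_right2: "(\<^bold>1 (X\<^sup>\<dagger>) \<star> evt X) \<cdot> (coevt X \<star> \<^bold>1 (X\<^sup>\<dagger>)) = \<^bold>1 (X\<^sup>\<dagger>)"
    and pivotal_mates:
      "\<Phi> \<in> hom B X Z \<Longrightarrow>
        (ev Z \<star> \<^bold>1 (X\<^sup>\<dagger>)) \<cdot> (\<^bold>1 (Z\<^sup>\<dagger>) \<star> \<Phi> \<star> \<^bold>1 (X\<^sup>\<dagger>)) \<cdot> (\<^bold>1 (Z\<^sup>\<dagger>) \<star> coev X)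
        = (\<^bold>1 (X\<^sup>\<dagger>) \<star> evt Z) \<cdot> (\<^bold>1 (X\<^sup>\<dagger>) \<star> \<Phi> \<star> \<^bold>1 (Z\<^sup>\<dagger>)) \<cdot> (coevt X \<star> \<^bold>1 (Z\<^sup>\<dagger>))"
    and pivotal_hcomp:
      "src B Y = trg B X \<Longrightarrow>
        dag_comp B Y X
        = (ev (Y \<otimes> X) \<star> \<^bold>1 (X\<^sup>\<dagger> \<otimes> Y\<^sup>\<dagger>))
            \<cdot> (\<^bold>1 ((Y \<otimes> X)\<^sup>\<dagger> \<otimes> Y) \<star> coev X \<star> \<^bold>1 (Y\<^sup>\<dagger>))
            \<cdot> (\<^bold>1 ((Y \<otimes> X)\<^sup>\<dagger>) \<star> coev Y)"

definition left_trace ::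
    "('o, 'm, 'c, 'k, 'z) pivotal_two_category_scheme \<Rightarrow> 'm \<Rightarrow> 'c \<Rightarrow> 'c" ("tr\<^sub>l\<index>") where
  "tr\<^sub>l X \<Psi> = ev X \<cdot> (\<^bold>1 (X\<^sup>\<dagger>) \<star> \<Psi>) \<cdot> coevt X"
  for B (structure)

definition right_trace ::
    "('o, 'm, 'c, 'k, 'z) pivotal_two_category_scheme \<Rightarrow> 'm \<Rightarrow> 'c \<Rightarrow> 'c" ("tr\<^sub>r\<index>") where
  "tr\<^sub>r X \<Psi> = evt X \<cdot> (\<Psi> \<star> \<^bold>1 (X\<^sup>\<dagger>)) \<cdot> coev X"
  for B (structure)

text \<open>A strict linear 2-functor from \<open>B\<close> to itself, given on objects, 1-morphisms and
  2-morphisms, which preserves the chosen adjunctions.\<close>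

locale linear_pivotal_endofunctor = linear_pivotal_two_category B
  for B :: "('o, 'm, 'c::ab_group_add, 'k::field, 'z) pivotal_two_category_scheme" (structure) +
  fixes F0 :: "'o \<Rightarrow> 'o" and F1 :: "'m \<Rightarrow> 'm" and F2 :: "'c \<Rightarrow> 'c"
  assumes src_F1: "src B (F1 X) = F0 (src B X)"
    and trg_F1: "trg B (F1 X) = F0 (trg B X)"
    and F1_unit1: "F1 (\<one> \<alpha>) = \<one> (F0 \<alpha>)"
    and F1_hcomp1: "src B X = trg B Y \<Longrightarrow> F1 (X \<otimes> Y) = F1 X \<otimes> F1 Y"
    and F2_linear:
      "\<lbrakk>src B X = src B Y; trg B X = trg B Y\<rbrakk>
        \<Longrightarrow> linear_map_on (scl B) (scl B) (hom B X Y) (hom B (F1 X) (F1 Y)) F2"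
    and F2_id2: "F2 (\<^bold>1 X) = \<^bold>1 (F1 X)"
    and F2_vcomp: "\<lbrakk>f \<in> hom B X Y; g \<in> hom B Y Z\<rbrakk> \<Longrightarrow> F2 (g \<cdot> f) = F2 g \<cdot> F2 f"
    and F2_hcomp2:
      "\<lbrakk>f \<in> hom B X X'; g \<in> hom B Y Y'; src B X = trg B Y\<rbrakk> \<Longrightarrow> F2 (f \<star> g) = F2 f \<star> F2 g"
    and F1_dag: "F1 (X\<^sup>\<dagger>) = (F1 X)\<^sup>\<dagger>"
    and F2_ev: "F2 (ev X) = ev (F1 X)"
    and F2_coev: "F2 (coev X) = coev (F1 X)"
    and F2_evt: "F2 (evt X) = evt (F1 X)"
    and F2_coevt: "F2 (coevt X) = coevt (F1 X)"


section \<open>Monoidal structure with duals\<close>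

text \<open>The functor that sends \<open>x\<close> to \<open>\<alpha> \<box> x\<close> is written \<open>\<alpha> \<rhd> X\<close> on 1-morphisms and \<open>\<alpha> \<unrhd> f\<close> on
  2-morphisms; the one that sends \<open>x\<close> to \<open>x \<box> \<alpha>\<close> is written \<open>X \<lhd> \<alpha>\<close> and \<open>f \<unlhd> \<alpha>\<close>.
  \<open>\<sigma> X Y\<close> is the interchange 2-morphism, \<open>\<eta> \<alpha>\<close> the fold and \<open>triang B \<alpha>\<close> the triangulator.\<close>

record ('o, 'm, 'c, 'k) gray_monoid = "('o, 'm, 'c, 'k) pivotal_two_category" +
  munit :: 'o ("\<O>\<index>")
  box :: "'o \<Rightarrow> 'o \<Rightarrow> 'o" (infixr "\<box>\<index>" 85)
  lbox1 :: "'o \<Rightarrow> 'm \<Rightarrow> 'm" (infixr "\<rhd>\<index>" 80)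
  rbox1 :: "'m \<Rightarrow> 'o \<Rightarrow> 'm" (infixl "\<lhd>\<index>" 81)
  lbox2 :: "'o \<Rightarrow> 'c \<Rightarrow> 'c" (infixr "\<unrhd>\<index>" 80)
  rbox2 :: "'c \<Rightarrow> 'o \<Rightarrow> 'c" (infixl "\<unlhd>\<index>" 81)
  sigma :: "'m \<Rightarrow> 'm \<Rightarrow> 'c" ("\<sigma>\<index>")

record ('o, 'm, 'c, 'k) gray_monoid_with_duals = "('o, 'm, 'c, 'k) gray_monoid" +
  dual :: "'o \<Rightarrow> 'o" ("_\<^sup>#\<index>" [1000] 1000)
  fold1 :: "'o \<Rightarrow> 'm" ("\<eta>\<index>")
  triang :: "'o \<Rightarrow> 'c"

text \<open>A Gray category with a single object, i.e. a strict 2-category with the structure of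
  a Gray monoid, whose functors \<open>\<alpha> \<box> -\<close> and \<open>- \<box> \<alpha>\<close> preserve the linear and pivotal structure.\<close>

locale linear_pivotal_gray_monoid = linear_pivotal_two_category B
  for B :: "('o, 'm, 'c::ab_group_add, 'k::field, 'z) gray_monoid_scheme" (structure) +
  assumes lbox_functor: "linear_pivotal_endofunctor B (\<lambda>\<beta>. \<alpha> \<box> \<beta>) (\<lambda>X. \<alpha> \<rhd> X) (\<lambda>f. \<alpha> \<unrhd> f)"
    and rbox_functor: "linear_pivotal_endofunctor B (\<lambda>\<beta>. \<beta> \<box> \<alpha>) (\<lambda>X. X \<lhd> \<alpha>) (\<lambda>f. f \<unlhd> \<alpha>)"
    and box_assoc: "(\<alpha> \<box> \<beta>) \<box> \<gamma> = \<alpha> \<box> (\<beta> \<box> \<gamma>)"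
    and lbox1_lbox1: "(\<alpha> \<box> \<beta>) \<rhd> X = \<alpha> \<rhd> (\<beta> \<rhd> X)"
    and rbox1_rbox1: "X \<lhd> (\<alpha> \<box> \<beta>) = (X \<lhd> \<alpha>) \<lhd> \<beta>"
    and lbox1_rbox1: "(\<alpha> \<rhd> X) \<lhd> \<beta> = \<alpha> \<rhd> (X \<lhd> \<beta>)"
    and lbox2_lbox2: "f \<in> hom B X Y \<Longrightarrow> (\<alpha> \<box> \<beta>) \<unrhd> f = \<alpha> \<unrhd> (\<beta> \<unrhd> f)"
    and rbox2_rbox2: "f \<in> hom B X Y \<Longrightarrow> f \<unlhd> (\<alpha> \<box> \<beta>) = (f \<unlhd> \<alpha>) \<unlhd> \<beta>"
    and lbox2_rbox2: "f \<in> hom B X Y \<Longrightarrow> (\<alpha> \<unrhd> f) \<unlhd> \<beta> = \<alpha> \<unrhd> (f \<unlhd> \<beta>)"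
    and box_unit_left: "\<O> \<box> \<alpha> = \<alpha>"
    and box_unit_right: "\<alpha> \<box> \<O> = \<alpha>"
    and lbox1_unit: "\<O> \<rhd> X = X"
    and rbox1_unit: "X \<lhd> \<O> = X"
    and lbox2_unit: "f \<in> hom B X Y \<Longrightarrow> \<O> \<unrhd> f = f"
    and rbox2_unit: "f \<in> hom B X Y \<Longrightarrow> f \<unlhd> \<O> = f"
    and sigma_invertible:
      "\<lbrakk>X \<in> mor B \<alpha> \<alpha>'; Y \<in> mor B \<beta> \<beta>'\<rbrakk> \<Longrightarrow>
        invertible2 B ((X \<lhd> \<beta>') \<otimes> (\<alpha> \<rhd> Y)) ((\<alpha>' \<rhd> Y) \<otimes> (X \<lhd> \<beta>)) (\<sigma> X Y)"
    and sigma_natural: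
      "\<lbrakk>X \<in> mor B \<alpha> \<alpha>'; X' \<in> mor B \<alpha> \<alpha>'; Y \<in> mor B \<beta> \<beta>'; Y' \<in> mor B \<beta> \<beta>';
        f \<in> hom B X X'; g \<in> hom B Y Y'\<rbrakk> \<Longrightarrow>
        \<sigma> X' Y' \<cdot> ((f \<unlhd> \<beta>') \<star> (\<alpha> \<unrhd> g)) = ((\<alpha>' \<unrhd> g) \<star> (f \<unlhd> \<beta>)) \<cdot> \<sigma> X Y"
    and sigma_unit_left: "Y \<in> mor B \<beta> \<beta>' \<Longrightarrow> \<sigma> (\<one> \<alpha>) Y = \<^bold>1 (\<alpha> \<rhd> Y)"
    and sigma_unit_right: "X \<in> mor B \<alpha> \<alpha>' \<Longrightarrow> \<sigma> X (\<one> \<beta>) = \<^bold>1 (X \<lhd> \<beta>)"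
    and sigma_hcomp_left:
      "\<lbrakk>X \<in> mor B \<alpha> \<alpha>'; X' \<in> mor B \<alpha>' \<alpha>''; Y \<in> mor B \<beta> \<beta>'\<rbrakk> \<Longrightarrow>
        \<sigma> (X' \<otimes> X) Y = (\<sigma> X' Y \<star> \<^bold>1 (X \<lhd> \<beta>)) \<cdot> (\<^bold>1 (X' \<lhd> \<beta>') \<star> \<sigma> X Y)"
    and sigma_hcomp_right:
      "\<lbrakk>X \<in> mor B \<alpha> \<alpha>'; Y \<in> mor B \<beta> \<beta>'; Y' \<in> mor B \<beta>' \<beta>''\<rbrakk> \<Longrightarrow>
        \<sigma> X (Y' \<otimes> Y) = (\<^bold>1 (\<alpha>' \<rhd> Y') \<star> \<sigma> X Y) \<cdot> (\<sigma> X Y' \<star> \<^bold>1 (\<alpha> \<rhd> Y))"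
    and sigma_lbox: "\<sigma> (\<gamma> \<rhd> X) Y = \<gamma> \<unrhd> \<sigma> X Y"
    and sigma_mid: "\<sigma> (X \<lhd> \<gamma>) Y = \<sigma> X (\<gamma> \<rhd> Y)"
    and sigma_rbox: "\<sigma> X (Y \<lhd> \<gamma>) = \<sigma> X Y \<unlhd> \<gamma>"

text \<open>\<open>T\<^sub>\<alpha>\<^sup>\<dagger> : 1\<^sub>\<alpha> \<rightarrow> (\<alpha> \<box> \<eta>\<^sub>\<alpha>\<^sub>#\<^sup>\<dagger>) \<otimes> (\<eta>\<^sub>\<alpha> \<box> \<alpha>)\<close>, the mate of the triangulator \<open>T\<^sub>\<alpha>\<close> under the right
  adjunction of \<open>\<alpha> \<box> \<eta>\<^sub>\<alpha>\<^sub>#\<close> and the left adjunction of \<open>\<eta>\<^sub>\<alpha> \<box> \<alpha>\<close>.  It is literally \<open>T\<^sub>\<alpha>\<^sup>\<dagger>\<close> when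
  \<open>X\<^sup>\<dagger>\<^sup>\<dagger> = X\<close>, \<open>(X \<otimes> Y)\<^sup>\<dagger> = Y\<^sup>\<dagger> \<otimes> X\<^sup>\<dagger>\<close> and \<open>1\<^sup>\<dagger> = 1\<close> hold strictly.\<close>

definition triang_mate ::
    "('o, 'm, 'c, 'k, 'z) gray_monoid_with_duals_scheme \<Rightarrow> 'o \<Rightarrow> 'c" where
  "triang_mate B \<alpha> =
     (\<^bold>1 ((\<alpha> \<rhd> \<eta> (\<alpha>\<^sup>#))\<^sup>\<dagger> \<otimes> (\<eta> \<alpha> \<lhd> \<alpha>)) \<star> triang B \<alpha>)
       \<cdot> (\<^bold>1 ((\<alpha> \<rhd> \<eta> (\<alpha>\<^sup>#))\<^sup>\<dagger>) \<star> (coev (\<eta> \<alpha>) \<unlhd> \<alpha>) \<star> \<^bold>1 (\<alpha> \<rhd> \<eta> (\<alpha>\<^sup>#)))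
       \<cdot> coevt (\<alpha> \<rhd> \<eta> (\<alpha>\<^sup>#))"
  for B (structure)

text \<open>Compatibility of the triangulator with \<open>\<box>\<close> and units: in a pivotal 2-category the canonical
  isomorphisms \<open>1\<^sup>\<dagger> \<rightarrow> 1\<close> (namely \<open>ev\<close>) and \<open>(Y \<otimes> X)\<^sup>\<dagger> \<rightarrow> X\<^sup>\<dagger> \<otimes> Y\<^sup>\<dagger>\<close> (namely \<open>dag_comp\<close>)
  need not be identities, and therefore appear explicitly.\<close>

locale linear_gray_monoid_with_duals = linear_pivotal_gray_monoid B
  for B :: "('o, 'm, 'c::ab_group_add, 'k::field, 'z) gray_monoid_with_duals_scheme" (structure) +
  assumes dual_dual: "\<alpha>\<^sup>#\<^sup># = \<alpha>"
    and dual_unit: "\<O>\<^sup># = \<O>"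
    and dual_box: "(\<alpha> \<box> \<beta>)\<^sup># = \<beta>\<^sup># \<box> \<alpha>\<^sup>#"
    and fold_closed: "\<eta> \<alpha> \<in> mor B \<O> (\<alpha> \<box> \<alpha>\<^sup>#)"
    and fold_unit: "\<eta> \<O> = \<one> \<O>"
    and fold_box: "\<eta> (\<alpha> \<box> \<beta>) = (\<alpha> \<rhd> (\<eta> \<beta> \<lhd> \<alpha>\<^sup>#)) \<otimes> \<eta> \<alpha>"
    and triang_invertible:
      "invertible2 B (((\<eta> \<alpha>)\<^sup>\<dagger> \<lhd> \<alpha>) \<otimes> (\<alpha> \<rhd> \<eta> (\<alpha>\<^sup>#))) (\<one> \<alpha>) (triang B \<alpha>)"
    and triang_unit: "triang B \<O> = ev (\<one> \<O>)"
    and triang_box: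
      "triang B (\<alpha> \<box> \<beta>) =
        ((triang B \<alpha> \<unlhd> \<beta>) \<star> (\<alpha> \<unrhd> triang B \<beta>))
          \<cdot> (\<^bold>1 ((\<eta> \<alpha>)\<^sup>\<dagger> \<lhd> (\<alpha> \<box> \<beta>))
              \<star> (\<alpha> \<unrhd> (\<sigma> ((\<eta> \<beta>)\<^sup>\<dagger>) (\<eta> (\<alpha>\<^sup>#)) \<unlhd> \<beta>))
              \<star> \<^bold>1 ((\<alpha> \<box> \<beta>) \<rhd> \<eta> (\<beta>\<^sup>#)))
          \<cdot> ((dag_comp B (\<alpha> \<rhd> (\<eta> \<beta> \<lhd> \<alpha>\<^sup>#)) (\<eta> \<alpha>) \<unlhd> (\<alpha> \<box> \<beta>))
              \<star> \<^bold>1 ((\<alpha> \<box> \<beta>) \<rhd> \<eta> ((\<alpha> \<box> \<beta>)\<^sup>#)))"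
    and swallowtail:
      "((\<alpha> \<unrhd> triang B (\<alpha>\<^sup>#)) \<star> \<^bold>1 (\<eta> \<alpha>))
         \<cdot> (\<^bold>1 (\<alpha> \<rhd> ((\<eta> (\<alpha>\<^sup>#))\<^sup>\<dagger> \<lhd> \<alpha>\<^sup>#)) \<star> \<sigma> (\<eta> \<alpha>) (\<eta> \<alpha>))
         \<cdot> ((triang_mate B \<alpha> \<unlhd> \<alpha>\<^sup>#) \<star> \<^bold>1 (\<eta> \<alpha>))
       = \<^bold>1 (\<eta> \<alpha>)"


section \<open>Equivalence with the category of finite-dimensional vector spaces\<close>

text \<open>Every finite-dimensional \<open>'k\<close>-vector space is isomorphic to a subspace of the space of
  sequences in \<open>'k\<close>; the category of vector spaces is represented by its (equivalent)
  full subcategory on these subspaces.\<close>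

definition seq_scl :: "'k::field \<Rightarrow> (nat \<Rightarrow> 'k) \<Rightarrow> (nat \<Rightarrow> 'k)" where
  "seq_scl c v = (\<lambda>n. c * v n)"

abbreviation Vect :: "(nat \<Rightarrow> 'k::field) set set" where
  "Vect \<equiv> {V. fin_dim_subspace seq_scl V}"

abbreviation Vect_hom ::
    "(nat \<Rightarrow> 'k::field) set \<Rightarrow> (nat \<Rightarrow> 'k) set \<Rightarrow> ((nat \<Rightarrow> 'k) \<Rightarrow> (nat \<Rightarrow> 'k)) \<Rightarrow> bool" where
  "Vect_hom \<equiv> linear_map_on seq_scl seq_scl"

text \<open>\<open>T\<close> together with the bilinear map \<open>\<mu>\<close> is a tensor product of \<open>V\<close> and \<open>W\<close>.\<close>

definition is_tensor_product ::
    "(nat \<Rightarrow> 'k::field) set \<Rightarrow> (nat \<Rightarrow> 'k) set \<Rightarrow> (nat \<Rightarrow> 'k) set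
      \<Rightarrow> ((nat \<Rightarrow> 'k) \<Rightarrow> (nat \<Rightarrow> 'k) \<Rightarrow> (nat \<Rightarrow> 'k)) \<Rightarrow> bool" where
  "is_tensor_product V W T \<mu> \<longleftrightarrow>
     bilinear_map_on seq_scl seq_scl seq_scl V W T \<mu> \<and>
     (\<forall>U\<in>Vect. \<forall>b. bilinear_map_on seq_scl seq_scl seq_scl V W U b \<longrightarrow>
        (\<exists>g. Vect_hom T U g \<and> (\<forall>v\<in>V. \<forall>w\<in>W. g (\<mu> v w) = b v w) \<and>
          (\<forall>g'. Vect_hom T U g' \<and> (\<forall>v\<in>V. \<forall>w\<in>W. g' (\<mu> v w) = b v w) \<longrightarrow> (\<forall>t\<in>T. g' t = g t))))"

text \<open>A linear strong monoidal functor from \<open>B(\<O>,\<O>)\<close> to finite-dimensional vector spaces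
  which is fully faithful and essentially surjective.  The structure isomorphisms
  \<open>V X \<otimes>\<^sub>k V Y \<rightarrow> V (X \<otimes> Y)\<close> are given by the bilinear maps \<open>\<mu> X Y\<close>, which makes coherence
  an equation between elements, and \<open>k \<rightarrow> V \<one>\<^sub>\<O>\<close> is given by the image \<open>e\<close> of \<open>1\<close>.\<close>

locale Vect_equivalence =
  fixes B :: "('o, 'm, 'c::ab_group_add, 'k::field, 'z) gray_monoid_scheme" (structure)
    and V :: "'m \<Rightarrow> (nat \<Rightarrow> 'k) set"
    and F :: "'m \<Rightarrow> 'm \<Rightarrow> 'c \<Rightarrow> (nat \<Rightarrow> 'k) \<Rightarrow> (nat \<Rightarrow> 'k)"
    and \<mu> :: "'m \<Rightarrow> 'm \<Rightarrow> (nat \<Rightarrow> 'k) \<Rightarrow> (nat \<Rightarrow> 'k) \<Rightarrow> (nat \<Rightarrow> 'k)"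
    and e :: "nat \<Rightarrow> 'k"
  assumes V_closed: "X \<in> mor B \<O> \<O> \<Longrightarrow> V X \<in> Vect"
    and F_closed:
      "\<lbrakk>X \<in> mor B \<O> \<O>; Y \<in> mor B \<O> \<O>; f \<in> hom B X Y\<rbrakk> \<Longrightarrow> Vect_hom (V X) (V Y) (F X Y f)"
    and F_id2: "\<lbrakk>X \<in> mor B \<O> \<O>; v \<in> V X\<rbrakk> \<Longrightarrow> F X X (\<^bold>1 X) v = v"
    and F_vcomp:
      "\<lbrakk>X \<in> mor B \<O> \<O>; f \<in> hom B X Y; g \<in> hom B Y Z; v \<in> V X\<rbrakk>
        \<Longrightarrow> F X Z (g \<cdot> f) v = F Y Z g (F X Y f v)"
    and F_linear:
      "\<lbrakk>X \<in> mor B \<O> \<O>; Y \<in> mor B \<O> \<O>; v \<in> V X\<rbrakk>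
        \<Longrightarrow> linear_map_on (scl B) seq_scl (hom B X Y) (V Y) (\<lambda>f. F X Y f v)"
    and fully_faithful:
      "\<lbrakk>X \<in> mor B \<O> \<O>; Y \<in> mor B \<O> \<O>; Vect_hom (V X) (V Y) h\<rbrakk>
        \<Longrightarrow> \<exists>!f. f \<in> hom B X Y \<and> (\<forall>v\<in>V X. F X Y f v = h v)"
    and essentially_surjective:
      "W \<in> Vect \<Longrightarrow> \<exists>X\<in>mor B \<O> \<O>. \<exists>g. Vect_hom (V X) W g \<and> bij_betw g (V X) W"
    and mu_tensor:
      "\<lbrakk>X \<in> mor B \<O> \<O>; Y \<in> mor B \<O> \<O>\<rbrakk> \<Longrightarrow> is_tensor_product (V X) (V Y) (V (X \<otimes> Y)) (\<mu> X Y)"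
    and mu_natural:
      "\<lbrakk>X \<in> mor B \<O> \<O>; Y \<in> mor B \<O> \<O>; f \<in> hom B X X'; g \<in> hom B Y Y'; v \<in> V X; w \<in> V Y\<rbrakk>
        \<Longrightarrow> F (X \<otimes> Y) (X' \<otimes> Y') (f \<star> g) (\<mu> X Y v w) = \<mu> X' Y' (F X X' f v) (F Y Y' g w)"
    and mu_assoc:
      "\<lbrakk>X \<in> mor B \<O> \<O>; Y \<in> mor B \<O> \<O>; Z \<in> mor B \<O> \<O>; u \<in> V X; v \<in> V Y; w \<in> V Z\<rbrakk>
        \<Longrightarrow> \<mu> (X \<otimes> Y) Z (\<mu> X Y u v) w = \<mu> X (Y \<otimes> Z) u (\<mu> Y Z v w)"
    and unit_iso: "bij_betw (\<lambda>c. seq_scl c e) UNIV (V (\<one> \<O>))"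
    and mu_unit_left: "\<lbrakk>X \<in> mor B \<O> \<O>; v \<in> V X\<rbrakk> \<Longrightarrow> \<mu> (\<one> \<O>) X e v = v"
    and mu_unit_right: "\<lbrakk>X \<in> mor B \<O> \<O>; v \<in> V X\<rbrakk> \<Longrightarrow> \<mu> X (\<one> \<O>) v e = v"

definition unit_category_equiv_Vect ::
    "('o, 'm, 'c::ab_group_add, 'k::field, 'z) gray_monoid_scheme \<Rightarrow> bool" where
  "unit_category_equiv_Vect B \<longleftrightarrow> (\<exists>V F \<mu> e. Vect_equivalence B V F \<mu> e)"


section \<open>The pairing on endomorphisms of a unit 1-morphism\<close>

text \<open>The identification of \<open>End(1\<^sub>\<O>)\<close> with the ground field.\<close>

definition scalar_of ::
    "('o, 'm, 'c, 'k, 'z) gray_monoid_scheme \<Rightarrow> 'c \<Rightarrow> 'k" where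
  "scalar_of B f = (THE c. f = scl B c (\<^bold>1 (\<one> \<O>)))"
  for B (structure)

definition tilde ::
    "('o, 'm, 'c, 'k, 'z) gray_monoid_with_duals_scheme \<Rightarrow> 'o \<Rightarrow> 'c \<Rightarrow> 'c" where
  "tilde B \<alpha> \<phi> = (\<phi> \<unlhd> \<alpha>\<^sup>#) \<star> \<^bold>1 (\<eta> \<alpha>)"
  for B (structure)

definition unit_pairing ::
    "('o, 'm, 'c, 'k, 'z) gray_monoid_with_duals_scheme \<Rightarrow> 'o \<Rightarrow> 'c \<Rightarrow> 'c \<Rightarrow> 'k" where
  "unit_pairing B \<alpha> \<phi>\<^sub>1 \<phi>\<^sub>2 = scalar_of B (tr\<^sub>l (\<eta> \<alpha>) (tilde B \<alpha> \<phi>\<^sub>1 \<cdot> tilde B \<alpha> \<phi>\<^sub>2))"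
  for B (structure)

definition unit_average ::
    "('o, 'm, 'c, 'k, 'z) gray_monoid_with_duals_scheme \<Rightarrow> 'o \<Rightarrow> 'c \<Rightarrow> 'k" where
  "unit_average B \<alpha> \<phi> = unit_pairing B \<alpha> \<phi> (\<^bold>1 (\<one> \<alpha>))"
  for B (structure)

section \<open>Pairings and maps on endomorphisms of 1-morphisms from the unit object\<close>

text \<open>The pairing \<open>\<langle>\<Phi>,\<Psi>\<rangle>\<^sub>Y\<^sub>X\<close> of \<open>\<Phi> : X \<rightarrow> Y\<close> and \<open>\<Psi> : Y \<rightarrow> X\<close>.\<close>

definition hom_pairing ::
    "('o, 'm, 'c, 'k, 'z) gray_monoid_scheme \<Rightarrow> 'm \<Rightarrow> 'm \<Rightarrow> 'c \<Rightarrow> 'c \<Rightarrow> 'k" where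
  "hom_pairing B Y X \<Phi> \<Psi> = scalar_of B (tr\<^sub>l X (\<Psi> \<cdot> \<Phi>))"
  for B (structure)

text \<open>\<open>bulk_boundary B X\<close> is \<open>\<beta>\<^sub>X\<close> and \<open>boundary_bulk B X\<close> is \<open>\<beta>\<^sup>X\<close>.\<close>

definition bulk_boundary ::
    "('o, 'm, 'c, 'k, 'z) two_category_scheme \<Rightarrow> 'm \<Rightarrow> 'c \<Rightarrow> 'c" where
  "bulk_boundary B X \<phi> = \<phi> \<star> \<^bold>1 X"
  for B (structure)

definition boundary_bulk ::
    "('o, 'm, 'c, 'k, 'z) pivotal_two_category_scheme \<Rightarrow> 'm \<Rightarrow> 'c \<Rightarrow> 'c" where
  "boundary_bulk B X \<Psi> = tr\<^sub>r X \<Psi>"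
  for B (structure)

end

theory Submission
  imports Defs
begin

text \<open>Adjunction identifies \<open>Hom(X,Y)\<close> with \<open>Hom(1, X\<^sup>\<dagger> \<otimes> Y)\<close> and \<open>Hom(Y,X)\<close> with \<open>Hom(X\<^sup>\<dagger> \<otimes> Y, 1)\<close>, and
  turns \<open>tr\<^sub>l(\<Psi>\<Phi>)\<close> into composition.  For \<open>X, Y : \<O> \<rightarrow> \<alpha>\<close> the 1-morphism \<open>X\<^sup>\<dagger> \<otimes> Y\<close> is a
  finite-dimensional vector space, so the trace pairing is perfect and \<open>1 = \<Sum>\<^sub>i w\<^sub>i \<circ> u\<^sub>i\<close> for dual bases
  \<open>w\<^sub>i, u\<^sub>i\<close>, which correspond to dual bases \<open>v\<^sub>i, v'\<^sub>i\<close> of the two \<open>Hom\<close>-spaces.  Cutting the annulus along this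
  identity gives \<open>\<beta>\<^sub>Y(\<beta>\<^sup>X(\<Phi>)) = \<Sum>\<^sub>i v\<^sub>i \<Phi> v'\<^sub>i\<close>; together with the adjointness of \<open>\<beta>\<^sub>Y\<close> and \<open>\<beta>\<^sup>Y\<close>, which is the
  hypothesis on traces, this is the Cardy condition.  The pairing on \<open>End(1\<^sub>\<alpha>)\<close> is
  nondegenerate because duality makes \<open>End(1\<^sub>\<alpha>) \<rightarrow> End(\<eta>\<^sub>\<alpha>)\<close> bijective.\<close>

section \<open>Linear algebra on subspaces\<close>

text \<open>No finite dimension of Hom(X,Y) is assumed; it is drawn from \<open>Vect\<close> as a
  finite expansion of every 2-morphism in elements v_b, with coefficients given by traces against
  v'_b. This one device yields finite dimension, nondegeneracy, the representation of functionals
  and the value of \<open>trace_on\<close>, and it never has to be compared with a chosen basis. Two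
  consequences of pivotality carry the rest. Cyclicity of tr_l comes from the agreement of left and
  right mates. The normalisation tr_l = id on End(1_\<alpha>) comes from the compatibility of
  adjoints with composition; it has to be proved, because the adjoint of a unit 1-morphism need not
  be that unit. It identifies the average over \<O>, which enters through the trace hypothesis at D
  : \<O> \<rightarrow> \<alpha>, with the plain scalar used in the Serre pairing.\<close>

lemma linear_map_onD:
  assumes "linear_map_on s t V W f"
  shows "x \<in> V \<Longrightarrow> f x \<in> W" "\<lbrakk>x \<in> V; y \<in> V\<rbrakk> \<Longrightarrow> f (x + y) = f x + f y"
    "x \<in> V \<Longrightarrow> f (s c x) = t c (f x)"
  using assms by (auto simp: linear_map_on_def)

lemma linear_map_on_compose:
  assumes "linear_map_on s t V W f" "linear_map_on t r W U g"
  shows "linear_map_on s r V U (\<lambda>x. g (f x))"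
  using assms by (simp add: linear_map_on_def)

text \<open>Since \<open>f\<close> and \<open>g\<close> agree only on \<open>V\<close>, transferring
  additivity and homogeneity needs sums and multiples to stay in \<open>V\<close>; the two closure
  conditions supply this.\<close>

lemma linear_map_on_cong:
  assumes "linear_map_on s t V W f" "\<And>x. x \<in> V \<Longrightarrow> f x = g x"
    "\<And>x y. \<lbrakk>x \<in> V; y \<in> V\<rbrakk> \<Longrightarrow> x + y \<in> V" "\<And>c x. x \<in> V \<Longrightarrow> s c x \<in> V"
  shows "linear_map_on s t V W g"
proof -
  have "g x \<in> W" if "x \<in> V" for x
    using assms(1,2) that by (metis linear_map_onD(1))
  moreover have "g (x + y) = g x + g y" if "x \<in> V" "y \<in> V" for x y
    using assms that by (metis linear_map_onD(2))
  moreover have "g (s c x) = t c (g x)" if "x \<in> V" for c x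
    using assms that by (metis linear_map_onD(3))
  ultimately show ?thesis by (simp add: linear_map_on_def)
qed

lemma linear_map_on_sum:
  assumes "vector_space s" "vector_space t" "module.subspace s V"
    and f: "linear_map_on s t V W f" and g: "\<And>i. i \<in> I \<Longrightarrow> g i \<in> V"
  shows "f (\<Sum>i\<in>I. s (c i) (g i)) = (\<Sum>i\<in>I. t (c i) (f (g i)))"
proof -
  interpret s: vector_space s by fact
  interpret t: vector_space t by fact
  have V: "s.subspace V" by fact
  have f0: "f 0 = 0"
    using linear_map_onD(3)[OF f s.subspace_0[OF V], of 0] by simp
  show ?thesis
    using g
  proof (induction I rule: infinite_finite_induct)
    case (insert i I)
    have "(\<Sum>i\<in>I. s (c i) (g i)) \<in> V"
      using insert by (intro s.subspace_sum[OF V] s.subspace_scale[OF V]) auto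
    then show ?case
      using insert V by (simp add: linear_map_onD[OF f] s.subspace_scale)
  qed (simp_all add: f0)
qed

text \<open>A frame is a finite spanning family with coefficient functionals, possibly redundant.
  Expanding the basis vectors in the frame, or the images \<open>f (v i)\<close> in the basis,
  produces the same double sum in the two orders of summation. So the trace can be evaluated without
  knowing which basis \<open>trace_on\<close> has chosen.\<close>

lemma trace_on_frame:
  assumes s: "vector_space s" and V: "module.subspace s V" and I: "finite I"
    and v: "\<And>i. i \<in> I \<Longrightarrow> v i \<in> V"
    and c: "\<And>i. i \<in> I \<Longrightarrow> linear_map_on s (*) V UNIV (c i)"
    and frame: "\<And>x. x \<in> V \<Longrightarrow> x = (\<Sum>i\<in>I. s (c i x) (v i))"
    and f: "linear_map_on s s V V f"
  shows "trace_on s V f = (\<Sum>i\<in>I. c i (f (v i)))"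
proof -
  interpret s: vector_space s by fact
  have k: "vector_space ((*) :: 'a \<Rightarrow> 'a \<Rightarrow> 'a)"
    by unfold_locales (simp_all add: algebra_simps)
  define S where "S = (SOME S. \<not> s.dependent S \<and> s.span S = V)"
  have "\<exists>S. \<not> s.dependent S \<and> s.span S = V"
    using s.basis_exists[of V] s.span_minimal[OF _ V] by (metis subset_antisym)
  then have S: "s.independent S" "s.span S = V"
    unfolding S_def by (metis (mono_tags, lifting) someI_ex)+
  have SV: "b \<in> V" if "b \<in> S" for b
    using S that s.span_base by auto
  \<comment> \<open>Bounds the chosen basis: it is independent inside the span of a finite set,
    hence finite, so that the sum defining the trace is a genuine one and not the default 0.\<close>
  have "V \<subseteq> s.span (v ` I)"
  proof
    fix x assume "x \<in> V"
    show "x \<in> s.span (v ` I)"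
      by (subst frame[OF \<open>x \<in> V\<close>]) (intro s.span_sum s.span_scale s.span_base imageI)
  qed
  then have fS: "finite S"
    using s.independent_span_bound[of "v ` I" S] S I s.span_superset by (metis finite_imageI subset_trans)
  have rep: "(\<Sum>b\<in>S. s (s.representation S x b) b) = x" if "x \<in> V" for x
    using s.sum_representation_eq[of S x S] S that fS by auto
  have lin_rep: "linear_map_on s (*) V UNIV (\<lambda>x. s.representation S x b)" for b
    using S by (simp add: linear_map_on_def s.representation_add s.representation_scale)
  have "trace_on s V f = (\<Sum>b\<in>S. s.representation S (f b) b)"
    by (simp add: trace_on_def S_def Let_def)
  also have "\<dots> = (\<Sum>b\<in>S. \<Sum>i\<in>I. c i b * s.representation S (f (v i)) b)"
  proof (rule sum.cong[OF refl])
    fix b assume b: "b \<in> S"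
    have "s.representation S (f b) b = s.representation S (f (\<Sum>i\<in>I. s (c i b) (v i))) b"
      using frame[OF SV[OF b]] by simp
    also have "\<dots> = (\<Sum>i\<in>I. c i b * s.representation S (f (v i)) b)"
      by (rule linear_map_on_sum[OF s k V linear_map_on_compose[OF f lin_rep] v])
    finally show "s.representation S (f b) b = \<dots>" .
  qed
  also have "\<dots> = (\<Sum>i\<in>I. \<Sum>b\<in>S. s.representation S (f (v i)) b * c i b)"
    by (subst sum.swap) (simp add: mult.commute)
  also have "\<dots> = (\<Sum>i\<in>I. c i (f (v i)))"
  proof (rule sum.cong[OF refl])
    fix i assume i: "i \<in> I"
    have "(\<Sum>b\<in>S. s.representation S (f (v i)) b * c i b)
        = c i (\<Sum>b\<in>S. s (s.representation S (f (v i)) b) b)"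
      by (rule linear_map_on_sum[OF s k V c[OF i] SV, symmetric])
    also have "\<dots> = c i (f (v i))"
      by (simp add: rep linear_map_onD(1)[OF f v[OF i]])
    finally show "(\<Sum>b\<in>S. s.representation S (f (v i)) b * c i b) = c i (f (v i))" .
  qed
  finally show ?thesis .
qed

section \<open>A calculus of typed 2-morphisms\<close>

text \<open>An element of \<open>hom B X Y\<close> does not determine \<open>X\<close> and \<open>Y\<close>.  A cell records them, so that the side
  conditions of the 2-category axioms become equations between 1-morphisms.\<close>

datatype ('m, 'c) cell = Cell (dm: 'm) (body: 'c) (cd: 'm)

context linear_two_category
begin

definition arr :: "('m, 'c) cell \<Rightarrow> bool" where
  "arr f \<longleftrightarrow> body f \<in> hom B (dm f) (cd f)"

definition cid :: "'m \<Rightarrow> ('m, 'c) cell" where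
  "cid X = Cell X (\<^bold>1 X) X"

definition cseq :: "('m, 'c) cell \<Rightarrow> ('m, 'c) cell \<Rightarrow> ('m, 'c) cell" (infixr "\<bullet>" 70) where
  "g \<bullet> f = Cell (dm f) (body g \<cdot> body f) (cd g)"

definition cpar :: "('m, 'c) cell \<Rightarrow> ('m, 'c) cell \<Rightarrow> ('m, 'c) cell" (infixr "\<diamondop>" 75) where
  "f \<diamondop> g = Cell (dm f \<otimes> dm g) (body f \<star> body g) (cd f \<otimes> cd g)"

lemma cell_simps [simp]:
  "dm (cid X) = X" "cd (cid X) = X" "body (cid X) = \<^bold>1 X"
  "dm (g \<bullet> f) = dm f" "cd (g \<bullet> f) = cd g" "body (g \<bullet> f) = body g \<cdot> body f"
  "dm (f \<diamondop> g) = dm f \<otimes> dm g" "cd (f \<diamondop> g) = cd f \<otimes> cd g" "body (f \<diamondop> g) = body f \<star> body g"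
  by (simp_all add: cid_def cseq_def cpar_def)

lemma arr_Cell [simp]: "arr (Cell X f Y) \<longleftrightarrow> f \<in> hom B X Y"
  by (simp add: arr_def)

lemma arr_cid [simp]: "arr (cid X)"
  by (simp add: arr_def id2_closed)

lemma arr_cseq [simp]: "\<lbrakk>arr f; arr g; cd f = dm g\<rbrakk> \<Longrightarrow> arr (g \<bullet> f)"
  by (simp add: arr_def vcomp_closed)

lemma arr_cpar [simp]: "\<lbrakk>arr f; arr g; src B (dm f) = trg B (dm g)\<rbrakk> \<Longrightarrow> arr (f \<diamondop> g)"
  by (simp add: arr_def hcomp2_closed)

lemma src_cd: "arr f \<Longrightarrow> src B (cd f) = src B (dm f)"
  and trg_cd: "arr f \<Longrightarrow> trg B (cd f) = trg B (dm f)"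
  by (auto simp: arr_def dest: hom_parallel)

lemmas [simp] = src_unit1 trg_unit1 src_hcomp1 trg_hcomp1

lemma hcomp1_assoc' [simp]:
  "\<lbrakk>src B X = trg B Y; src B Y = trg B Z\<rbrakk> \<Longrightarrow> (X \<otimes> Y) \<otimes> Z = X \<otimes> (Y \<otimes> Z)"
  by (rule hcomp1_assoc)

lemma unit1_left' [simp]: "trg B X = a \<Longrightarrow> \<one> a \<otimes> X = X"
  and unit1_right' [simp]: "src B X = a \<Longrightarrow> X \<otimes> \<one> a = X"
  using unit1_left unit1_right by auto

text \<open>Right-nested composites are the simp normal form, for cells as for 1-morphisms. Two
  adjacent factors with more to their right are then no subterm, which is why the calculations below
  regroup explicitly before rewriting such a pair.\<close>

lemma cseq_assoc [simp]:
  "\<lbrakk>arr f; arr g; arr h; cd f = dm g; cd g = dm h\<rbrakk> \<Longrightarrow> (h \<bullet> g) \<bullet> f = h \<bullet> (g \<bullet> f)"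
  by (simp add: arr_def cseq_def vcomp_assoc)

lemma cid_left [simp]: "\<lbrakk>arr f; cd f = X\<rbrakk> \<Longrightarrow> cid X \<bullet> f = f"
  and cid_right [simp]: "\<lbrakk>arr f; dm f = X\<rbrakk> \<Longrightarrow> f \<bullet> cid X = f"
  by (cases f; simp add: cseq_def cid_def id2_left id2_right)+

lemma cid_left_assoc [simp]: "\<lbrakk>arr f; arr g; cd g = X; cd f = dm g\<rbrakk> \<Longrightarrow> cid X \<bullet> (g \<bullet> f) = g \<bullet> f"
  by simp

lemma cpar_assoc [simp]:
  "\<lbrakk>arr f; arr g; arr h; src B (dm f) = trg B (dm g); src B (dm g) = trg B (dm h)\<rbrakk>
    \<Longrightarrow> (f \<diamondop> g) \<diamondop> h = f \<diamondop> (g \<diamondop> h)"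
  using src_cd[of f] src_cd[of g] trg_cd[of g] trg_cd[of h]
  by (simp add: cpar_def arr_def hcomp2_assoc)

lemma cpar_unit_left [simp]: "\<lbrakk>arr f; trg B (dm f) = a\<rbrakk> \<Longrightarrow> cid (\<one> a) \<diamondop> f = f"
  using trg_cd[of f] hcomp2_unit_left[of "body f" "dm f" "cd f"]
  by (cases f) (simp add: cpar_def cid_def)

lemma cpar_unit_right [simp]: "\<lbrakk>arr f; src B (dm f) = a\<rbrakk> \<Longrightarrow> f \<diamondop> cid (\<one> a) = f"
  using src_cd[of f] hcomp2_unit_right[of "body f" "dm f" "cd f"]
  by (cases f) (simp add: cpar_def cid_def)

lemma cpar_cid [simp]: "src B X = trg B Y \<Longrightarrow> cid X \<diamondop> cid Y = cid (X \<otimes> Y)"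
  by (simp add: cpar_def cid_def hcomp2_id2)

lemma cpar_cid_assoc [simp]:
  "\<lbrakk>arr f; src B X = trg B Y; src B Y = trg B (dm f)\<rbrakk> \<Longrightarrow> cid X \<diamondop> (cid Y \<diamondop> f) = cid (X \<otimes> Y) \<diamondop> f"
  by (subst cpar_assoc[symmetric]) simp_all

lemma cseq_cpar:
  "\<lbrakk>arr f; arr f'; arr g; arr g'; cd f = dm f'; cd g = dm g'; src B (dm f) = trg B (dm g)\<rbrakk>
    \<Longrightarrow> (f' \<diamondop> g') \<bullet> (f \<diamondop> g) = (f' \<bullet> f) \<diamondop> (g' \<bullet> g)"
  by (simp add: cpar_def cseq_def arr_def interchange)

text \<open>Together with \<open>cpar_split_right_first\<close> this factors the same
  \<open>f \<diamondop> g\<close> in two orders. Equating the two slides a 2-morphism past a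
  horizontally adjacent one, the basic move of the graphical arguments below.\<close>

lemma cpar_split_left_first:
  "\<lbrakk>arr f; arr g; src B (dm f) = trg B (dm g)\<rbrakk>
    \<Longrightarrow> (cid (cd f) \<diamondop> g) \<bullet> (f \<diamondop> cid (dm g)) = f \<diamondop> g"
  by (subst cseq_cpar) simp_all

lemma cpar_split_right_first:
  "\<lbrakk>arr f; arr g; src B (dm f) = trg B (dm g)\<rbrakk>
    \<Longrightarrow> (f \<diamondop> cid (cd g)) \<bullet> (cid (dm f) \<diamondop> g) = f \<diamondop> g"
  by (subst cseq_cpar) simp_all

lemma whisker_left_cseq:
  "\<lbrakk>arr f; arr g; cd f = dm g; src B X = trg B (dm f)\<rbrakk>
    \<Longrightarrow> cid X \<diamondop> (g \<bullet> f) = (cid X \<diamondop> g) \<bullet> (cid X \<diamondop> f)"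
  by (subst cseq_cpar) simp_all

lemma whisker_right_cseq:
  "\<lbrakk>arr f; arr g; cd f = dm g; src B (dm f) = trg B X\<rbrakk>
    \<Longrightarrow> (g \<bullet> f) \<diamondop> cid X = (g \<diamondop> cid X) \<bullet> (f \<diamondop> cid X)"
  by (subst cseq_cpar) simp_all

end

section \<open>Duality and traces in a pivotal 2-category\<close>

context linear_pivotal_two_category
begin

lemmas [simp] = src_dag trg_dag

definition evc :: "'m \<Rightarrow> ('m, 'c) cell" where
  "evc X = Cell (X\<^sup>\<dagger> \<otimes> X) (ev X) (\<one> (src B X))"

definition coevc :: "'m \<Rightarrow> ('m, 'c) cell" where
  "coevc X = Cell (\<one> (trg B X)) (coev X) (X \<otimes> X\<^sup>\<dagger>)"

definition evtc :: "'m \<Rightarrow> ('m, 'c) cell" where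
  "evtc X = Cell (X \<otimes> X\<^sup>\<dagger>) (evt X) (\<one> (trg B X))"

definition coevtc :: "'m \<Rightarrow> ('m, 'c) cell" where
  "coevtc X = Cell (\<one> (src B X)) (coevt X) (X\<^sup>\<dagger> \<otimes> X)"

lemma duality_cell_simps [simp]:
  "dm (evc X) = X\<^sup>\<dagger> \<otimes> X" "body (evc X) = ev X" "cd (evc X) = \<one> (src B X)" "arr (evc X)"
  "dm (coevc X) = \<one> (trg B X)" "body (coevc X) = coev X" "cd (coevc X) = X \<otimes> X\<^sup>\<dagger>" "arr (coevc X)"
  "dm (evtc X) = X \<otimes> X\<^sup>\<dagger>" "body (evtc X) = evt X" "cd (evtc X) = \<one> (trg B X)" "arr (evtc X)"
  "dm (coevtc X) = \<one> (src B X)" "body (coevtc X) = coevt X" "cd (coevtc X) = X\<^sup>\<dagger> \<otimes> X" "arr (coevtc X)"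
  by (simp_all add: evc_def coevc_def evtc_def coevtc_def ev_closed coev_closed evt_closed coevt_closed)

lemma zigzag:
  "(cid X \<diamondop> evc X) \<bullet> (coevc X \<diamondop> cid X) = cid X"
  "(evc X \<diamondop> cid (X\<^sup>\<dagger>)) \<bullet> (cid (X\<^sup>\<dagger>) \<diamondop> coevc X) = cid (X\<^sup>\<dagger>)"
  "(evtc X \<diamondop> cid X) \<bullet> (cid X \<diamondop> coevtc X) = cid X"
  "(cid (X\<^sup>\<dagger>) \<diamondop> evtc X) \<bullet> (coevtc X \<diamondop> cid (X\<^sup>\<dagger>)) = cid (X\<^sup>\<dagger>)"
  by (rule cell.expand; simp add: zigzag_left1 zigzag_left2 zigzag_right1 zigzag_right2)+

text \<open>The transposes of f : X \<rightarrow> Y to 1 \<rightarrow>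
  \<open>X\<^sup>\<dagger> \<otimes> Y\<close> and, in \<open>coname\<close>, of g : Y \<rightarrow>
  X to \<open>X\<^sup>\<dagger> \<otimes> Y\<close> \<rightarrow> 1. The name uses the right
  adjunction and the coname the left one: exactly these two appear in tr_l, so a left trace becomes
  a coname after a name.\<close>

definition name :: "('m, 'c) cell \<Rightarrow> ('m, 'c) cell" where
  "name f = (cid ((dm f)\<^sup>\<dagger>) \<diamondop> f) \<bullet> coevtc (dm f)"

definition coname :: "('m, 'c) cell \<Rightarrow> ('m, 'c) cell" where
  "coname f = evc (cd f) \<bullet> (cid ((cd f)\<^sup>\<dagger>) \<diamondop> f)"

definition unname :: "'m \<Rightarrow> 'm \<Rightarrow> ('m, 'c) cell \<Rightarrow> ('m, 'c) cell" where
  "unname X Y w = (evtc X \<diamondop> cid Y) \<bullet> (cid X \<diamondop> w)"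

definition unconame :: "'m \<Rightarrow> 'm \<Rightarrow> ('m, 'c) cell \<Rightarrow> ('m, 'c) cell" where
  "unconame X Y u = (cid X \<diamondop> u) \<bullet> (coevc X \<diamondop> cid Y)"

lemma name_simps [simp]:
  "dm (name f) = \<one> (src B (dm f))" "cd (name f) = (dm f)\<^sup>\<dagger> \<otimes> cd f"
  "arr f \<Longrightarrow> arr (name f)"
  by (simp_all add: name_def src_cd trg_cd)

lemma coname_simps [simp]:
  "dm (coname f) = (cd f)\<^sup>\<dagger> \<otimes> dm f" "cd (coname f) = \<one> (src B (cd f))"
  "arr f \<Longrightarrow> arr (coname f)"
  by (simp_all add: coname_def src_cd trg_cd)

lemma unname_simps:
  assumes "src B Y = src B X" "trg B Y = trg B X" "arr w" "dm w = \<one> (src B X)" "cd w = X\<^sup>\<dagger> \<otimes> Y"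
  shows "dm (unname X Y w) = X" "cd (unname X Y w) = Y" "arr (unname X Y w)"
  using assms by (simp_all add: unname_def)

lemma unconame_simps:
  assumes "src B Y = src B X" "trg B Y = trg B X" "arr u" "dm u = X\<^sup>\<dagger> \<otimes> Y" "cd u = \<one> (src B X)"
  shows "dm (unconame X Y u) = Y" "cd (unconame X Y u) = X" "arr (unconame X Y u)"
  using assms by (simp_all add: unconame_def)

text \<open>Slide \<open>f\<close> past the evaluation; what remains is a zigzag. The three lemmas
  that follow are the same move for the other adjunction or the other order.\<close>

lemma unname_name:
  assumes f: "arr f" "dm f = X" "cd f = Y"
  shows "unname X Y (name f) = f"
proof -
  have XY: "src B Y = src B X" "trg B Y = trg B X"
    using f src_cd[of f] trg_cd[of f] by auto
  have "unname X Y (name f)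
      = (evtc X \<diamondop> cid Y) \<bullet> (cid (X \<otimes> X\<^sup>\<dagger>) \<diamondop> f) \<bullet> (cid X \<diamondop> coevtc X)"
    using f XY by (simp add: unname_def name_def whisker_left_cseq)
  also have "\<dots> = ((evtc X \<diamondop> cid Y) \<bullet> (cid (X \<otimes> X\<^sup>\<dagger>) \<diamondop> f)) \<bullet> (cid X \<diamondop> coevtc X)"
    using f XY by simp
  also have "(evtc X \<diamondop> cid Y) \<bullet> (cid (X \<otimes> X\<^sup>\<dagger>) \<diamondop> f) = f \<bullet> (evtc X \<diamondop> cid X)"
    using f XY cpar_split_left_first[of "evtc X" f] cpar_split_right_first[of "evtc X" f] by simp
  finally show ?thesis
    using f XY by (simp add: zigzag)
qed

lemma name_unname:
  assumes XY: "src B Y = src B X" "trg B Y = trg B X"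
    and w: "arr w" "dm w = \<one> (src B X)" "cd w = X\<^sup>\<dagger> \<otimes> Y"
  shows "name (unname X Y w) = w"
proof -
  have "name (unname X Y w)
      = (cid (X\<^sup>\<dagger>) \<diamondop> evtc X \<diamondop> cid Y) \<bullet> (cid (X\<^sup>\<dagger> \<otimes> X) \<diamondop> w) \<bullet> coevtc X"
    using XY w by (simp add: unname_def name_def whisker_left_cseq)
  also have "(cid (X\<^sup>\<dagger> \<otimes> X) \<diamondop> w) \<bullet> coevtc X = (coevtc X \<diamondop> cid (X\<^sup>\<dagger> \<otimes> Y)) \<bullet> w"
    using w XY cpar_split_left_first[of "coevtc X" w] cpar_split_right_first[of "coevtc X" w] by simp
  also have "(cid (X\<^sup>\<dagger>) \<diamondop> evtc X \<diamondop> cid Y) \<bullet> (coevtc X \<diamondop> cid (X\<^sup>\<dagger> \<otimes> Y)) \<bullet> w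
      = (((cid (X\<^sup>\<dagger>) \<diamondop> evtc X) \<bullet> (coevtc X \<diamondop> cid (X\<^sup>\<dagger>))) \<diamondop> cid Y) \<bullet> w"
    using w XY by (simp add: whisker_right_cseq)
  finally show ?thesis
    using w XY by (simp add: zigzag)
qed

lemma unconame_coname:
  assumes f: "arr f" "dm f = Y" "cd f = X"
  shows "unconame X Y (coname f) = f"
proof -
  have XY: "src B Y = src B X" "trg B Y = trg B X"
    using f src_cd[of f] trg_cd[of f] by auto
  have "unconame X Y (coname f)
      = (cid X \<diamondop> evc X) \<bullet> (cid (X \<otimes> X\<^sup>\<dagger>) \<diamondop> f) \<bullet> (coevc X \<diamondop> cid Y)"
    using f XY by (simp add: unconame_def coname_def whisker_left_cseq)
  also have "(cid (X \<otimes> X\<^sup>\<dagger>) \<diamondop> f) \<bullet> (coevc X \<diamondop> cid Y) = (coevc X \<diamondop> cid X) \<bullet> f"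
    using f XY cpar_split_left_first[of "coevc X" f] cpar_split_right_first[of "coevc X" f] by simp
  also have "(cid X \<diamondop> evc X) \<bullet> (coevc X \<diamondop> cid X) \<bullet> f = ((cid X \<diamondop> evc X) \<bullet> (coevc X \<diamondop> cid X)) \<bullet> f"
    using f XY by simp
  finally show ?thesis
    using f XY by (simp add: zigzag)
qed

lemma coname_unconame:
  assumes XY: "src B Y = src B X" "trg B Y = trg B X"
    and u: "arr u" "dm u = X\<^sup>\<dagger> \<otimes> Y" "cd u = \<one> (src B X)"
  shows "coname (unconame X Y u) = u"
proof -
  have "coname (unconame X Y u)
      = (evc X \<bullet> (cid (X\<^sup>\<dagger> \<otimes> X) \<diamondop> u)) \<bullet> (cid (X\<^sup>\<dagger>) \<diamondop> coevc X \<diamondop> cid Y)"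
    using XY u by (simp add: unconame_def coname_def whisker_left_cseq)
  also have "evc X \<bullet> (cid (X\<^sup>\<dagger> \<otimes> X) \<diamondop> u) = u \<bullet> (evc X \<diamondop> cid (X\<^sup>\<dagger> \<otimes> Y))"
    using u XY cpar_split_left_first[of "evc X" u] cpar_split_right_first[of "evc X" u] by simp
  also have "(u \<bullet> (evc X \<diamondop> cid (X\<^sup>\<dagger> \<otimes> Y))) \<bullet> (cid (X\<^sup>\<dagger>) \<diamondop> coevc X \<diamondop> cid Y)
      = u \<bullet> (((evc X \<diamondop> cid (X\<^sup>\<dagger>)) \<bullet> (cid (X\<^sup>\<dagger>) \<diamondop> coevc X)) \<diamondop> cid Y)"
    using u XY by (simp add: whisker_right_cseq)
  finally show ?thesis
    using u XY by (simp add: zigzag)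
qed

section \<open>Left traces as composites of a coname and a name, and their cyclicity\<close>

lemma left_trace_cseq:
  assumes "arr f" "arr g" "cd f = dm g" "cd g = dm f"
  shows "tr\<^sub>l (dm f) (body (g \<bullet> f)) = body (coname g \<bullet> name f)"
proof -
  have "coname g \<bullet> name f = evc (dm f) \<bullet> (cid ((dm f)\<^sup>\<dagger>) \<diamondop> (g \<bullet> f)) \<bullet> coevtc (dm f)"
    using assms src_cd[of f] trg_cd[of f] by (simp add: coname_def name_def whisker_left_cseq)
  then show ?thesis
    by (simp add: left_trace_def)
qed

text \<open>Here axiom \<open>pivotal_mates\<close> enters. The mate \<open>m\<close> of
  \<open>f\<close> turns ev_X into \<open>coname f\<close> when written with left adjunctions, and
  turns the right coevaluation of Y into \<open>name f\<close> when written with right adjunctions.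
  Since both forms are the same 2-morphism, \<open>f\<close> can be carried around the loop from one
  end to the other.\<close>

lemma coname_name_cyclic:
  assumes f: "arr f" "dm f = X" "cd f = Y" and g: "arr g" "dm g = Y" "cd g = X"
  shows "coname g \<bullet> name f = coname f \<bullet> name g"
proof -
  have XY: "src B Y = src B X" "trg B Y = trg B X"
    using f src_cd[of f] trg_cd[of f] by auto
  define m where "m = (evc Y \<diamondop> cid (X\<^sup>\<dagger>)) \<bullet> (cid (Y\<^sup>\<dagger>) \<diamondop> f \<diamondop> cid (X\<^sup>\<dagger>)) \<bullet> (cid (Y\<^sup>\<dagger>) \<diamondop> coevc X)"
  have m': "m = (cid (X\<^sup>\<dagger>) \<diamondop> evtc Y) \<bullet> (cid (X\<^sup>\<dagger>) \<diamondop> f \<diamondop> cid (Y\<^sup>\<dagger>)) \<bullet> (coevtc X \<diamondop> cid (Y\<^sup>\<dagger>))"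
    unfolding m_def
    by (rule cell.expand) (use f XY pivotal_mates[of "body f" X Y] in \<open>simp add: arr_def\<close>)
  have m: "arr m" "dm m = Y\<^sup>\<dagger>" "cd m = X\<^sup>\<dagger>"
    using f XY by (simp_all add: m_def)
  have m_ev: "evc X \<bullet> (m \<diamondop> cid X) = coname f"
  proof -
    have "evc X \<bullet> (m \<diamondop> cid X)
        = (evc X \<bullet> (evc Y \<diamondop> cid (X\<^sup>\<dagger> \<otimes> X))) \<bullet> (cid (Y\<^sup>\<dagger>) \<diamondop> f \<diamondop> cid (X\<^sup>\<dagger> \<otimes> X))
            \<bullet> (cid (Y\<^sup>\<dagger>) \<diamondop> coevc X \<diamondop> cid X)"
      using f XY by (simp add: m_def whisker_right_cseq)
    also have "evc X \<bullet> (evc Y \<diamondop> cid (X\<^sup>\<dagger> \<otimes> X)) = evc Y \<bullet> (cid (Y\<^sup>\<dagger> \<otimes> Y) \<diamondop> evc X)"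
      using XY cpar_split_left_first[of "evc Y" "evc X"] cpar_split_right_first[of "evc Y" "evc X"]
      by simp
    also have "(evc Y \<bullet> (cid (Y\<^sup>\<dagger> \<otimes> Y) \<diamondop> evc X)) \<bullet> (cid (Y\<^sup>\<dagger>) \<diamondop> f \<diamondop> cid (X\<^sup>\<dagger> \<otimes> X))
            \<bullet> (cid (Y\<^sup>\<dagger>) \<diamondop> coevc X \<diamondop> cid X)
        = evc Y \<bullet> (cid (Y\<^sup>\<dagger>) \<diamondop> (((cid Y \<diamondop> evc X) \<bullet> (f \<diamondop> cid (X\<^sup>\<dagger> \<otimes> X))) \<bullet> (coevc X \<diamondop> cid X)))"
      using f XY by (simp add: whisker_left_cseq)
    also have "(cid Y \<diamondop> evc X) \<bullet> (f \<diamondop> cid (X\<^sup>\<dagger> \<otimes> X)) = f \<bullet> (cid X \<diamondop> evc X)"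
      using f XY cpar_split_left_first[of f "evc X"] cpar_split_right_first[of f "evc X"] by simp
    finally show ?thesis
      using f XY by (simp add: zigzag coname_def)
  qed
  have m_coev: "(m \<diamondop> cid Y) \<bullet> coevtc Y = name f"
  proof -
    have "(m \<diamondop> cid Y) \<bullet> coevtc Y
        = (cid (X\<^sup>\<dagger>) \<diamondop> evtc Y \<diamondop> cid Y) \<bullet> (cid (X\<^sup>\<dagger>) \<diamondop> f \<diamondop> cid (Y\<^sup>\<dagger> \<otimes> Y))
            \<bullet> (coevtc X \<diamondop> cid (Y\<^sup>\<dagger> \<otimes> Y)) \<bullet> coevtc Y"
      using f XY by (simp add: m' whisker_right_cseq)
    also have "(coevtc X \<diamondop> cid (Y\<^sup>\<dagger> \<otimes> Y)) \<bullet> coevtc Y = (cid (X\<^sup>\<dagger> \<otimes> X) \<diamondop> coevtc Y) \<bullet> coevtc X"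
      using XY cpar_split_left_first[of "coevtc X" "coevtc Y"] cpar_split_right_first[of "coevtc X" "coevtc Y"]
      by simp
    also have "(cid (X\<^sup>\<dagger>) \<diamondop> evtc Y \<diamondop> cid Y) \<bullet> (cid (X\<^sup>\<dagger>) \<diamondop> f \<diamondop> cid (Y\<^sup>\<dagger> \<otimes> Y))
            \<bullet> (cid (X\<^sup>\<dagger> \<otimes> X) \<diamondop> coevtc Y) \<bullet> coevtc X
        = (cid (X\<^sup>\<dagger>) \<diamondop> ((evtc Y \<diamondop> cid Y) \<bullet> ((f \<diamondop> cid (Y\<^sup>\<dagger> \<otimes> Y)) \<bullet> (cid X \<diamondop> coevtc Y)))) \<bullet> coevtc X"
      using f XY by (simp add: whisker_left_cseq)
    also have "(f \<diamondop> cid (Y\<^sup>\<dagger> \<otimes> Y)) \<bullet> (cid X \<diamondop> coevtc Y) = (cid Y \<diamondop> coevtc Y) \<bullet> f"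
      using f XY cpar_split_left_first[of f "coevtc Y"] cpar_split_right_first[of f "coevtc Y"] by simp
    also have "(evtc Y \<diamondop> cid Y) \<bullet> (cid Y \<diamondop> coevtc Y) \<bullet> f
        = ((evtc Y \<diamondop> cid Y) \<bullet> (cid Y \<diamondop> coevtc Y)) \<bullet> f"
      using f XY by simp
    finally show ?thesis
      using f XY by (simp add: zigzag name_def)
  qed
  \<comment> \<open>Replace the name of \<open>f\<close> by \<open>m\<close> on the right
    coevaluation, slide \<open>g\<close> past \<open>m\<close>, and absorb \<open>m\<close> into the
    left evaluation.\<close>
  have "coname g \<bullet> name f = evc X \<bullet> ((cid (X\<^sup>\<dagger>) \<diamondop> g) \<bullet> (m \<diamondop> cid Y)) \<bullet> coevtc Y"
    using f g XY m by (simp add: m_coev[symmetric] coname_def)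
  also have "(cid (X\<^sup>\<dagger>) \<diamondop> g) \<bullet> (m \<diamondop> cid Y) = (m \<diamondop> cid X) \<bullet> (cid (Y\<^sup>\<dagger>) \<diamondop> g)"
    using f g XY m cpar_split_left_first[of m g] cpar_split_right_first[of m g] by simp
  also have "evc X \<bullet> ((m \<diamondop> cid X) \<bullet> (cid (Y\<^sup>\<dagger>) \<diamondop> g)) \<bullet> coevtc Y = coname f \<bullet> name g"
    using f g XY m by (simp add: m_ev[symmetric] name_def)
  finally show ?thesis .
qed

lemma left_trace_cyclic:
  assumes f: "f \<in> hom B X Y" and g: "g \<in> hom B Y X"
  shows "tr\<^sub>l X (g \<cdot> f) = tr\<^sub>l Y (f \<cdot> g)"
  using left_trace_cseq[of "Cell X f Y" "Cell Y g X"] left_trace_cseq[of "Cell Y g X" "Cell X f Y"]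
    coname_name_cyclic[of "Cell X f Y" X Y "Cell Y g X"] f g by simp

text \<open>The dimension of the unit 1-morphism is 1. The element in question is invertible by the
  zigzag identities and idempotent by \<open>pivotal_hcomp\<close>, hence the identity.\<close>

lemma unit_ev_coevt: "evc (\<one> a) \<bullet> coevtc (\<one> a) = cid (\<one> a)"
proof -
  let ?J = "(\<one> a)\<^sup>\<dagger>" and ?e = "evc (\<one> a)" and ?d = "coevc (\<one> a)"
    and ?t = "evtc (\<one> a)" and ?c = "coevtc (\<one> a)"
  have ed: "?e \<bullet> ?d = cid (\<one> a)" and tc: "?t \<bullet> ?c = cid (\<one> a)"
    using zigzag(1,3)[of "\<one> a"] by simp_all
  have de: "?d \<bullet> ?e = cid ?J"
    using zigzag(2)[of "\<one> a"] cpar_split_left_first[of ?e ?d] cpar_split_right_first[of ?e ?d] by simp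
  \<comment> \<open>Axiom \<open>pivotal_hcomp\<close> for the pair of unit 1-morphisms. Both sides
    go from \<open>?J\<close> to \<open>?J \<otimes> ?J\<close>; the one from right adjunctions
    collapses to \<open>(?c \<diamondop> ?c) \<bullet> ?t\<close>, the one from left adjunctions to
    \<open>(?d \<diamondop> ?d) \<bullet> ?e\<close>.\<close>
  have "Cell ?J (dag_comp B (\<one> a) (\<one> a)) (?J \<otimes> ?J)
      = (cid (?J \<otimes> ?J) \<diamondop> ?t) \<bullet> (cid ?J \<diamondop> ?c \<diamondop> cid ?J) \<bullet> (?c \<diamondop> cid ?J)"
    by (rule cell.expand) (simp add: dag_comp_def)
  moreover have "Cell ?J (dag_comp B (\<one> a) (\<one> a)) (?J \<otimes> ?J)
      = (?e \<diamondop> cid (?J \<otimes> ?J)) \<bullet> (cid ?J \<diamondop> ?d \<diamondop> cid ?J) \<bullet> (cid ?J \<diamondop> ?d)"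
    by (rule cell.expand) (simp add: pivotal_hcomp)
  moreover have "(cid (?J \<otimes> ?J) \<diamondop> ?t) \<bullet> (cid ?J \<diamondop> ?c \<diamondop> cid ?J) \<bullet> (?c \<diamondop> cid ?J) = (?c \<diamondop> ?c) \<bullet> ?t"
  proof -
    have "(cid ?J \<diamondop> ?c \<diamondop> cid ?J) \<bullet> (?c \<diamondop> cid ?J) = (?c \<diamondop> ?c) \<diamondop> cid ?J"
      by (subst cseq_cpar) simp_all
    then show ?thesis
      using cpar_split_left_first[of "?c \<diamondop> ?c" ?t] cpar_split_right_first[of "?c \<diamondop> ?c" ?t] by simp
  qed
  moreover have "(?e \<diamondop> cid (?J \<otimes> ?J)) \<bullet> (cid ?J \<diamondop> ?d \<diamondop> cid ?J) \<bullet> (cid ?J \<diamondop> ?d) = (?d \<diamondop> ?d) \<bullet> ?e"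
  proof -
    have "(cid ?J \<diamondop> ?d \<diamondop> cid ?J) \<bullet> (cid ?J \<diamondop> ?d) = cid ?J \<diamondop> (?d \<diamondop> ?d)"
      using cpar_split_right_first[of ?d ?d] by (subst cseq_cpar) simp_all
    then show ?thesis
      using cpar_split_left_first[of ?e "?d \<diamondop> ?d"] cpar_split_right_first[of ?e "?d \<diamondop> ?d"] by simp
  qed
  ultimately have key: "(?c \<diamondop> ?c) \<bullet> ?t = (?d \<diamondop> ?d) \<bullet> ?e"
    by simp
  define l where "l = ?e \<bullet> ?c"
  have l: "arr l" "dm l = \<one> a" "cd l = \<one> a" by (simp_all add: l_def)
  \<comment> \<open>On endomorphisms of a unit, horizontal and vertical composition agree, so this
    computes the square of \<open>l\<close>. Inserting \<open>?t \<bullet> ?c\<close>, an identity,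
    makes the axiom applicable.\<close>
  have "l \<diamondop> l = (?e \<diamondop> ?e) \<bullet> (?c \<diamondop> ?c)"
    by (simp add: l_def cseq_cpar)
  also have "\<dots> = (?e \<diamondop> ?e) \<bullet> ((?c \<diamondop> ?c) \<bullet> ?t) \<bullet> ?c"
    by (simp add: tc)
  also have "\<dots> = (((?e \<diamondop> ?e) \<bullet> (?d \<diamondop> ?d)) \<bullet> ?e) \<bullet> ?c"
    unfolding key by simp
  also have "\<dots> = l"
    by (simp add: cseq_cpar ed l_def)
  finally have "l \<bullet> l = l"
    using cpar_split_left_first[of l l] l by simp
  moreover have inv: "l \<bullet> (?t \<bullet> ?d) = cid (\<one> a)"
  proof -
    have "?c \<bullet> ?t = cid ?J"
      using zigzag(4)[of "\<one> a"] cpar_split_left_first[of ?c ?t] cpar_split_right_first[of ?c ?t] by simp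
    then have "?c \<bullet> ?t \<bullet> ?d = ?d"
      using cseq_assoc[of ?d ?t ?c] by simp
    then show ?thesis by (simp add: l_def ed)
  qed
  ultimately have "l \<bullet> (l \<bullet> (?t \<bullet> ?d)) = l \<bullet> (?t \<bullet> ?d)"
    using cseq_assoc[of "?t \<bullet> ?d" l l] l by simp
  then show ?thesis
    unfolding inv using l by (simp add: l_def)
qed

text \<open>\<open>f\<close> slides out of the loop, which leaves the dimension of the unit as a
  factor.\<close>

lemma left_trace_unit:
  assumes f: "f \<in> hom B (\<one> a) (\<one> a)"
  shows "tr\<^sub>l (\<one> a) f = f"
proof -
  let ?f = "Cell (\<one> a) f (\<one> a)" and ?J = "(\<one> a)\<^sup>\<dagger>"
  have "evc (\<one> a) \<bullet> (cid ?J \<diamondop> ?f) \<bullet> coevtc (\<one> a) = evc (\<one> a) \<bullet> coevtc (\<one> a) \<bullet> ?f"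
    using f cpar_split_left_first[of "coevtc (\<one> a)" ?f] cpar_split_right_first[of "coevtc (\<one> a)" ?f]
    by simp
  also have "\<dots> = (evc (\<one> a) \<bullet> coevtc (\<one> a)) \<bullet> ?f"
    using f by simp
  also have "\<dots> = ?f"
    using f by (simp add: unit_ev_coevt)
  finally show ?thesis
    by (auto simp: left_trace_def dest: arg_cong[of _ _ body])
qed

text \<open>By cyclicity of the trace, the mate of a retraction is a section.\<close>

lemma mate_section:
  assumes XY: "src B Y = src B X" "trg B Y = trg B X"
    and u: "arr u" "dm u = X\<^sup>\<dagger> \<otimes> Y" "cd u = \<one> (src B X)"
    and w: "arr w" "dm w = \<one> (src B X)" "cd w = X\<^sup>\<dagger> \<otimes> Y"
    and uw: "u \<bullet> w = cid (\<one> (src B X))"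
  shows "coname (unname X Y w) \<bullet> name (unconame X Y u) = cid (\<one> (src B X))"
  using coname_name_cyclic[of "unconame X Y u" Y X "unname X Y w"] assms
  by (simp add: unname_simps unconame_simps name_unname coname_unconame)

text \<open>With X = \<open>\<eta> a \<lhd> a\<close>, Y =
  \<open>a \<rhd> \<eta> (a\<^sup>#)\<close> and \<open>u\<close> the triangulator, the right-hand
  side is the formula of \<open>triang_mate\<close>. Thus the mate in the swallowtail identity is a
  twofold transpose, and \<open>mate_section\<close> applies to it.\<close>

lemma name_unconame:
  assumes XY: "src B Y = src B X" "trg B Y = trg B X"
    and u: "arr u" "dm u = X\<^sup>\<dagger> \<otimes> Y" "cd u = \<one> (src B X)"
  shows "name (unconame X Y u)
    = (cid (Y\<^sup>\<dagger> \<otimes> X) \<diamondop> u) \<bullet> (cid (Y\<^sup>\<dagger>) \<diamondop> coevc X \<diamondop> cid Y) \<bullet> coevtc Y"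
  using assms by (simp add: name_def unconame_simps) (simp add: unconame_def whisker_left_cseq)

end

section \<open>Duality with respect to the monoidal structure\<close>

context linear_pivotal_endofunctor
begin

definition fcell :: "('m, 'c) cell \<Rightarrow> ('m, 'c) cell" where
  "fcell f = Cell (F1 (dm f)) (F2 (body f)) (F1 (cd f))"

lemma arr_fcell: "arr f \<Longrightarrow> arr (fcell f)"
  using F2_linear[of "dm f" "cd f"] hom_parallel[of "body f" "dm f" "cd f"]
  by (auto simp: fcell_def arr_def dest: linear_map_onD(1))

lemma fcell_cid: "fcell (cid X) = cid (F1 X)"
  by (simp add: fcell_def cid_def F2_id2)

lemma fcell_cseq: "\<lbrakk>arr f; arr g; cd f = dm g\<rbrakk> \<Longrightarrow> fcell (g \<bullet> f) = fcell g \<bullet> fcell f"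
  by (simp add: fcell_def cseq_def arr_def F2_vcomp)

lemma fcell_cpar:
  "\<lbrakk>arr f; arr g; src B (dm f) = trg B (dm g)\<rbrakk> \<Longrightarrow> fcell (f \<diamondop> g) = fcell f \<diamondop> fcell g"
  using src_cd[of f] trg_cd[of g] by (simp add: fcell_def cpar_def arr_def F2_hcomp2 F1_hcomp1)

end

context linear_pivotal_gray_monoid
begin

section \<open>Whiskering of cells by objects, and the interchanger\<close>

definition lbox_cell :: "'o \<Rightarrow> ('m, 'c) cell \<Rightarrow> ('m, 'c) cell" where
  "lbox_cell a f = Cell (a \<rhd> dm f) (a \<unrhd> body f) (a \<rhd> cd f)"

definition rbox_cell :: "('m, 'c) cell \<Rightarrow> 'o \<Rightarrow> ('m, 'c) cell" where
  "rbox_cell f a = Cell (dm f \<lhd> a) (body f \<unlhd> a) (cd f \<lhd> a)"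

lemma box_cell_simps [simp]:
  "dm (lbox_cell a f) = a \<rhd> dm f" "cd (lbox_cell a f) = a \<rhd> cd f" "body (lbox_cell a f) = a \<unrhd> body f"
  "dm (rbox_cell f a) = dm f \<lhd> a" "cd (rbox_cell f a) = cd f \<lhd> a" "body (rbox_cell f a) = body f \<unlhd> a"
  by (simp_all add: lbox_cell_def rbox_cell_def)

lemma lbox_simps [simp]:
  "src B (a \<rhd> X) = a \<box> src B X" "trg B (a \<rhd> X) = a \<box> trg B X" "a \<rhd> \<one> b = \<one> (a \<box> b)"
  "src B X = trg B Y \<Longrightarrow> a \<rhd> (X \<otimes> Y) = (a \<rhd> X) \<otimes> (a \<rhd> Y)"
  "a \<rhd> X\<^sup>\<dagger> = (a \<rhd> X)\<^sup>\<dagger>"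
proof -
  interpret L: linear_pivotal_endofunctor B "\<lambda>\<beta>. a \<box> \<beta>" "\<lambda>X. a \<rhd> X" "\<lambda>f. a \<unrhd> f"
    by (rule lbox_functor)
  show "src B (a \<rhd> X) = a \<box> src B X" "trg B (a \<rhd> X) = a \<box> trg B X" "a \<rhd> \<one> b = \<one> (a \<box> b)"
    "src B X = trg B Y \<Longrightarrow> a \<rhd> (X \<otimes> Y) = (a \<rhd> X) \<otimes> (a \<rhd> Y)" "a \<rhd> X\<^sup>\<dagger> = (a \<rhd> X)\<^sup>\<dagger>"
    by (rule L.src_F1 L.trg_F1 L.F1_unit1 L.F1_hcomp1 L.F1_dag; assumption?)+
qed

lemma rbox_simps [simp]:
  "src B (X \<lhd> a) = src B X \<box> a" "trg B (X \<lhd> a) = trg B X \<box> a" "\<one> b \<lhd> a = \<one> (b \<box> a)"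
  "src B X = trg B Y \<Longrightarrow> (X \<otimes> Y) \<lhd> a = (X \<lhd> a) \<otimes> (Y \<lhd> a)"
  "X\<^sup>\<dagger> \<lhd> a = (X \<lhd> a)\<^sup>\<dagger>"
proof -
  interpret R: linear_pivotal_endofunctor B "\<lambda>\<beta>. \<beta> \<box> a" "\<lambda>X. X \<lhd> a" "\<lambda>f. f \<unlhd> a"
    by (rule rbox_functor)
  show "src B (X \<lhd> a) = src B X \<box> a" "trg B (X \<lhd> a) = trg B X \<box> a" "\<one> b \<lhd> a = \<one> (b \<box> a)"
    "src B X = trg B Y \<Longrightarrow> (X \<otimes> Y) \<lhd> a = (X \<lhd> a) \<otimes> (Y \<lhd> a)" "X\<^sup>\<dagger> \<lhd> a = (X \<lhd> a)\<^sup>\<dagger>"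
    by (rule R.src_F1 R.trg_F1 R.F1_unit1 R.F1_hcomp1 R.F1_dag; assumption?)+
qed

lemma lbox_cell:
  "arr f \<Longrightarrow> arr (lbox_cell a f)" "lbox_cell a (cid X) = cid (a \<rhd> X)"
  "\<lbrakk>arr f; arr g; cd f = dm g\<rbrakk> \<Longrightarrow> lbox_cell a (g \<bullet> f) = lbox_cell a g \<bullet> lbox_cell a f"
proof -
  interpret L: linear_pivotal_endofunctor B "\<lambda>\<beta>. a \<box> \<beta>" "\<lambda>X. a \<rhd> X" "\<lambda>f. a \<unrhd> f"
    by (rule lbox_functor)
  have eq: "lbox_cell a f = L.fcell f" for f
    by (simp add: lbox_cell_def L.fcell_def)
  show "arr f \<Longrightarrow> arr (lbox_cell a f)" "lbox_cell a (cid X) = cid (a \<rhd> X)"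
    "\<lbrakk>arr f; arr g; cd f = dm g\<rbrakk> \<Longrightarrow> lbox_cell a (g \<bullet> f) = lbox_cell a g \<bullet> lbox_cell a f"
    unfolding eq by (rule L.arr_fcell L.fcell_cid L.fcell_cseq; assumption)+
qed

lemma rbox_cell:
  "arr f \<Longrightarrow> arr (rbox_cell f a)" "rbox_cell (cid X) a = cid (X \<lhd> a)"
  "\<lbrakk>arr f; arr g; cd f = dm g\<rbrakk> \<Longrightarrow> rbox_cell (g \<bullet> f) a = rbox_cell g a \<bullet> rbox_cell f a"
  "\<lbrakk>arr f; arr g; src B (dm f) = trg B (dm g)\<rbrakk> \<Longrightarrow> rbox_cell (f \<diamondop> g) a = rbox_cell f a \<diamondop> rbox_cell g a"
proof -
  interpret R: linear_pivotal_endofunctor B "\<lambda>\<beta>. \<beta> \<box> a" "\<lambda>X. X \<lhd> a" "\<lambda>f. f \<unlhd> a"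
    by (rule rbox_functor)
  have eq: "rbox_cell f a = R.fcell f" for f
    by (simp add: rbox_cell_def R.fcell_def)
  show "arr f \<Longrightarrow> arr (rbox_cell f a)" "rbox_cell (cid X) a = cid (X \<lhd> a)"
    "\<lbrakk>arr f; arr g; cd f = dm g\<rbrakk> \<Longrightarrow> rbox_cell (g \<bullet> f) a = rbox_cell g a \<bullet> rbox_cell f a"
    "\<lbrakk>arr f; arr g; src B (dm f) = trg B (dm g)\<rbrakk> \<Longrightarrow> rbox_cell (f \<diamondop> g) a = rbox_cell f a \<diamondop> rbox_cell g a"
    unfolding eq by (rule R.arr_fcell R.fcell_cid R.fcell_cseq R.fcell_cpar; assumption)+
qed

lemma rbox_linear:
  "\<lbrakk>src B X = src B Y; trg B X = trg B Y\<rbrakk>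
    \<Longrightarrow> linear_map_on (scl B) (scl B) (hom B X Y) (hom B (X \<lhd> a) (Y \<lhd> a)) (\<lambda>f. f \<unlhd> a)"
  using linear_pivotal_endofunctor.F2_linear[OF rbox_functor] .

lemma rbox_coev: "coev X \<unlhd> a = coev (X \<lhd> a)"
  using linear_pivotal_endofunctor.F2_coev[OF rbox_functor] .

lemma rbox_cell_box: "arr f \<Longrightarrow> rbox_cell f (a \<box> b) = rbox_cell (rbox_cell f a) b"
  by (simp add: rbox_cell_def arr_def rbox1_rbox1 rbox2_rbox2)

lemmas [simp] = lbox_cell(1) rbox_cell(1) box_assoc box_unit_left box_unit_right lbox1_unit rbox1_unit
  rbox1_rbox1 lbox1_lbox1

definition sigma_cell :: "'m \<Rightarrow> 'm \<Rightarrow> ('m, 'c) cell" where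
  "sigma_cell X Y = Cell ((X \<lhd> trg B Y) \<otimes> (src B X \<rhd> Y)) (\<sigma> X Y) ((trg B X \<rhd> Y) \<otimes> (X \<lhd> src B Y))"

lemma sigma_cell_simps [simp]:
  "dm (sigma_cell X Y) = (X \<lhd> trg B Y) \<otimes> (src B X \<rhd> Y)" "body (sigma_cell X Y) = \<sigma> X Y"
  "cd (sigma_cell X Y) = (trg B X \<rhd> Y) \<otimes> (X \<lhd> src B Y)" "arr (sigma_cell X Y)"
  using sigma_invertible[of X "src B X" "trg B X" Y "src B Y" "trg B Y"]
  by (simp_all add: sigma_cell_def mor_def invertible2_def)

lemma sigma_cell_natural_left:
  assumes f: "arr f" "dm f = X" "cd f = X'"
  shows "sigma_cell X' Y \<bullet> (rbox_cell f (trg B Y) \<diamondop> cid (src B X \<rhd> Y))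
    = (cid (trg B X \<rhd> Y) \<diamondop> rbox_cell f (src B Y)) \<bullet> sigma_cell X Y"
proof -
  have XX: "src B X' = src B X" "trg B X' = trg B X"
    using f src_cd[of f] trg_cd[of f] by auto
  have id: "a \<unrhd> \<^bold>1 Y = \<^bold>1 (a \<rhd> Y)" for a
    using arg_cong[OF lbox_cell(2)[of a Y], of body] by simp
  show ?thesis
    using sigma_natural[of X "src B X" "trg B X" X' Y "src B Y" "trg B Y" Y "body f" "\<^bold>1 Y"] f XX
    by (intro cell.expand) (simp add: mor_def arr_def id2_closed id)
qed

definition inv_cell :: "('m, 'c) cell \<Rightarrow> ('m, 'c) cell \<Rightarrow> bool" where
  "inv_cell f g \<longleftrightarrow> arr f \<and> arr g \<and> dm g = cd f \<and> cd g = dm f \<and> g \<bullet> f = cid (dm f) \<and> f \<bullet> g = cid (cd f)"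

lemma invertible2_imp_inv_cell:
  assumes "invertible2 B X Y f"
  obtains g where "inv_cell (Cell X f Y) g"
proof -
  obtain g where "g \<in> hom B Y X" "g \<cdot> f = \<^bold>1 X" "f \<cdot> g = \<^bold>1 Y" "f \<in> hom B X Y"
    using assms by (auto simp: invertible2_def)
  then have "inv_cell (Cell X f Y) (Cell Y g X)"
    by (simp add: inv_cell_def cseq_def cid_def)
  then show thesis ..
qed

end

context linear_gray_monoid_with_duals
begin

lemma fold_simps [simp]: "src B (\<eta> a) = \<O>" "trg B (\<eta> a) = a \<box> a\<^sup>#" "a\<^sup>#\<^sup># = a"
  using fold_closed[of a] by (simp_all add: mor_def dual_dual)

definition tilde_cell :: "'o \<Rightarrow> ('m, 'c) cell \<Rightarrow> ('m, 'c) cell" where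
  "tilde_cell a f = rbox_cell f (a\<^sup>#) \<diamondop> cid (\<eta> a)"

lemma body_tilde_cell: "body (tilde_cell a f) = tilde B a (body f)"
  by (simp add: tilde_cell_def tilde_def)

text \<open>The domain has the dagger outside the whiskering, the form into which
  \<open>rbox_simps\<close> rewrites; it is the domain of the triangulator because whiskering by an
  object preserves adjoints.\<close>

definition triang_cell :: "'o \<Rightarrow> ('m, 'c) cell" where
  "triang_cell a = Cell ((\<eta> a \<lhd> a)\<^sup>\<dagger> \<otimes> (a \<rhd> \<eta> (a\<^sup>#))) (triang B a) (\<one> a)"

lemma triang_cell_simps [simp]:
  "dm (triang_cell a) = (\<eta> a \<lhd> a)\<^sup>\<dagger> \<otimes> (a \<rhd> \<eta> (a\<^sup>#))" "body (triang_cell a) = triang B a"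
  "cd (triang_cell a) = \<one> a" "arr (triang_cell a)"
  using triang_invertible[of a] by (simp_all add: triang_cell_def invertible2_def)

lemma triang_cell_invertible: obtains g where "inv_cell (triang_cell a) g"
  using invertible2_imp_inv_cell[OF triang_invertible[of a]] by (auto simp: triang_cell_def)

text \<open>The functor \<open>X \<mapsto> (X \<box> \<alpha>\<^sup>#) \<otimes> \<eta>\<^sub>\<alpha>\<close> has the quasi-inverse \<open>Y \<mapsto> (\<alpha> \<box> \<eta>\<^sub>\<alpha>\<^sub>#)\<^sup>\<dagger> \<otimes> (Y \<box> \<alpha>)\<close>.  The swallowtail
  identity says that the mate of \<open>T\<^sub>\<alpha>\<close>, which trivialises one composite at \<open>1\<^sub>\<alpha>\<close>, is inverted by
  the isomorphism built from \<open>T\<^sub>\<alpha>\<^sub>#\<close> and \<open>\<sigma>\<close>, which trivialises the other composite at \<open>\<eta>\<^sub>\<alpha>\<close>.\<close>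

lemma tilde_cell_inverse:
  fixes a :: 'o
  defines "h \<equiv> \<eta> a" and "b \<equiv> a\<^sup>#"
  obtains G where
    "\<forall>f. arr f \<and> dm f = h \<and> cd f = h \<longrightarrow>
      arr (G f) \<and> dm (G f) = \<one> a \<and> cd (G f) = \<one> a \<and> tilde_cell a (G f) = f"
    "\<forall>f. arr f \<and> dm f = \<one> a \<and> cd f = \<one> a \<longrightarrow> G (tilde_cell a f) = f"
proof -
  define C where "C = h \<lhd> a"
  define D where "D = a \<rhd> \<eta> b"
  define K where "K = D\<^sup>\<dagger> \<lhd> b"
  have h [simp]: "src B h = \<O>" "trg B h = a \<box> b" and b [simp]: "b\<^sup># = a"
    by (simp_all add: h_def b_def)
  have CD [simp]: "src B C = a" "trg B C = a \<box> b \<box> a" "src B D = a" "trg B D = a \<box> b \<box> a"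
    by (simp_all add: C_def D_def)
  have K [simp]: "src B K = a \<box> b \<box> a \<box> b" "trg B K = a \<box> b"
    unfolding K_def by simp_all
  let ?T = "triang_cell a"
  have T: "arr ?T" "dm ?T = C\<^sup>\<dagger> \<otimes> D" "cd ?T = \<one> a"
    by (simp_all add: C_def D_def h_def b_def)
  obtain T' where T': "arr T'" "dm T' = \<one> a" "cd T' = C\<^sup>\<dagger> \<otimes> D" "?T \<bullet> T' = cid (\<one> a)"
    using triang_cell_invertible[of a] T by (auto simp: inv_cell_def)
  \<comment> \<open>\<open>N\<close> is the mate of the triangulator and \<open>M\<close> the
    corresponding mate of its inverse; by \<open>mate_section\<close> the latter retracts the
    former.\<close>
  define N where "N = name (unconame C D ?T)"
  define M where "M = coname (unname C D T')"
  have N [simp]: "arr N" "dm N = \<one> a" "cd N = D\<^sup>\<dagger> \<otimes> C"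
    and M [simp]: "arr M" "dm M = D\<^sup>\<dagger> \<otimes> C" "cd M = \<one> a"
    using T T' by (simp_all add: N_def M_def unconame_simps unname_simps)
  have MN: "M \<bullet> N = cid (\<one> a)"
    using mate_section[of D C ?T T'] T T' by (simp add: M_def N_def)
  have "N = (cid (D\<^sup>\<dagger> \<otimes> C) \<diamondop> ?T) \<bullet> (cid (D\<^sup>\<dagger>) \<diamondop> coevc C \<diamondop> cid D) \<bullet> coevtc D"
    unfolding N_def using T by (simp add: name_unconame)
  then have body_N: "body N = triang_mate B a"
    by (simp add: triang_mate_def C_def D_def h_def b_def rbox_coev)
  have bh: "\<eta> a = h" "a\<^sup># = b"
    by (simp_all add: h_def b_def)
  define H where "H = h \<lhd> (a \<box> b)"
  define E where "E = (a \<box> b) \<rhd> h"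
  have HE [simp]: "src B H = a \<box> b" "trg B H = a \<box> b \<box> a \<box> b"
    "src B E = a \<box> b" "trg B E = a \<box> b \<box> a \<box> b"
    by (simp_all add: H_def E_def)
  have CH: "C \<lhd> b = H"
    by (simp add: C_def H_def)
  define tb where "tb = lbox_cell a (triang_cell b)"
  define sg where "sg = sigma_cell h h"
  define rN where "rN = rbox_cell N b"
  define rM where "rM = rbox_cell M b"
  have tb [simp]: "arr tb" "dm tb = K \<otimes> E" "cd tb = \<one> (a \<box> b)" "body tb = a \<unrhd> triang B b"
    by (simp_all add: tb_def bh K_def D_def E_def lbox1_rbox1)
  have sg [simp]: "arr sg" "dm sg = H \<otimes> h" "cd sg = E \<otimes> h" "body sg = \<sigma> h h"
    by (simp_all add: sg_def H_def E_def)
  have rN [simp]: "arr rN" "dm rN = \<one> (a \<box> b)" "cd rN = K \<otimes> H" "body rN = triang_mate B a \<unlhd> b"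
    by (simp_all add: rN_def body_N K_def CH[symmetric])
  have rM [simp]: "arr rM" "dm rM = K \<otimes> H" "cd rM = \<one> (a \<box> b)"
    by (simp_all add: rM_def K_def CH[symmetric])
  \<comment> \<open>The swallowtail identity read as \<open>n \<bullet> u = cid h\<close>:
    \<open>n\<close> collects the triangulator of the dual object and the interchanger,
    \<open>u\<close> is the whiskered mate. The third map \<open>m\<close> is the whiskered
    retraction, a second left inverse of \<open>u\<close>.\<close>
  define n where "n = (tb \<diamondop> cid h) \<bullet> (cid K \<diamondop> sg)"
  define u where "u = rN \<diamondop> cid h"
  define m where "m = rM \<diamondop> cid h"
  have nt [simp]: "arr n" "dm n = K \<otimes> H \<otimes> h" "cd n = h"
    by (simp_all add: n_def)
  have ut [simp]: "arr u" "dm u = h" "cd u = K \<otimes> H \<otimes> h"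
    by (simp_all add: u_def)
  have mt [simp]: "arr m" "dm m = K \<otimes> H \<otimes> h" "cd m = h"
    by (simp_all add: m_def)
  have rMN: "rM \<bullet> rN = cid (\<one> (a \<box> b))"
    using rbox_cell(3)[of N M b] by (simp add: rM_def rN_def MN rbox_cell)
  have mu: "m \<bullet> u = cid h"
    by (simp add: m_def u_def cseq_cpar rMN)
  have "body ((tb \<diamondop> cid h) \<bullet> (cid K \<diamondop> sg) \<bullet> u) = \<^bold>1 h"
    using swallowtail[of a] by (simp add: u_def bh K_def D_def lbox1_rbox1)
  then have nu: "n \<bullet> u = cid h"
    by (intro cell.expand) (simp add: n_def)
  obtain n' where n': "arr n'" "dm n' = h" "cd n' = K \<otimes> H \<otimes> h" "n' \<bullet> n = cid (K \<otimes> H \<otimes> h)"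
  proof -
    obtain t' where t': "arr t'" "dm t' = \<one> b" "cd t' = dm (triang_cell b)"
        "t' \<bullet> triang_cell b = cid (dm (triang_cell b))"
      using triang_cell_invertible[of b] by (auto simp: inv_cell_def)
    define lt where "lt = lbox_cell a t'"
    have lt [simp]: "arr lt" "dm lt = \<one> (a \<box> b)" "cd lt = K \<otimes> E"
      using t' tb(2) by (simp_all add: lt_def tb_def)
    have ltb: "lt \<bullet> tb = cid (K \<otimes> E)"
      using lbox_cell(3)[of "triang_cell b" t' a] t' tb(2)
      by (simp add: lt_def tb_def lbox_cell(2) del: triang_cell_simps(1))
    obtain s' where s': "arr s'" "dm s' = E \<otimes> h" "cd s' = H \<otimes> h" "s' \<bullet> sg = cid (H \<otimes> h)"
      using invertible2_imp_inv_cell[OF sigma_invertible[of h \<O> "a \<box> b" h \<O> "a \<box> b"]] sg(2,3)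
      by (auto simp: inv_cell_def mor_def sg_def sigma_cell_def)
    show thesis
    proof (rule that)
      show "((cid K \<diamondop> s') \<bullet> (lt \<diamondop> cid h)) \<bullet> n = cid (K \<otimes> H \<otimes> h)"
      proof -
        have "((cid K \<diamondop> s') \<bullet> (lt \<diamondop> cid h)) \<bullet> n
            = (cid K \<diamondop> s') \<bullet> ((lt \<diamondop> cid h) \<bullet> (tb \<diamondop> cid h)) \<bullet> (cid K \<diamondop> sg)"
          using s' by (simp add: n_def)
        also have "(lt \<diamondop> cid h) \<bullet> (tb \<diamondop> cid h) = cid (K \<otimes> E \<otimes> h)"
          by (simp add: cseq_cpar ltb)
        finally show ?thesis
          using s' by (simp add: cseq_cpar)
      qed
    qed (use s' in simp_all)
  qed
  \<comment> \<open>As \<open>n\<close> is invertible, its right inverse \<open>u\<close> is its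
    inverse, so the left inverse \<open>m\<close> of \<open>u\<close> is \<open>n\<close>. Hence the
    factor \<open>M\<close> of \<open>G\<close>, once whiskered, may be replaced by the triangulator
    and the interchanger, whose naturality is available.\<close>
  have "n = m"
  proof -
    have "n' = (n' \<bullet> n) \<bullet> u"
      using n'(1-3) nu by simp
    then have "u = n'"
      using n' by simp
    then have un: "u \<bullet> n = cid (K \<otimes> H \<otimes> h)"
      using n'(4) by simp
    have "m = m \<bullet> (u \<bullet> n)"
      by (simp add: un)
    also have "\<dots> = (m \<bullet> u) \<bullet> n"
      by simp
    finally show ?thesis
      by (simp add: mu)
  qed
  \<comment> \<open>The quasi-inverse functor applied to \<open>f\<close>, carried back to 1_a along
    \<open>N\<close> and its retraction \<open>M\<close>.\<close>
  define G where "G f = M \<bullet> (cid (D\<^sup>\<dagger>) \<diamondop> rbox_cell f a) \<bullet> N" for f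
  have f0: "rbox_cell f \<O> = f" if "arr f" for f
    using that rbox2_unit[of "body f" "dm f" "cd f"] by (intro cell.expand) (simp add: arr_def)
  show thesis
  proof (rule that; intro allI impI; elim conjE)
    fix f assume f: "arr f" "dm f = h" "cd f = h"
    define r where "r = rbox_cell f a"
    have r [simp]: "arr r" "dm r = C" "cd r = C"
      using f by (simp_all add: r_def C_def)
    have G_type: "arr (G f) \<and> dm (G f) = \<one> a \<and> cd (G f) = \<one> a"
      by (simp add: G_def r_def[symmetric])
    define rr where "rr = rbox_cell f (a \<box> b)"
    have rr [simp]: "arr rr" "dm rr = H" "cd rr = H"
      using f by (simp_all add: rr_def H_def)
    have "rbox_cell (G f) b = rM \<bullet> rbox_cell (cid (D\<^sup>\<dagger>) \<diamondop> r) b \<bullet> rN"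
      by (simp add: G_def r_def[symmetric] rbox_cell rM_def rN_def del: rbox_simps(5))
    also have "rbox_cell (cid (D\<^sup>\<dagger>) \<diamondop> r) b = cid K \<diamondop> rr"
      using f by (simp add: rbox_cell K_def rr_def r_def rbox_cell_box)
    finally have "tilde_cell a (G f) = m \<bullet> (cid K \<diamondop> rr \<diamondop> cid h) \<bullet> u"
      by (simp add: tilde_cell_def bh m_def u_def whisker_right_cseq)
    also have "\<dots> = (tb \<diamondop> cid h) \<bullet> ((cid K \<diamondop> sg) \<bullet> (cid K \<diamondop> rr \<diamondop> cid h)) \<bullet> u"
      unfolding \<open>n = m\<close>[symmetric] by (simp add: n_def)
    also have "(cid K \<diamondop> sg) \<bullet> (cid K \<diamondop> rr \<diamondop> cid h) = cid K \<diamondop> (sg \<bullet> (rr \<diamondop> cid h))"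
      by (subst cseq_cpar) simp_all
    \<comment> \<open>Naturality of \<sigma> exchanges the two copies of the fold: the whiskered
      \<open>f\<close> on \<open>H\<close> becomes the bare \<open>f\<close> on \<open>h\<close>,
      which can slide past the triangulator.\<close>
    also have "sg \<bullet> (rr \<diamondop> cid h) = (cid E \<diamondop> f) \<bullet> sg"
      using sigma_cell_natural_left[OF f, of h]
      by (simp only: h lbox1_unit f0[OF f(1)] sg_def rr_def E_def)
    also have "(tb \<diamondop> cid h) \<bullet> (cid K \<diamondop> ((cid E \<diamondop> f) \<bullet> sg)) \<bullet> u
        = ((tb \<diamondop> cid h) \<bullet> (cid (K \<otimes> E) \<diamondop> f)) \<bullet> (cid K \<diamondop> sg) \<bullet> u"
      using f by (simp add: whisker_left_cseq)
    also have "(tb \<diamondop> cid h) \<bullet> (cid (K \<otimes> E) \<diamondop> f) = f \<bullet> (tb \<diamondop> cid h)"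
      using f cpar_split_left_first[of tb f] cpar_split_right_first[of tb f] by simp
    also have "(f \<bullet> (tb \<diamondop> cid h)) \<bullet> (cid K \<diamondop> sg) \<bullet> u = f \<bullet> (n \<bullet> u)"
      using f by (simp add: n_def)
    finally have "tilde_cell a (G f) = f"
      using f by (simp add: nu)
    with G_type show "arr (G f) \<and> dm (G f) = \<one> a \<and> cd (G f) = \<one> a \<and> tilde_cell a (G f) = f"
      by blast
  next
    fix f assume f: "arr f" "dm f = \<one> a" "cd f = \<one> a"
    \<comment> \<open>The interchanger of 1_a with \<open>Y\<close> is an identity, so its
      naturality says that \<open>f\<close> passes through \<open>D\<^sup>\<dagger>\<close> and is
      whiskered by b \<box> a on the other side. This brings \<open>f\<close> next to
      \<open>M\<close>, past which it slides.\<close>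
    define Y where "Y = (\<eta> b)\<^sup>\<dagger>"
    have Y: "src B Y = b \<box> a" "trg B Y = \<O>" "a \<rhd> Y = D\<^sup>\<dagger>"
      by (simp_all add: Y_def D_def)
    have sY: "sigma_cell (\<one> a) Y = cid (D\<^sup>\<dagger>)"
      using sigma_unit_left[of Y "b \<box> a" \<O> a] Y
      by (intro cell.expand) (simp add: mor_def)
    define r where "r = rbox_cell f (b \<box> a)"
    have r [simp]: "arr r" "dm r = \<one> (a \<box> b \<box> a)" "cd r = \<one> (a \<box> b \<box> a)"
      using f by (simp_all add: r_def del: rbox1_rbox1)
    have nat: "cid (D\<^sup>\<dagger>) \<diamondop> r = f \<diamondop> cid (D\<^sup>\<dagger>)"
      using sigma_cell_natural_left[OF f, of Y] f f0[OF f(1)] Y sY by (simp add: r_def[symmetric])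
    have "rbox_cell (tilde_cell a f) a = r \<diamondop> cid C"
      using f rbox_cell_box[of f b a] by (simp add: tilde_cell_def bh rbox_cell r_def C_def)
    then have "G (tilde_cell a f) = M \<bullet> ((cid (D\<^sup>\<dagger>) \<diamondop> r) \<diamondop> cid C) \<bullet> N"
      by (simp add: G_def)
    also have "\<dots> = (M \<bullet> (f \<diamondop> cid (D\<^sup>\<dagger> \<otimes> C))) \<bullet> N"
      unfolding nat using f by simp
    also have "M \<bullet> (f \<diamondop> cid (D\<^sup>\<dagger> \<otimes> C)) = f \<bullet> M"
      using f cpar_split_left_first[of f M] cpar_split_right_first[of f M] by simp
    finally show "G (tilde_cell a f) = f"
      using f by (simp add: MN)
  qed
qed

end

section \<open>Linearity\<close>

lemma vector_space_field: "vector_space ((*) :: 'k::field \<Rightarrow> 'k \<Rightarrow> 'k)"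
  by unfold_locales (simp_all add: algebra_simps)

context linear_two_category
begin

sublocale scl: vector_space "scl B"
  by (rule vector_space)

lemma linear_vcomp_left:
  assumes "g \<in> hom B Y Z" "src B X = src B Y" "trg B X = trg B Y"
  shows "linear_map_on (scl B) (scl B) (hom B X Y) (hom B X Z) (\<lambda>f. g \<cdot> f)"
  using vcomp_bilinear[of X "src B X" "trg B X" Y Z] assms hom_parallel[OF assms(1)]
  by (simp add: bilinear_map_on_def mor_def)

lemma linear_vcomp_right:
  assumes "f \<in> hom B X Y" "src B Y = src B Z" "trg B Y = trg B Z"
  shows "linear_map_on (scl B) (scl B) (hom B Y Z) (hom B X Z) (\<lambda>g. g \<cdot> f)"
  using vcomp_bilinear[of X "src B X" "trg B X" Y Z] assms hom_parallel[OF assms(1)]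
  by (simp add: bilinear_map_on_def mor_def)

lemma linear_hcomp2_left:
  assumes "f \<in> hom B X X'" "src B Y = src B Y'" "trg B Y = trg B Y'" "src B X = trg B Y"
  shows "linear_map_on (scl B) (scl B) (hom B Y Y') (hom B (X \<otimes> Y) (X' \<otimes> Y')) (\<lambda>g. f \<star> g)"
  using hcomp2_bilinear[of X "src B X" "trg B X" X' Y "src B Y" Y'] assms hom_parallel[OF assms(1)]
  by (simp add: bilinear_map_on_def mor_def)

lemma linear_hcomp2_right:
  assumes "g \<in> hom B Y Y'" "src B X = src B X'" "trg B X = trg B X'" "src B X = trg B Y"
  shows "linear_map_on (scl B) (scl B) (hom B X X') (hom B (X \<otimes> Y) (X' \<otimes> Y')) (\<lambda>f. f \<star> g)"
  using hcomp2_bilinear[of X "src B X" "trg B X" X' Y "src B Y" Y'] assms hom_parallel[OF assms(1)]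
  by (simp add: bilinear_map_on_def mor_def)

lemma linear_sum:
  assumes "linear_map_on (scl B) (scl B) (hom B X Y) W f" "src B X = src B Y" "trg B X = trg B Y"
    and "\<And>i. i \<in> I \<Longrightarrow> g i \<in> hom B X Y"
  shows "f (\<Sum>i\<in>I. scl B (c i) (g i)) = (\<Sum>i\<in>I. scl B (c i) (f (g i)))"
  using assms by (intro linear_map_on_sum[OF vector_space vector_space hom_subspace])

lemma linear_sum':
  assumes "linear_map_on (scl B) (scl B) (hom B X Y) W f" "src B X = src B Y" "trg B X = trg B Y"
    and "\<And>i. i \<in> I \<Longrightarrow> g i \<in> hom B X Y"
  shows "f (\<Sum>i\<in>I. g i) = (\<Sum>i\<in>I. f (g i))"
  using linear_sum[OF assms, where c = "\<lambda>_. 1"] by simp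

lemma linear_functional_sum:
  assumes "linear_map_on (scl B) (*) (hom B X Y) UNIV f" "src B X = src B Y" "trg B X = trg B Y"
    and "\<And>i. i \<in> I \<Longrightarrow> g i \<in> hom B X Y"
  shows "f (\<Sum>i\<in>I. g i) = (\<Sum>i\<in>I. f (g i))"
  using linear_map_on_sum[OF vector_space vector_space_field hom_subspace assms(1,4),
      where c = "\<lambda>_. 1"] assms(2,3) by simp

lemma endo_algebra: "algebra_on (scl B) (endo B X) (vcomp B) (\<^bold>1 X)"
proof
  show "scl.subspace (endo B X)"
    by (simp add: endo_def hom_subspace)
  show "bilinear_map_on (scl B) (scl B) (scl B) (endo B X) (endo B X) (endo B X) (vcomp B)"
    using vcomp_bilinear[of X "src B X" "trg B X" X X] by (simp add: endo_def mor_def)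
  fix f g h assume "f \<in> endo B X" "g \<in> endo B X" "h \<in> endo B X"
  then show "(f \<cdot> g) \<cdot> h = f \<cdot> (g \<cdot> h)"
    by (simp add: endo_def vcomp_assoc)
qed (simp_all add: endo_def id2_closed id2_left id2_right)

lemma whisker_central:
  assumes "\<phi> \<in> hom B (\<one> a) (\<one> a)" "f \<in> hom B X Y" "trg B X = a"
  shows "f \<cdot> (\<phi> \<star> \<^bold>1 X) = (\<phi> \<star> \<^bold>1 Y) \<cdot> f"
proof -
  let ?p = "Cell (\<one> a) \<phi> (\<one> a)" and ?f = "Cell X f Y"
  have "?f \<bullet> (?p \<diamondop> cid X) = (?p \<diamondop> cid Y) \<bullet> ?f"
    using assms hom_parallel[OF assms(2)] cpar_split_left_first[of ?p ?f] cpar_split_right_first[of ?p ?f]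
    by simp
  then show ?thesis
    by (auto dest: arg_cong[of _ _ body])
qed

text \<open>The Eckmann-Hilton argument: centrality of whiskered elements, taken at X = Y =
  1_a.\<close>

lemma unit_endo_commute:
  assumes "\<phi> \<in> hom B (\<one> a) (\<one> a)" "\<psi> \<in> hom B (\<one> a) (\<one> a)"
  shows "\<psi> \<cdot> \<phi> = \<phi> \<cdot> \<psi>"
  using whisker_central[OF assms] hcomp2_unit_right[OF assms(1)] by simp

end

context linear_pivotal_two_category
begin

lemma linear_left_trace:
  "linear_map_on (scl B) (scl B) (hom B X X) (hom B (\<one> (src B X)) (\<one> (src B X))) (tr\<^sub>l X)"
  unfolding left_trace_def
  by (rule linear_map_on_compose[OF linear_map_on_compose[OF
        linear_hcomp2_left[OF id2_closed] linear_vcomp_right[OF coevt_closed]]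
        linear_vcomp_left[OF ev_closed]]) simp_all

lemma linear_right_trace:
  "linear_map_on (scl B) (scl B) (hom B X X) (hom B (\<one> (trg B X)) (\<one> (trg B X))) (tr\<^sub>r X)"
  unfolding right_trace_def
  by (rule linear_map_on_compose[OF linear_map_on_compose[OF
        linear_hcomp2_right[OF id2_closed] linear_vcomp_right[OF coev_closed]]
        linear_vcomp_left[OF evt_closed]]) simp_all

text \<open>\<phi> lives in the region outside the circle formed by X, so it can be pulled off the
  coevaluation.\<close>

lemma right_trace_whisker:
  assumes f: "f \<in> hom B X X" and p: "\<phi> \<in> hom B (\<one> a) (\<one> a)" and X: "trg B X = a"
  shows "tr\<^sub>r X (f \<cdot> (\<phi> \<star> \<^bold>1 X)) = tr\<^sub>r X f \<cdot> \<phi>"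
proof -
  let ?p = "Cell (\<one> a) \<phi> (\<one> a)" and ?f = "Cell X f X"
  have "evtc X \<bullet> ((?f \<bullet> (?p \<diamondop> cid X)) \<diamondop> cid (X\<^sup>\<dagger>)) \<bullet> coevc X
      = evtc X \<bullet> (?f \<diamondop> cid (X\<^sup>\<dagger>)) \<bullet> (?p \<diamondop> cid (X \<otimes> X\<^sup>\<dagger>)) \<bullet> coevc X"
    using f p X by (simp add: whisker_right_cseq)
  also have "(?p \<diamondop> cid (X \<otimes> X\<^sup>\<dagger>)) \<bullet> coevc X = coevc X \<bullet> ?p"
    using p X cpar_split_left_first[of ?p "coevc X"] cpar_split_right_first[of ?p "coevc X"] by simp
  also have "evtc X \<bullet> (?f \<diamondop> cid (X\<^sup>\<dagger>)) \<bullet> coevc X \<bullet> ?p = (evtc X \<bullet> (?f \<diamondop> cid (X\<^sup>\<dagger>)) \<bullet> coevc X) \<bullet> ?p"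
    using f p X by simp
  finally show ?thesis
    by (auto simp: right_trace_def dest: arg_cong[of _ _ body])
qed

text \<open>The left side is a circle X carrying \<open>f\<close> beside a strand Y. The adjacent
  half of the circle and the strand together form \<open>X\<^sup>\<dagger> \<otimes> Y\<close>; each
  summand of its identity factors through a unit 1-morphism, so it opens the circle and joins it to
  the strand, which then runs through \<open>v' i\<close>, \<open>f\<close> and
  \<open>v i\<close>.\<close>

lemma right_trace_whisker_frame:
  assumes f: "f \<in> hom B X X" and XY: "src B Y = src B X" "trg B Y = trg B X"
    and v: "\<And>i. i \<in> I \<Longrightarrow> v i \<in> hom B X Y" and v': "\<And>i. i \<in> I \<Longrightarrow> v' i \<in> hom B Y X"
    and frame: "\<^bold>1 (X\<^sup>\<dagger> \<otimes> Y) = (\<Sum>i\<in>I. body (name (Cell X (v i) Y) \<bullet> coname (Cell Y (v' i) X)))"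
  shows "tr\<^sub>r X f \<star> \<^bold>1 Y = (\<Sum>i\<in>I. v i \<cdot> f \<cdot> v' i)"
proof -
  let ?f = "Cell X f X"
  \<comment> \<open>The picture with \<open>h\<close> inserted on
    \<open>X\<^sup>\<dagger> \<otimes> Y\<close>. Its argument is a bare 2-morphism, since sums
    exist for bodies and not for cells.\<close>
  define P where "P h = (evtc X \<diamondop> cid Y) \<bullet> (?f \<diamondop> Cell (X\<^sup>\<dagger> \<otimes> Y) h (X\<^sup>\<dagger> \<otimes> Y)) \<bullet> (coevc X \<diamondop> cid Y)" for h
  have "linear_map_on (scl B) (scl B) (hom B (X\<^sup>\<dagger> \<otimes> Y) (X\<^sup>\<dagger> \<otimes> Y)) (hom B Y Y)
      (\<lambda>h. (evt X \<star> \<^bold>1 Y) \<cdot> (f \<star> h) \<cdot> (coev X \<star> \<^bold>1 Y))"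
  proof (rule linear_map_on_compose[OF linear_map_on_compose[OF
        linear_hcomp2_left[OF f] linear_vcomp_right] linear_vcomp_left])
    show "coev X \<star> \<^bold>1 Y \<in> hom B Y (X \<otimes> X\<^sup>\<dagger> \<otimes> Y)"
      using hcomp2_closed[OF coev_closed[of X] id2_closed[of Y]] XY by simp
    show "evt X \<star> \<^bold>1 Y \<in> hom B (X \<otimes> X\<^sup>\<dagger> \<otimes> Y) Y"
      using hcomp2_closed[OF evt_closed[of X] id2_closed[of Y]] XY by simp
  qed (simp_all add: XY)
  then have lin: "linear_map_on (scl B) (scl B) (hom B (X\<^sup>\<dagger> \<otimes> Y) (X\<^sup>\<dagger> \<otimes> Y)) (hom B Y Y) (\<lambda>h. body (P h))"
    by (simp add: P_def)
  have P_one: "body (P (\<^bold>1 (X\<^sup>\<dagger> \<otimes> Y))) = tr\<^sub>r X f \<star> \<^bold>1 Y"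
  proof -
    have "P (\<^bold>1 (X\<^sup>\<dagger> \<otimes> Y)) = (evtc X \<bullet> (?f \<diamondop> cid (X\<^sup>\<dagger>)) \<bullet> coevc X) \<diamondop> cid Y"
      using f XY by (simp add: P_def cid_def[of "X\<^sup>\<dagger> \<otimes> Y", symmetric] whisker_right_cseq)
    then show ?thesis
      by (simp add: right_trace_def)
  qed
  have P_cut: "body (P (body (name (Cell X (v i) Y) \<bullet> coname (Cell Y (v' i) X)))) = v i \<cdot> f \<cdot> v' i"
    if i: "i \<in> I" for i
  proof -
    let ?v = "Cell X (v i) Y" and ?v' = "Cell Y (v' i) X"
    have a: "arr ?v" "arr ?v'" "arr ?f"
      using f v[OF i] v'[OF i] by simp_all
    have "?f \<diamondop> (name ?v \<bullet> coname ?v') = (cid X \<diamondop> name ?v) \<bullet> (?f \<diamondop> coname ?v')"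
      using a XY by (subst cseq_cpar) simp_all
    also have "?f \<diamondop> coname ?v' = ?f \<bullet> (cid X \<diamondop> coname ?v')"
      using cpar_split_right_first[of ?f "coname ?v'"] a XY by simp
    moreover have "P (body (name ?v \<bullet> coname ?v'))
        = (evtc X \<diamondop> cid Y) \<bullet> (?f \<diamondop> (name ?v \<bullet> coname ?v')) \<bullet> (coevc X \<diamondop> cid Y)"
      using XY by (simp add: P_def cpar_def cseq_def)
    ultimately have "P (body (name ?v \<bullet> coname ?v')) = unname X Y (name ?v) \<bullet> ?f \<bullet> unconame X Y (coname ?v')"
      using a XY by (simp add: unname_def unconame_def)
    then show ?thesis
      using a XY by (simp add: unname_name unconame_coname)
  qed
  have "tr\<^sub>r X f \<star> \<^bold>1 Y = body (P (\<Sum>i\<in>I. body (name (Cell X (v i) Y) \<bullet> coname (Cell Y (v' i) X))))"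
    unfolding P_one[symmetric] frame ..
  also have "\<dots> = (\<Sum>i\<in>I. body (P (body (name (Cell X (v i) Y) \<bullet> coname (Cell Y (v' i) X)))))"
  proof (rule linear_sum'[OF lin])
    fix i assume i: "i \<in> I"
    have "arr (name (Cell X (v i) Y) \<bullet> coname (Cell Y (v' i) X))"
      using v[OF i] v'[OF i] XY by simp
    then show "body (name (Cell X (v i) Y) \<bullet> coname (Cell Y (v' i) X)) \<in> hom B (X\<^sup>\<dagger> \<otimes> Y) (X\<^sup>\<dagger> \<otimes> Y)"
      by (simp add: arr_def)
  qed simp_all
  also have "\<dots> = (\<Sum>i\<in>I. v i \<cdot> f \<cdot> v' i)"
    by (rule sum.cong) (simp_all only: P_cut)
  finally show ?thesis .
qed

end

section \<open>Linearisation over the unit object\<close>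

lemma vector_space_seq_scl: "vector_space (seq_scl :: 'k::field \<Rightarrow> _)"
  by unfold_locales (auto simp: seq_scl_def algebra_simps fun_eq_iff)

lemma fin_dim_subspace_basis:
  assumes s: "vector_space s" and V: "fin_dim_subspace s V"
  obtains S where "finite S" "\<not> module.dependent s S" "module.span s S = V"
proof -
  interpret s: vector_space s by fact
  obtain T where T: "finite T" "s.span T = V" and sub: "s.subspace V"
    using V by (auto simp: fin_dim_subspace_def)
  obtain S where S: "S \<subseteq> V" "s.independent S" "V \<subseteq> s.span S"
    using s.basis_exists by metis
  show thesis
    using that[of S] S T s.independent_span_bound[of T S] s.span_minimal[OF S(1) sub] by auto
qed

locale gray_monoid_over_Vect = linear_gray_monoid_with_duals B + Vect_equivalence B V F \<mu> e
  for B :: "('o, 'm, 'c::ab_group_add, 'k::field, 'z) gray_monoid_with_duals_scheme" (structure)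
    and V :: "'m \<Rightarrow> (nat \<Rightarrow> 'k) set"
    and F :: "'m \<Rightarrow> 'm \<Rightarrow> 'c \<Rightarrow> (nat \<Rightarrow> 'k) \<Rightarrow> (nat \<Rightarrow> 'k)"
    and \<mu> :: "'m \<Rightarrow> 'm \<Rightarrow> (nat \<Rightarrow> 'k) \<Rightarrow> (nat \<Rightarrow> 'k) \<Rightarrow> (nat \<Rightarrow> 'k)"
    and e :: "nat \<Rightarrow> 'k"
begin

interpretation seq: vector_space "seq_scl :: 'k \<Rightarrow> _"
  by (rule vector_space_seq_scl)

lemma unit_mor: "\<one> \<O> \<in> mor B \<O> \<O>"
  by (simp add: mor_def)

lemma F_faithful:
  assumes "X \<in> mor B \<O> \<O>" "Y \<in> mor B \<O> \<O>" "f \<in> hom B X Y" "g \<in> hom B X Y"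
    and "\<And>v. v \<in> V X \<Longrightarrow> F X Y f v = F X Y g v"
  shows "f = g"
  using fully_faithful[OF assms(1,2) F_closed[OF assms(1,2,4)]] assms(3-5) by blast

lemma F_sum:
  assumes "X \<in> mor B \<O> \<O>" "Y \<in> mor B \<O> \<O>" "v \<in> V X" "\<And>i. i \<in> I \<Longrightarrow> f i \<in> hom B X Y"
  shows "F X Y (\<Sum>i\<in>I. f i) v = (\<Sum>i\<in>I. F X Y (f i) v)"
proof -
  have "scl.subspace (hom B X Y)"
    using assms(1,2) by (simp add: hom_subspace mor_def)
  then show ?thesis
    using linear_map_on_sum[OF vector_space vector_space_seq_scl _ F_linear[OF assms(1,2,3)] assms(4),
        where c = "\<lambda>_. 1"] by simp
qed

text \<open>The coordinate on the line \<open>V (\<one> \<O>)\<close> with respect to its generator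
  \<open>e\<close>.\<close>

definition unit_coord :: "(nat \<Rightarrow> 'k) \<Rightarrow> 'k" where
  "unit_coord = the_inv_into UNIV (\<lambda>c. seq_scl c e)"

lemma unit_coord [simp]: "unit_coord (seq_scl c e) = c"
  using unit_iso the_inv_into_f_f[of "\<lambda>c. seq_scl c e" UNIV c] by (simp add: unit_coord_def bij_betw_def)

lemma V_unitE:
  assumes "v \<in> V (\<one> \<O>)"
  obtains c where "v = seq_scl c e"
  using unit_iso assms by (auto simp: bij_betw_def)

lemma V_unitI: "seq_scl c e \<in> V (\<one> \<O>)"
  using unit_iso by (auto simp: bij_betw_def)

lemma unit_coord_add:
  "\<lbrakk>v \<in> V (\<one> \<O>); w \<in> V (\<one> \<O>)\<rbrakk> \<Longrightarrow> unit_coord (v + w) = unit_coord v + unit_coord w"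
  by (metis V_unitE seq.scale_left_distrib unit_coord)

lemma unit_coord_scl: "v \<in> V (\<one> \<O>) \<Longrightarrow> unit_coord (seq_scl c v) = c * unit_coord v"
  by (metis V_unitE seq.scale_scale unit_coord)

lemma e_closed: "e \<in> V (\<one> \<O>)"
  using V_unitI[of 1] by simp

lemma F_unit_scl: "F (\<one> \<O>) (\<one> \<O>) (scl B c (\<^bold>1 (\<one> \<O>))) v = seq_scl c v" if "v \<in> V (\<one> \<O>)"
  using linear_map_onD(3)[OF F_linear[OF unit_mor unit_mor that] id2_closed] F_id2[OF unit_mor that]
  by simp

lemma scalar_unique:
  assumes "scl B c (\<^bold>1 (\<one> \<O>)) = scl B d (\<^bold>1 (\<one> \<O>))"
  shows "c = d"
  using F_unit_scl[OF e_closed, of c] F_unit_scl[OF e_closed, of d] assms unit_coord by metis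

lemma scl_id2_closed: "scl B c (\<^bold>1 X) \<in> hom B X X"
  by (rule scl.subspace_scale[OF hom_subspace]) (simp_all add: id2_closed)

lemma scalar_of_scl: "scalar_of B (scl B c (\<^bold>1 (\<one> \<O>))) = c"
  unfolding scalar_of_def using scalar_unique by blast

text \<open>The image of \<open>f\<close> is an endomorphism of a line, hence multiplication by a
  scalar, and \<open>F\<close> is faithful. With \<open>scalar_of_scl\<close> this shows that the
  definite description in \<open>scalar_of\<close> denotes.\<close>

lemma scalar_of_eq:
  assumes f: "f \<in> hom B (\<one> \<O>) (\<one> \<O>)"
  shows "scl B (scalar_of B f) (\<^bold>1 (\<one> \<O>)) = f"
proof -
  note Ff = F_closed[OF unit_mor unit_mor f]
  obtain c where c: "F (\<one> \<O>) (\<one> \<O>) f e = seq_scl c e"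
    using linear_map_onD(1)[OF Ff e_closed] by (rule V_unitE)
  have "f = scl B c (\<^bold>1 (\<one> \<O>))"
  proof (rule F_faithful[OF unit_mor unit_mor f scl_id2_closed])
    fix v assume v: "v \<in> V (\<one> \<O>)"
    then obtain d where d: "v = seq_scl d e" by (rule V_unitE)
    show "F (\<one> \<O>) (\<one> \<O>) f v = F (\<one> \<O>) (\<one> \<O>) (scl B c (\<^bold>1 (\<one> \<O>))) v"
      using linear_map_onD(3)[OF Ff e_closed, of d] c
      by (simp add: F_unit_scl[OF v]) (simp add: d mult.commute)
  qed
  then show ?thesis
    using scalar_of_scl by metis
qed

lemma linear_scalar_of: "linear_map_on (scl B) (*) (hom B (\<one> \<O>) (\<one> \<O>)) UNIV (scalar_of B)"
proof -
  have "scalar_of B (f + g) = scalar_of B f + scalar_of B g"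
    if "f \<in> hom B (\<one> \<O>) (\<one> \<O>)" "g \<in> hom B (\<one> \<O>) (\<one> \<O>)" for f g
    using scalar_of_scl[of "scalar_of B f + scalar_of B g"] that
    by (simp add: scl.scale_left_distrib scalar_of_eq)
  moreover have "scalar_of B (scl B c f) = c * scalar_of B f" if "f \<in> hom B (\<one> \<O>) (\<one> \<O>)" for f c
    using scalar_of_scl[of "c * scalar_of B f"] that
    by (simp add: scl.scale_scale[symmetric] scalar_of_eq del: scl.scale_scale)
  ultimately show ?thesis
    by (simp add: linear_map_on_def)
qed

text \<open>A vector space is a finite direct sum of copies of the ground field. A basis of
  \<open>V Z\<close> gives this decomposition of the identity in \<open>Vect\<close>; fullness lifts
  its maps and faithfulness lifts the equation.\<close>

lemma unit_frame:
  assumes Z: "Z \<in> mor B \<O> \<O>"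
  obtains S :: "(nat \<Rightarrow> 'k) set" and w u where "finite S"
    "\<forall>b\<in>S. w b \<in> hom B (\<one> \<O>) Z \<and> u b \<in> hom B Z (\<one> \<O>)"
    "\<^bold>1 Z = (\<Sum>b\<in>S. w b \<cdot> u b)"
proof -
  obtain S where S: "finite S" "seq.independent S" "seq.span S = V Z"
    using V_closed[OF Z] fin_dim_subspace_basis[OF vector_space_seq_scl] by blast
  \<comment> \<open>\<open>w b\<close> lifts the map that sends the generator \<open>e\<close> to
    the basis vector \<open>b\<close>, and \<open>u b\<close> lifts the coordinate functional of
    \<open>b\<close>.\<close>
  define w where "w b = (SOME f. f \<in> hom B (\<one> \<O>) Z \<and>
    (\<forall>v\<in>V (\<one> \<O>). F (\<one> \<O>) Z f v = seq_scl (unit_coord v) b))" for b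
  define u where "u b = (SOME f. f \<in> hom B Z (\<one> \<O>) \<and>
    (\<forall>v\<in>V Z. F Z (\<one> \<O>) f v = seq_scl (seq.representation S v b) e))" for b
  have w: "w b \<in> hom B (\<one> \<O>) Z" "F (\<one> \<O>) Z (w b) (seq_scl c e) = seq_scl c b" if "b \<in> S" for b c
  proof -
    have "b \<in> V Z" using that S seq.span_base by blast
    then have b: "seq_scl c b \<in> V Z" for c
      using S seq.span_scale by metis
    have "Vect_hom (V (\<one> \<O>)) (V Z) (\<lambda>v. seq_scl (unit_coord v) b)"
      by (simp add: linear_map_on_def b unit_coord_add unit_coord_scl seq.scale_left_distrib)
    then have "w b \<in> hom B (\<one> \<O>) Z \<and> (\<forall>v\<in>V (\<one> \<O>). F (\<one> \<O>) Z (w b) v = seq_scl (unit_coord v) b)"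
      unfolding w_def by (rule someI_ex[OF ex1_implies_ex[OF fully_faithful[OF unit_mor Z]]])
    then show "w b \<in> hom B (\<one> \<O>) Z" "F (\<one> \<O>) Z (w b) (seq_scl c e) = seq_scl c b"
      using V_unitI by auto
  qed
  have u: "u b \<in> hom B Z (\<one> \<O>)"
    "v \<in> V Z \<Longrightarrow> F Z (\<one> \<O>) (u b) v = seq_scl (seq.representation S v b) e" for b v
  proof -
    have "Vect_hom (V Z) (V (\<one> \<O>)) (\<lambda>v. seq_scl (seq.representation S v b) e)"
      using S V_unitI
      by (simp add: linear_map_on_def seq.representation_add seq.representation_scale seq.scale_left_distrib)
    then have "u b \<in> hom B Z (\<one> \<O>) \<and> (\<forall>v\<in>V Z. F Z (\<one> \<O>) (u b) v = seq_scl (seq.representation S v b) e)"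
      unfolding u_def by (rule someI_ex[OF ex1_implies_ex[OF fully_faithful[OF Z unit_mor]]])
    then show "u b \<in> hom B Z (\<one> \<O>)"
      "v \<in> V Z \<Longrightarrow> F Z (\<one> \<O>) (u b) v = seq_scl (seq.representation S v b) e"
      by auto
  qed
  have wu: "w b \<cdot> u b \<in> hom B Z Z" if "b \<in> S" for b
    using vcomp_closed[OF u(1) w(1)[OF that]] .
  have ZZ: "scl.subspace (hom B Z Z)"
    by (simp add: hom_subspace)
  have "\<^bold>1 Z = (\<Sum>b\<in>S. w b \<cdot> u b)"
  proof (rule F_faithful[OF Z Z id2_closed scl.subspace_sum[OF ZZ wu]])
    fix v assume v: "v \<in> V Z"
    have "F Z Z (\<Sum>b\<in>S. w b \<cdot> u b) v = (\<Sum>b\<in>S. F Z Z (w b \<cdot> u b) v)"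
      using wu by (rule F_sum[OF Z Z v])
    also have "\<dots> = (\<Sum>b\<in>S. seq_scl (seq.representation S v b) b)"
      by (rule sum.cong[OF refl]) (simp add: F_vcomp[OF Z u(1) w(1) v] u(2)[OF v] w(2))
    also have "\<dots> = v"
      using seq.sum_representation_eq[of S v S] S v by auto
    finally show "F Z Z (\<^bold>1 Z) v = F Z Z (\<Sum>b\<in>S. w b \<cdot> u b) v"
      by (simp add: F_id2[OF Z v])
  qed simp
  then show thesis
    using S(1) w(1) u(1) by (intro that) auto
qed

lemma hom_frame:
  assumes X: "X \<in> mor B \<O> a" and Y: "Y \<in> mor B \<O> a"
  obtains S :: "(nat \<Rightarrow> 'k) set" and v v' where "finite S"
    "\<forall>b\<in>S. v b \<in> hom B X Y \<and> v' b \<in> hom B Y X"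
    "\<^bold>1 (X\<^sup>\<dagger> \<otimes> Y) = (\<Sum>b\<in>S. body (name (Cell X (v b) Y) \<bullet> coname (Cell Y (v' b) X)))"
proof -
  have XY: "src B X = \<O>" "src B Y = \<O>" "trg B X = a" "trg B Y = a"
    using X Y by (auto simp: mor_def)
  \<comment> \<open>The point where it matters that X and Y start at \<O>.\<close>
  then have "X\<^sup>\<dagger> \<otimes> Y \<in> mor B \<O> \<O>"
    by (simp add: mor_def)
  then obtain S :: "(nat \<Rightarrow> 'k) set" and w u where S: "finite S"
      "\<forall>b\<in>S. w b \<in> hom B (\<one> \<O>) (X\<^sup>\<dagger> \<otimes> Y) \<and> u b \<in> hom B (X\<^sup>\<dagger> \<otimes> Y) (\<one> \<O>)"
      "\<^bold>1 (X\<^sup>\<dagger> \<otimes> Y) = (\<Sum>b\<in>S. w b \<cdot> u b)"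
    by (rule unit_frame)
  define vc where "vc b = unname X Y (Cell (\<one> \<O>) (w b) (X\<^sup>\<dagger> \<otimes> Y))" for b
  define vc' where "vc' b = unconame X Y (Cell (X\<^sup>\<dagger> \<otimes> Y) (u b) (\<one> \<O>))" for b
  have vc: "arr (vc b)" "dm (vc b) = X" "cd (vc b) = Y" "name (vc b) = Cell (\<one> \<O>) (w b) (X\<^sup>\<dagger> \<otimes> Y)"
    and vc': "arr (vc' b)" "dm (vc' b) = Y" "cd (vc' b) = X"
      "coname (vc' b) = Cell (X\<^sup>\<dagger> \<otimes> Y) (u b) (\<one> \<O>)" if "b \<in> S" for b
    using S(2) that XY
    by (simp_all add: vc_def vc'_def unname_simps unconame_simps name_unname coname_unconame)
  have eq: "Cell X (body (vc b)) Y = vc b" "Cell Y (body (vc' b)) X = vc' b" if "b \<in> S" for b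
    using vc(2,3)[OF that] vc'(2,3)[OF that] by (metis cell.collapse)+
  show thesis
  proof (rule that[OF S(1)])
    show "\<forall>b\<in>S. body (vc b) \<in> hom B X Y \<and> body (vc' b) \<in> hom B Y X"
      using vc vc' by (auto simp: arr_def)
    show "\<^bold>1 (X\<^sup>\<dagger> \<otimes> Y) = (\<Sum>b\<in>S. body (name (Cell X (body (vc b)) Y) \<bullet> coname (Cell Y (body (vc' b)) X)))"
      unfolding S(3) by (rule sum.cong[OF refl]) (simp add: eq vc(4) vc'(4))
  qed
qed

lemma linear_scalar_left_trace:
  assumes "X \<in> mor B \<O> a"
  shows "linear_map_on (scl B) (*) (hom B X X) UNIV (\<lambda>f. scalar_of B (tr\<^sub>l X f))"
  using linear_map_on_compose[OF linear_left_trace[of X], of "(*)" UNIV "scalar_of B"] linear_scalar_of assms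
  by (simp add: mor_def)

lemma scalar_left_trace_cyclic:
  "\<lbrakk>f \<in> hom B X Y; g \<in> hom B Y X\<rbrakk> \<Longrightarrow> scalar_of B (tr\<^sub>l X (g \<cdot> f)) = scalar_of B (tr\<^sub>l Y (f \<cdot> g))"
  by (rule arg_cong[OF left_trace_cyclic])

text \<open>Compose the decomposition of the identity of
  \<open>X\<^sup>\<dagger> \<otimes> Y\<close> with the name of \<Omega>, or with the coname of
  \<Psi>. Each term contains a coname after a name, that is, a left trace in End(1_\<O>), which is a
  scalar and can be pulled out; undoing the transposition, which is linear, gives the
  expansions.\<close>

lemma hom_dual_bases:
  assumes X: "X \<in> mor B \<O> a" and Y: "Y \<in> mor B \<O> a"
  obtains S :: "(nat \<Rightarrow> 'k) set" and v v' where "finite S"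
    "\<forall>b\<in>S. v b \<in> hom B X Y \<and> v' b \<in> hom B Y X"
    "\<forall>\<Omega>\<in>hom B X Y. \<Omega> = (\<Sum>b\<in>S. scl B (scalar_of B (tr\<^sub>l X (v' b \<cdot> \<Omega>))) (v b))"
    "\<forall>\<Psi>\<in>hom B Y X. \<Psi> = (\<Sum>b\<in>S. scl B (scalar_of B (tr\<^sub>l X (\<Psi> \<cdot> v b))) (v' b))"
    "\<forall>f\<in>hom B X X. tr\<^sub>r X f \<star> \<^bold>1 Y = (\<Sum>b\<in>S. v b \<cdot> f \<cdot> v' b)"
proof -
  have XY [simp]: "src B X = \<O>" "src B Y = \<O>" "trg B X = a" "trg B Y = a"
    using X Y by (auto simp: mor_def)
  let ?W = "X\<^sup>\<dagger> \<otimes> Y"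
  obtain S :: "(nat \<Rightarrow> 'k) set" and v v' where S: "finite S"
      "\<forall>b\<in>S. v b \<in> hom B X Y \<and> v' b \<in> hom B Y X"
      "\<^bold>1 ?W = (\<Sum>b\<in>S. body (name (Cell X (v b) Y) \<bullet> coname (Cell Y (v' b) X)))"
    by (rule hom_frame[OF X Y])
  define nm where "nm f = body (name (Cell X f Y))" for f
  define cn where "cn g = body (coname (Cell Y g X))" for g
  define un where "un w = body (unname X Y (Cell (\<one> \<O>) w ?W))" for w
  define uc where "uc u = body (unconame X Y (Cell ?W u (\<one> \<O>)))" for u
  have nm: "nm f \<in> hom B (\<one> \<O>) ?W" "un (nm f) = f" if "f \<in> hom B X Y" for f
  proof -
    have "arr (name (Cell X f Y))" using that by simp
    then show "nm f \<in> hom B (\<one> \<O>) ?W" by (simp add: arr_def nm_def)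
    have "name (Cell X f Y) = Cell (\<one> \<O>) (nm f) ?W"
      by (rule cell.expand) (simp add: nm_def)
    then show "un (nm f) = f"
      using unname_name[of "Cell X f Y" X Y] that by (simp add: un_def)
  qed
  have cn: "cn g \<in> hom B ?W (\<one> \<O>)" "uc (cn g) = g" if "g \<in> hom B Y X" for g
  proof -
    have "arr (coname (Cell Y g X))" using that by simp
    then show "cn g \<in> hom B ?W (\<one> \<O>)" by (simp add: arr_def cn_def)
    have "coname (Cell Y g X) = Cell ?W (cn g) (\<one> \<O>)"
      by (rule cell.expand) (simp add: cn_def)
    then show "uc (cn g) = g"
      using unconame_coname[of "Cell Y g X" Y X] that by (simp add: uc_def)
  qed
  have tr: "tr\<^sub>l X (g \<cdot> f) = cn g \<cdot> nm f" if "f \<in> hom B X Y" "g \<in> hom B Y X" for f g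
    using left_trace_cseq[of "Cell X f Y" "Cell Y g X"] that by (simp add: cn_def nm_def)
  have tr_scl: "cn g \<cdot> nm f = scl B (scalar_of B (tr\<^sub>l X (g \<cdot> f))) (\<^bold>1 (\<one> \<O>))"
    if "f \<in> hom B X Y" "g \<in> hom B Y X" for f g
    using vcomp_closed[OF nm(1)[OF that(1)] cn(1)[OF that(2)]] by (simp add: tr that scalar_of_eq)
  have frame: "\<^bold>1 ?W = (\<Sum>b\<in>S. nm (v b) \<cdot> cn (v' b))"
    using S(3) by (simp add: nm_def cn_def)
  have prod: "nm (v b) \<cdot> cn (v' b) \<in> hom B ?W ?W" if "b \<in> S" for b
    using S(2) that by (blast intro: vcomp_closed[OF cn(1) nm(1)])
  show thesis
  proof (rule that[OF S(1,2)]; intro ballI)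
    fix f assume f: "f \<in> hom B X Y"
    have lin: "linear_map_on (scl B) (scl B) (hom B (\<one> \<O>) ?W) (hom B X Y) un"
    proof -
      have "(evt X \<star> \<^bold>1 Y) \<in> hom B (X \<otimes> X\<^sup>\<dagger> \<otimes> Y) Y"
        using hcomp2_closed[OF evt_closed[of X] id2_closed[of Y]] by simp
      from linear_map_on_compose[OF linear_hcomp2_left[OF id2_closed[of X], where Y = "\<one> \<O>" and Y' = ?W]
        linear_vcomp_left[OF this]]
      show ?thesis
        by (simp add: un_def[abs_def] unname_def)
    qed
    have "nm f = (\<Sum>b\<in>S. nm (v b) \<cdot> cn (v' b)) \<cdot> nm f"
      using id2_left[OF nm(1)[OF f]] by (simp add: frame)
    also have "\<dots> = (\<Sum>b\<in>S. (nm (v b) \<cdot> cn (v' b)) \<cdot> nm f)"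
      by (rule linear_sum'[OF linear_vcomp_right[OF nm(1)[OF f], where Z = ?W]]) (simp_all add: prod)
    also have "\<dots> = (\<Sum>b\<in>S. scl B (scalar_of B (tr\<^sub>l X (v' b \<cdot> f))) (nm (v b)))"
    proof (rule sum.cong[OF refl])
      fix b assume b: "b \<in> S"
      then have vb: "v b \<in> hom B X Y" "v' b \<in> hom B Y X" using S(2) by auto
      have "(nm (v b) \<cdot> cn (v' b)) \<cdot> nm f = nm (v b) \<cdot> cn (v' b) \<cdot> nm f"
        by (rule vcomp_assoc[OF nm(1)[OF f] cn(1)[OF vb(2)] nm(1)[OF vb(1)]])
      also have "\<dots> = scl B (scalar_of B (tr\<^sub>l X (v' b \<cdot> f))) (nm (v b) \<cdot> \<^bold>1 (\<one> \<O>))"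
        unfolding tr_scl[OF f vb(2)]
        by (rule linear_map_onD(3)[OF linear_vcomp_left[OF nm(1)[OF vb(1)], where X = "\<one> \<O>"]]) (simp_all add: id2_closed)
      finally show "(nm (v b) \<cdot> cn (v' b)) \<cdot> nm f = scl B (scalar_of B (tr\<^sub>l X (v' b \<cdot> f))) (nm (v b))"
        by (simp add: id2_right[OF nm(1)[OF vb(1)]])
    qed
    finally have "un (nm f) = un \<dots>" by simp
    also have "\<dots> = (\<Sum>b\<in>S. scl B (scalar_of B (tr\<^sub>l X (v' b \<cdot> f))) (un (nm (v b))))"
      using S(2) nm(1) by (intro linear_sum[OF lin]) auto
    finally show "f = (\<Sum>b\<in>S. scl B (scalar_of B (tr\<^sub>l X (v' b \<cdot> f))) (v b))"
      using S(2) by (simp add: nm(2) f)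
  next
    fix g assume g: "g \<in> hom B Y X"
    have lin: "linear_map_on (scl B) (scl B) (hom B ?W (\<one> \<O>)) (hom B Y X) uc"
    proof -
      have "(coev X \<star> \<^bold>1 Y) \<in> hom B Y (X \<otimes> X\<^sup>\<dagger> \<otimes> Y)"
        using hcomp2_closed[OF coev_closed[of X] id2_closed[of Y]] by simp
      from linear_map_on_compose[OF linear_hcomp2_left[OF id2_closed[of X], where Y = ?W and Y' = "\<one> \<O>"]
        linear_vcomp_right[OF this]]
      show ?thesis
        by (simp add: uc_def[abs_def] unconame_def)
    qed
    have "cn g = cn g \<cdot> (\<Sum>b\<in>S. nm (v b) \<cdot> cn (v' b))"
      using id2_right[OF cn(1)[OF g]] by (simp add: frame)
    also have "\<dots> = (\<Sum>b\<in>S. cn g \<cdot> nm (v b) \<cdot> cn (v' b))"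
      by (rule linear_sum'[OF linear_vcomp_left[OF cn(1)[OF g], where X = ?W]]) (simp_all add: prod)
    also have "\<dots> = (\<Sum>b\<in>S. scl B (scalar_of B (tr\<^sub>l X (g \<cdot> v b))) (cn (v' b)))"
    proof (rule sum.cong[OF refl])
      fix b assume b: "b \<in> S"
      then have vb: "v b \<in> hom B X Y" "v' b \<in> hom B Y X" using S(2) by auto
      have "cn g \<cdot> nm (v b) \<cdot> cn (v' b) = (cn g \<cdot> nm (v b)) \<cdot> cn (v' b)"
        by (rule vcomp_assoc[OF cn(1)[OF vb(2)] nm(1)[OF vb(1)] cn(1)[OF g], symmetric])
      also have "\<dots> = scl B (scalar_of B (tr\<^sub>l X (g \<cdot> v b))) (\<^bold>1 (\<one> \<O>) \<cdot> cn (v' b))"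
        unfolding tr_scl[OF vb(1) g]
        by (rule linear_map_onD(3)[OF linear_vcomp_right[OF cn(1)[OF vb(2)], where Z = "\<one> \<O>"]]) (simp_all add: id2_closed)
      finally show "cn g \<cdot> nm (v b) \<cdot> cn (v' b) = scl B (scalar_of B (tr\<^sub>l X (g \<cdot> v b))) (cn (v' b))"
        by (simp add: id2_left[OF cn(1)[OF vb(2)]])
    qed
    finally have "uc (cn g) = uc \<dots>" by simp
    also have "\<dots> = (\<Sum>b\<in>S. scl B (scalar_of B (tr\<^sub>l X (g \<cdot> v b))) (uc (cn (v' b))))"
      using S(2) cn(1) by (intro linear_sum[OF lin]) auto
    finally show "g = (\<Sum>b\<in>S. scl B (scalar_of B (tr\<^sub>l X (g \<cdot> v b))) (v' b))"
      using S(2) by (simp add: cn(2) g)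
  next
    fix f assume "f \<in> hom B X X"
    then show "tr\<^sub>r X f \<star> \<^bold>1 Y = (\<Sum>b\<in>S. v b \<cdot> f \<cdot> v' b)"
      using S by (intro right_trace_whisker_frame) auto
  qed
qed

lemma hom_linear_category:
  "linear_category (scl B) (mor B \<O> a) (hom B) (vcomp B) (id2 B)"
proof
  show "scl.subspace (hom B X Y)" if "X \<in> mor B \<O> a" "Y \<in> mor B \<O> a" for X Y
    using that by (simp add: mor_def hom_subspace)
qed (simp_all add: vcomp_bilinear id2_closed vcomp_assoc id2_left id2_right)

text \<open>Naturality in the first object is cyclicity of the trace, in the second it is
  associativity. Bijectivity rests on the dual bases: the expansion in \<open>v'\<close> shows that
  the witness represents \<xi>, the one in \<open>v\<close> that it is unique.\<close>

lemma hom_calabi_yau: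
  "calabi_yau_category (scl B) (mor B \<O> a) (hom B) (vcomp B) (id2 B)
     (\<lambda>X Y f g. scalar_of B (tr\<^sub>l X (g \<cdot> f)))"
  unfolding calabi_yau_category_def serre_functor_def serre_functor_axioms_def
proof (intro conjI hom_linear_category allI impI)
  fix X Y assume X: "X \<in> mor B \<O> a" and Y: "Y \<in> mor B \<O> a"
  then have XY [simp]: "src B X = \<O>" "src B Y = \<O>" "trg B X = a" "trg B Y = a"
    by (auto simp: mor_def)
  note tr = linear_scalar_left_trace[OF X]
  show "bilinear_map_on (scl B) (scl B) (*) (hom B X Y) (hom B Y X) UNIV
      (\<lambda>f g. scalar_of B (tr\<^sub>l X (g \<cdot> f)))"
    unfolding bilinear_map_on_def
    by (intro conjI ballI linear_map_on_compose[OF linear_vcomp_left tr]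
        linear_map_on_compose[OF linear_vcomp_right tr]) simp_all
  fix \<xi> :: "'c \<Rightarrow> 'k" assume xi: "linear_map_on (scl B) (*) (hom B Y X) UNIV \<xi>"
  obtain S :: "(nat \<Rightarrow> 'k) set" and v v' where S: "finite S"
    "\<forall>b\<in>S. v b \<in> hom B X Y \<and> v' b \<in> hom B Y X"
    "\<forall>\<Omega>\<in>hom B X Y. \<Omega> = (\<Sum>b\<in>S. scl B (scalar_of B (tr\<^sub>l X (v' b \<cdot> \<Omega>))) (v b))"
    "\<forall>\<Psi>\<in>hom B Y X. \<Psi> = (\<Sum>b\<in>S. scl B (scalar_of B (tr\<^sub>l X (\<Psi> \<cdot> v b))) (v' b))"
    "\<forall>f\<in>hom B X X. tr\<^sub>r X f \<star> \<^bold>1 Y = (\<Sum>b\<in>S. v b \<cdot> f \<cdot> v' b)"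
    by (rule hom_dual_bases[OF X Y])
  have sub: "scl.subspace (hom B X Y)" "scl.subspace (hom B Y X)"
    by (simp_all add: hom_subspace)
  show "\<exists>!\<Phi>. \<Phi> \<in> hom B X Y \<and> (\<forall>\<Psi>\<in>hom B Y X. scalar_of B (tr\<^sub>l X (\<Psi> \<cdot> \<Phi>)) = \<xi> \<Psi>)"
  proof
    \<comment> \<open>The vector whose coordinates are the values of \<xi> on the dual
      basis.\<close>
    let ?f = "\<Sum>b\<in>S. scl B (\<xi> (v' b)) (v b)"
    have f: "?f \<in> hom B X Y"
      using S(2) by (intro scl.subspace_sum sub scl.subspace_scale) auto
    moreover have "scalar_of B (tr\<^sub>l X (g \<cdot> ?f)) = \<xi> g" if g: "g \<in> hom B Y X" for g
    proof -
      have "scalar_of B (tr\<^sub>l X (g \<cdot> ?f)) = (\<Sum>b\<in>S. \<xi> (v' b) * scalar_of B (tr\<^sub>l X (g \<cdot> v b)))"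
        using S(2) by (intro linear_map_on_sum[OF vector_space vector_space_field sub(1)
              linear_map_on_compose[OF linear_vcomp_left[OF g] tr]]) auto
      also have "\<dots> = \<xi> (\<Sum>b\<in>S. scl B (scalar_of B (tr\<^sub>l X (g \<cdot> v b))) (v' b))"
        using S(2) by (subst linear_map_on_sum[OF vector_space vector_space_field sub(2) xi])
          (auto simp: mult.commute)
      also have "\<dots> = \<xi> g"
        by (simp only: bspec[OF S(4) g, symmetric])
      finally show ?thesis .
    qed
    ultimately show "?f \<in> hom B X Y \<and> (\<forall>\<Psi>\<in>hom B Y X. scalar_of B (tr\<^sub>l X (\<Psi> \<cdot> ?f)) = \<xi> \<Psi>)"
      by blast
    fix \<Phi> assume \<Phi>: "\<Phi> \<in> hom B X Y \<and> (\<forall>\<Psi>\<in>hom B Y X. scalar_of B (tr\<^sub>l X (\<Psi> \<cdot> \<Phi>)) = \<xi> \<Psi>)"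
    then have "(\<Sum>b\<in>S. scl B (scalar_of B (tr\<^sub>l X (v' b \<cdot> \<Phi>))) (v b)) = ?f"
      using S(2) by (intro sum.cong) auto
    then show "\<Phi> = ?f"
      by (rule trans[OF bspec[OF S(3) conjunct1[OF \<Phi>]]])
  qed
next
  fix X X' Y h \<Phi> \<Psi>
  assume a: "h \<in> hom B X' X" "\<Phi> \<in> hom B X Y" "\<Psi> \<in> hom B Y X'"
  show "scalar_of B (tr\<^sub>l X' (\<Psi> \<cdot> \<Phi> \<cdot> h)) = scalar_of B (tr\<^sub>l X ((h \<cdot> \<Psi>) \<cdot> \<Phi>))"
    using scalar_left_trace_cyclic[OF a(1) vcomp_closed[OF a(2,3)]] vcomp_assoc[OF a] vcomp_assoc[OF a(2,3,1)]
    by simp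
next
  fix X Y Y' g \<Phi> \<Psi>
  assume a: "g \<in> hom B Y Y'" "\<Phi> \<in> hom B X Y" "\<Psi> \<in> hom B Y' X"
  show "scalar_of B (tr\<^sub>l X (\<Psi> \<cdot> g \<cdot> \<Phi>)) = scalar_of B (tr\<^sub>l X ((\<Psi> \<cdot> g) \<cdot> \<Phi>))"
    by (simp add: vcomp_assoc[OF a(2,1,3)])
qed auto

text \<open>Unfolding gives a trace over Y of \<Phi>\<Psi>, whereas \<open>hom_pairing\<close>
  traces \<Psi>\<Phi> over X; cyclicity reconciles them.\<close>

lemma serre_pairing_left_trace:
  assumes "\<Phi> \<in> hom B X Y" "\<Psi> \<in> hom B Y X"
  shows "serre_pairing (vcomp B) (id2 B) (\<lambda>X Y f g. scalar_of B (tr\<^sub>l X (g \<cdot> f))) Y X \<Phi> \<Psi>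
    = hom_pairing B Y X \<Phi> \<Psi>"
  by (simp only: serre_pairing_def hom_pairing_def id2_right[OF vcomp_closed[OF assms(2,1)]]
      left_trace_cyclic[OF assms])

end

section \<open>The Frobenius structure on endomorphisms of a unit 1-morphism\<close>

context gray_monoid_over_Vect
begin

lemma
  shows linear_tilde: "linear_map_on (scl B) (scl B) (hom B (\<one> a) (\<one> a)) (hom B (\<eta> a) (\<eta> a)) (tilde B a)"
    and tilde_id2: "tilde B a (\<^bold>1 (\<one> a)) = \<^bold>1 (\<eta> a)"
    and tilde_vcomp: "\<lbrakk>f \<in> hom B (\<one> a) (\<one> a); g \<in> hom B (\<one> a) (\<one> a)\<rbrakk>
      \<Longrightarrow> tilde B a (g \<cdot> f) = tilde B a g \<cdot> tilde B a f"
proof -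
  show "linear_map_on (scl B) (scl B) (hom B (\<one> a) (\<one> a)) (hom B (\<eta> a) (\<eta> a)) (tilde B a)"
    using linear_map_on_compose[OF rbox_linear[of "\<one> a" "\<one> a" "a\<^sup>#"]
        linear_hcomp2_right[OF id2_closed[of "\<eta> a"], of "\<one> a \<lhd> a\<^sup>#" "\<one> a \<lhd> a\<^sup>#"]]
    by (simp add: tilde_def[abs_def])
  have "tilde_cell a (cid (\<one> a)) = cid (\<eta> a)"
    by (simp add: tilde_cell_def rbox_cell)
  from arg_cong[OF this, of body] show "tilde B a (\<^bold>1 (\<one> a)) = \<^bold>1 (\<eta> a)"
    by (simp add: body_tilde_cell)
  show "tilde B a (g \<cdot> f) = tilde B a g \<cdot> tilde B a f"
    if "f \<in> hom B (\<one> a) (\<one> a)" "g \<in> hom B (\<one> a) (\<one> a)" for f g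
  proof -
    let ?f = "Cell (\<one> a) f (\<one> a)" and ?g = "Cell (\<one> a) g (\<one> a)"
    have "tilde_cell a (?g \<bullet> ?f) = tilde_cell a ?g \<bullet> tilde_cell a ?f"
      using that by (simp add: tilde_cell_def rbox_cell whisker_right_cseq)
    from arg_cong[OF this, of body] show ?thesis
      by (simp add: body_tilde_cell)
  qed
qed

lemma bij_betw_tilde: "bij_betw (tilde B a) (hom B (\<one> a) (\<one> a)) (hom B (\<eta> a) (\<eta> a))"
proof -
  obtain G where
    "\<forall>f. arr f \<and> dm f = \<eta> a \<and> cd f = \<eta> a \<longrightarrow>
      arr (G f) \<and> dm (G f) = \<one> a \<and> cd (G f) = \<one> a \<and> tilde_cell a (G f) = f"
    "\<forall>f. arr f \<and> dm f = \<one> a \<and> cd f = \<one> a \<longrightarrow> G (tilde_cell a f) = f"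
    by (rule tilde_cell_inverse)
  then have G: "\<lbrakk>arr f; dm f = \<eta> a; cd f = \<eta> a\<rbrakk> \<Longrightarrow> arr (G f) \<and> dm (G f) = \<one> a \<and> cd (G f) = \<one> a"
    "\<lbrakk>arr f; dm f = \<eta> a; cd f = \<eta> a\<rbrakk> \<Longrightarrow> tilde_cell a (G f) = f"
    "\<lbrakk>arr f; dm f = \<one> a; cd f = \<one> a\<rbrakk> \<Longrightarrow> G (tilde_cell a f) = f" for f
    by blast+
  have tc: "tilde_cell a (Cell (\<one> a) f (\<one> a)) = Cell (\<eta> a) (tilde B a f) (\<eta> a)" for f
    by (rule cell.expand) (simp add: body_tilde_cell, simp add: tilde_cell_def)
  show ?thesis
  proof (rule bij_betw_byWitness[where f' = "\<lambda>f. body (G (Cell (\<eta> a) f (\<eta> a)))"])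
    show "\<forall>f\<in>hom B (\<one> a) (\<one> a). body (G (Cell (\<eta> a) (tilde B a f) (\<eta> a))) = f"
    proof
      fix f assume "f \<in> hom B (\<one> a) (\<one> a)"
      then have "G (tilde_cell a (Cell (\<one> a) f (\<one> a))) = Cell (\<one> a) f (\<one> a)"
        by (intro G(3)) simp_all
      then show "body (G (Cell (\<eta> a) (tilde B a f) (\<eta> a))) = f"
        by (simp add: tc)
    qed
    show "\<forall>f\<in>hom B (\<eta> a) (\<eta> a). tilde B a (body (G (Cell (\<eta> a) f (\<eta> a)))) = f"
    proof
      fix f assume "f \<in> hom B (\<eta> a) (\<eta> a)"
      then have "tilde_cell a (G (Cell (\<eta> a) f (\<eta> a))) = Cell (\<eta> a) f (\<eta> a)"
        by (intro G(2)) simp_all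
      from arg_cong[OF this, of body]
      show "tilde B a (body (G (Cell (\<eta> a) f (\<eta> a)))) = f"
        by (simp add: body_tilde_cell)
    qed
    show "tilde B a ` hom B (\<one> a) (\<one> a) \<subseteq> hom B (\<eta> a) (\<eta> a)"
      using linear_map_onD(1)[OF linear_tilde] by blast
    have "body (G (Cell (\<eta> a) f (\<eta> a))) \<in> hom B (\<one> a) (\<one> a)" if "f \<in> hom B (\<eta> a) (\<eta> a)" for f
      using G(1)[of "Cell (\<eta> a) f (\<eta> a)"] that by (auto simp: arr_def)
    then show "(\<lambda>f. body (G (Cell (\<eta> a) f (\<eta> a)))) ` hom B (\<eta> a) (\<eta> a) \<subseteq> hom B (\<one> a) (\<one> a)"
      by blast
  qed
qed

lemma unit_pairing_eq:
  assumes "f \<in> hom B (\<one> a) (\<one> a)" "g \<in> hom B (\<one> a) (\<one> a)"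
  shows "unit_pairing B a f g = scalar_of B (tr\<^sub>l (\<eta> a) (tilde B a (f \<cdot> g)))"
  using assms by (simp add: unit_pairing_def tilde_vcomp)

lemma unit_pairing_average:
  assumes "f \<in> hom B (\<one> a) (\<one> a)" "g \<in> hom B (\<one> a) (\<one> a)"
  shows "unit_pairing B a f g = unit_average B a (f \<cdot> g)"
  using assms vcomp_closed[OF assms(2,1)]
  by (simp add: unit_average_def unit_pairing_eq id2_closed id2_right)

text \<open>At \<O> the fold is 1_\<O>, so \<open>tilde\<close> does nothing and the left trace is
  normalised to the identity. This evaluates one side of the trace hypothesis for 1-morphisms
  starting at \<O>.\<close>

lemma unit_average_munit:
  assumes f: "f \<in> hom B (\<one> \<O>) (\<one> \<O>)"
  shows "unit_average B \<O> f = scalar_of B f"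
proof -
  have "tilde B \<O> f = f"
    using f hcomp2_unit_right[OF f] by (simp add: tilde_def dual_unit fold_unit rbox2_unit)
  moreover have "unit_average B \<O> f = scalar_of B (tr\<^sub>l (\<eta> \<O>) (tilde B \<O> f))"
    using f by (simp add: unit_average_def unit_pairing_eq id2_closed id2_right)
  ultimately show ?thesis
    using f by (simp add: fold_unit left_trace_unit)
qed

text \<open>Everything is pulled back along the algebra isomorphism \<open>tilde\<close> from
  End(\<eta>_a) with its trace pairing. Pulled-back dual bases give a finite spanning set, and an
  element that pairs to 0 with all of them has a vanishing expansion. Associativity holds because
  the pairing depends only on the product.\<close>

lemma unit_frobenius_algebra:
  "commutative_frobenius_algebra (scl B) (endo B (\<one> a)) (vcomp B) (\<^bold>1 (\<one> a)) (unit_pairing B a)"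
proof (rule commutative_frobenius_algebra.intro[OF endo_algebra], unfold_locales)
  let ?A = "hom B (\<one> a) (\<one> a)" and ?E = "hom B (\<eta> a) (\<eta> a)"
  note closed = vcomp_closed[of _ "\<one> a" "\<one> a" _ "\<one> a"]
  have eta: "\<eta> a \<in> mor B \<O> (a \<box> a\<^sup>#)"
    by (simp add: mor_def)
  obtain S :: "(nat \<Rightarrow> 'k) set" and v v' where S: "finite S"
    "\<forall>b\<in>S. v b \<in> ?E \<and> v' b \<in> ?E"
    "\<forall>\<Omega>\<in>?E. \<Omega> = (\<Sum>b\<in>S. scl B (scalar_of B (tr\<^sub>l (\<eta> a) (v' b \<cdot> \<Omega>))) (v b))"
    "\<forall>\<Psi>\<in>?E. \<Psi> = (\<Sum>b\<in>S. scl B (scalar_of B (tr\<^sub>l (\<eta> a) (\<Psi> \<cdot> v b))) (v' b))"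
    "\<forall>f\<in>?E. tr\<^sub>r (\<eta> a) f \<star> \<^bold>1 (\<eta> a) = (\<Sum>b\<in>S. v b \<cdot> f \<cdot> v' b)"
    by (rule hom_dual_bases[OF eta eta])
  have inj: "inj_on (tilde B a) ?A" and surj: "tilde B a ` ?A = ?E"
    using bij_betw_tilde[of a] by (auto simp: bij_betw_def)
  define w where "w b = inv_into ?A (tilde B a) (v b)" for b
  define w' where "w' b = inv_into ?A (tilde B a) (v' b)" for b
  have w: "w b \<in> ?A" "tilde B a (w b) = v b" and w': "w' b \<in> ?A" "tilde B a (w' b) = v' b" if "b \<in> S" for b
    using S(2) that surj by (simp_all add: w_def w'_def inv_into_into f_inv_into_f)
  have sub: "scl.subspace ?A"
    by (simp add: hom_subspace)
  have lin: "linear_map_on (scl B) (*) ?A UNIV (\<lambda>f. scalar_of B (tr\<^sub>l (\<eta> a) (tilde B a f)))"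
    by (rule linear_map_on_compose[OF linear_tilde linear_scalar_left_trace[OF eta]])
  have expand: "f = (\<Sum>b\<in>S. scl B (unit_pairing B a (w' b) f) (w b))" if f: "f \<in> ?A" for f
  proof (rule inj_onD[OF inj _ f])
    have "tilde B a f = (\<Sum>b\<in>S. scl B (scalar_of B (tr\<^sub>l (\<eta> a) (v' b \<cdot> tilde B a f))) (v b))"
      using f surj by (intro bspec[OF S(3)]) blast
    also have "\<dots> = (\<Sum>b\<in>S. scl B (unit_pairing B a (w' b) f) (tilde B a (w b)))"
      by (rule sum.cong[OF refl]) (simp add: w w' unit_pairing_def)
    also have "\<dots> = tilde B a (\<Sum>b\<in>S. scl B (unit_pairing B a (w' b) f) (w b))"
      by (rule linear_sum[OF linear_tilde, symmetric]) (simp_all add: w)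
    finally show "tilde B a f = \<dots>" .
    show "(\<Sum>b\<in>S. scl B (unit_pairing B a (w' b) f) (w b)) \<in> ?A"
      by (intro scl.subspace_sum[OF sub] scl.subspace_scale[OF sub] w)
  qed
  have "?A \<subseteq> scl.span (w ` S)"
  proof
    fix f assume f: "f \<in> ?A"
    show "f \<in> scl.span (w ` S)"
      by (subst expand[OF f]) (intro scl.span_sum scl.span_scale scl.span_base imageI)
  qed
  moreover have "scl.span (w ` S) \<subseteq> ?A"
    using w(1) by (intro scl.span_minimal sub) auto
  ultimately show "fin_dim_subspace (scl B) (endo B (\<one> a))"
    using S(1) sub unfolding fin_dim_subspace_def endo_def by blast
  have commute: "unit_pairing B a f g = unit_pairing B a g f" if "f \<in> ?A" "g \<in> ?A" for f g
    by (simp only: unit_pairing_eq that unit_endo_commute[OF that])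
  have nondegenerate: "f = 0" if f: "f \<in> ?A" and "\<And>g. g \<in> ?A \<Longrightarrow> unit_pairing B a f g = 0" for f
  proof -
    have "unit_pairing B a (w' b) f = 0" if "b \<in> S" for b
      using \<open>\<And>g. g \<in> ?A \<Longrightarrow> unit_pairing B a f g = 0\<close> commute[OF f] w' that by metis
    then show "f = 0"
      by (subst expand[OF f]) simp
  qed
  show "bilinear_map_on (scl B) (scl B) (*) (endo B (\<one> a)) (endo B (\<one> a)) UNIV (unit_pairing B a)"
    unfolding bilinear_map_on_def endo_def
  proof (intro conjI ballI)
    fix f assume f: "f \<in> ?A"
    have "linear_map_on (scl B) (*) ?A UNIV (\<lambda>g. scalar_of B (tr\<^sub>l (\<eta> a) (tilde B a (f \<cdot> g))))"
      by (rule linear_map_on_compose[OF linear_vcomp_left[OF f] lin]) simp_all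
    then show "linear_map_on (scl B) (*) ?A UNIV (unit_pairing B a f)"
      by (rule linear_map_on_cong)
        (simp_all add: unit_pairing_eq f scl.subspace_add[OF sub] scl.subspace_scale[OF sub])
    then show "linear_map_on (scl B) (*) ?A UNIV (\<lambda>g. unit_pairing B a g f)"
      by (rule linear_map_on_cong)
        (simp_all add: commute f scl.subspace_add[OF sub] scl.subspace_scale[OF sub])
  qed
  fix f assume f: "f \<in> endo B (\<one> a)"
  show "f = 0" if "\<And>g. g \<in> endo B (\<one> a) \<Longrightarrow> unit_pairing B a f g = 0"
    using nondegenerate f that by (simp add: endo_def)
  show "f = 0" if "\<And>g. g \<in> endo B (\<one> a) \<Longrightarrow> unit_pairing B a g f = 0"
    using nondegenerate[of f] commute[of f] f that by (simp add: endo_def)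
  fix g assume g: "g \<in> endo B (\<one> a)"
  show "f \<cdot> g = g \<cdot> f"
    using f g unfolding endo_def by (intro unit_endo_commute)
  fix h assume h: "h \<in> endo B (\<one> a)"
  show "unit_pairing B a (f \<cdot> g) h = unit_pairing B a f (g \<cdot> h)"
    using f g h closed by (simp add: endo_def unit_pairing_eq vcomp_assoc)
qed

end

section \<open>The bulk-boundary maps and the Cardy condition\<close>

locale trace_compatible_gray_monoid = gray_monoid_over_Vect B V F \<mu> e
  for B :: "('o, 'm, 'c::ab_group_add, 'k::field, 'z) gray_monoid_with_duals_scheme" (structure)
    and V :: "'m \<Rightarrow> (nat \<Rightarrow> 'k) set"
    and F :: "'m \<Rightarrow> 'm \<Rightarrow> 'c \<Rightarrow> (nat \<Rightarrow> 'k) \<Rightarrow> (nat \<Rightarrow> 'k)"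
    and \<mu> :: "'m \<Rightarrow> 'm \<Rightarrow> (nat \<Rightarrow> 'k) \<Rightarrow> (nat \<Rightarrow> 'k) \<Rightarrow> (nat \<Rightarrow> 'k)"
    and e :: "nat \<Rightarrow> 'k" +
  assumes traces: "\<lbrakk>D \<in> mor B \<beta> \<gamma>; \<Psi> \<in> endo B D\<rbrakk>
    \<Longrightarrow> unit_average B \<beta> (tr\<^sub>l D \<Psi>) = unit_average B \<gamma> (tr\<^sub>r D \<Psi>)"
begin

text \<open>Absorb \<phi> into the circle; the hypothesis turns the average over a of this right
  trace into the average over \<O> of a left trace, which is the scalar itself.\<close>

lemma boundary_bulk_adjoint:
  assumes X: "X \<in> mor B \<O> a" and p: "\<phi> \<in> hom B (\<one> a) (\<one> a)" and f: "f \<in> hom B X X"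
  shows "unit_pairing B a (tr\<^sub>r X f) \<phi> = scalar_of B (tr\<^sub>l X ((\<phi> \<star> \<^bold>1 X) \<cdot> f))"
proof -
  have XY [simp]: "src B X = \<O>" "trg B X = a"
    using X by (auto simp: mor_def)
  have w: "\<phi> \<star> \<^bold>1 X \<in> hom B X X"
    using hcomp2_closed[OF p id2_closed[of X]] by simp
  then have fw: "f \<cdot> (\<phi> \<star> \<^bold>1 X) \<in> hom B X X"
    using f vcomp_closed by blast
  have "unit_pairing B a (tr\<^sub>r X f) \<phi> = unit_average B a (tr\<^sub>r X (f \<cdot> (\<phi> \<star> \<^bold>1 X)))"
    using unit_pairing_average[OF _ p] linear_map_onD(1)[OF linear_right_trace f]
    by (simp add: right_trace_whisker[OF f p])
  also have "\<dots> = unit_average B \<O> (tr\<^sub>l X (f \<cdot> (\<phi> \<star> \<^bold>1 X)))"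
    using traces[OF X] fw by (simp add: endo_def)
  also have "\<dots> = scalar_of B (tr\<^sub>l X (f \<cdot> (\<phi> \<star> \<^bold>1 X)))"
    using linear_map_onD(1)[OF linear_left_trace fw] by (intro unit_average_munit) simp
  also have "f \<cdot> (\<phi> \<star> \<^bold>1 X) = (\<phi> \<star> \<^bold>1 X) \<cdot> f"
    using whisker_central[OF p f] by simp
  finally show ?thesis .
qed

lemma cardy:
  assumes X: "X \<in> mor B \<O> a" and Y: "Y \<in> mor B \<O> a"
    and f: "f \<in> hom B X X" and g: "g \<in> hom B Y Y"
  shows "trace_on (scl B) (hom B X Y) (\<lambda>h. g \<cdot> h \<cdot> f) = unit_pairing B a (tr\<^sub>r Y g) (tr\<^sub>r X f)"
proof -
  have XY [simp]: "src B X = \<O>" "src B Y = \<O>" "trg B X = a" "trg B Y = a"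
    using X Y by (auto simp: mor_def)
  obtain S :: "(nat \<Rightarrow> 'k) set" and v v' where S: "finite S"
    "\<forall>b\<in>S. v b \<in> hom B X Y \<and> v' b \<in> hom B Y X"
    "\<forall>\<Omega>\<in>hom B X Y. \<Omega> = (\<Sum>b\<in>S. scl B (scalar_of B (tr\<^sub>l X (v' b \<cdot> \<Omega>))) (v b))"
    "\<forall>\<Psi>\<in>hom B Y X. \<Psi> = (\<Sum>b\<in>S. scl B (scalar_of B (tr\<^sub>l X (\<Psi> \<cdot> v b))) (v' b))"
    "\<forall>f\<in>hom B X X. tr\<^sub>r X f \<star> \<^bold>1 Y = (\<Sum>b\<in>S. v b \<cdot> f \<cdot> v' b)"
    by (rule hom_dual_bases[OF X Y])
  have v: "v b \<in> hom B X Y" "v' b \<in> hom B Y X" if "b \<in> S" for b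
    using S(2) that by auto
  have "trace_on (scl B) (hom B X Y) (\<lambda>h. g \<cdot> h \<cdot> f)
      = (\<Sum>b\<in>S. scalar_of B (tr\<^sub>l X (v' b \<cdot> g \<cdot> v b \<cdot> f)))"
  proof (rule trace_on_frame[OF vector_space hom_subspace S(1) v(1)])
    show "linear_map_on (scl B) (*) (hom B X Y) UNIV (\<lambda>h. scalar_of B (tr\<^sub>l X (v' b \<cdot> h)))"
      if "b \<in> S" for b
      by (rule linear_map_on_compose[OF linear_vcomp_left[OF v(2)[OF that]] linear_scalar_left_trace[OF X]])
        simp_all
    show "linear_map_on (scl B) (scl B) (hom B X Y) (hom B X Y) (\<lambda>h. g \<cdot> h \<cdot> f)"
      by (rule linear_map_on_compose[OF linear_vcomp_right[OF f] linear_vcomp_left[OF g]]) simp_all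
    show "h = (\<Sum>b\<in>S. scl B (scalar_of B (tr\<^sub>l X (v' b \<cdot> h))) (v b))" if "h \<in> hom B X Y" for h
      using that by (rule bspec[OF S(3)])
  qed simp_all
  \<comment> \<open>Cyclicity moves \<open>v' b\<close> to the far end, so that the sum over the
    frame assembles into the cut annulus and the trace is taken over Y.\<close>
  also have "\<dots> = (\<Sum>b\<in>S. scalar_of B (tr\<^sub>l Y (g \<cdot> v b \<cdot> f \<cdot> v' b)))"
  proof (rule sum.cong[OF refl])
    fix b assume b: "b \<in> S"
    note vb = v[OF b]
    have "(g \<cdot> v b \<cdot> f) \<cdot> v' b = g \<cdot> v b \<cdot> f \<cdot> v' b"
      using vcomp_assoc[OF vb(2) vcomp_closed[OF f vb(1)] g] vcomp_assoc[OF vb(2) f vb(1)] by simp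
    then show "scalar_of B (tr\<^sub>l X (v' b \<cdot> g \<cdot> v b \<cdot> f)) = scalar_of B (tr\<^sub>l Y (g \<cdot> v b \<cdot> f \<cdot> v' b))"
      using left_trace_cyclic[OF vcomp_closed[OF vcomp_closed[OF f vb(1)] g] vb(2)] by simp
  qed
  also have "\<dots> = scalar_of B (tr\<^sub>l Y (g \<cdot> (\<Sum>b\<in>S. v b \<cdot> f \<cdot> v' b)))"
    by (rule linear_functional_sum[OF linear_map_on_compose[OF linear_vcomp_left[OF g]
            linear_scalar_left_trace[OF Y]], symmetric])
      (simp_all add: vcomp_closed[OF vcomp_closed[OF v(2) f] v(1)])
  also have "(\<Sum>b\<in>S. v b \<cdot> f \<cdot> v' b) = tr\<^sub>r X f \<star> \<^bold>1 Y"
    using bspec[OF S(5) f] ..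
  \<comment> \<open>Centrality brings the product into the shape of
    \<open>boundary_bulk_adjoint\<close> for Y, with the right trace over X as the bulk
    element.\<close>
  also have "g \<cdot> (tr\<^sub>r X f \<star> \<^bold>1 Y) = (tr\<^sub>r X f \<star> \<^bold>1 Y) \<cdot> g"
    using linear_map_onD(1)[OF linear_right_trace f] g by (intro whisker_central[of _ a]) simp_all
  also have "scalar_of B (tr\<^sub>l Y \<dots>) = unit_pairing B a (tr\<^sub>r Y g) (tr\<^sub>r X f)"
    using linear_map_onD(1)[OF linear_right_trace f] by (intro boundary_bulk_adjoint[OF Y _ g, symmetric]) simp
  finally show ?thesis .
qed

lemma bulk_boundary_hom:
  assumes X: "X \<in> mor B \<O> a"
  shows "algebra_hom_on (scl B) (vcomp B) (endo B (\<one> a)) (\<^bold>1 (\<one> a)) (endo B X) (\<^bold>1 X) (bulk_boundary B X)"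
proof -
  have XY [simp]: "src B X = \<O>" "trg B X = a"
    using X by (auto simp: mor_def)
  have "linear_map_on (scl B) (scl B) (endo B (\<one> a)) (endo B X) (bulk_boundary B X)"
    using linear_hcomp2_right[OF id2_closed[of X], of "\<one> a" "\<one> a"]
    by (simp add: endo_def bulk_boundary_def[abs_def])
  moreover have "(g \<cdot> f) \<star> \<^bold>1 X = (g \<star> \<^bold>1 X) \<cdot> (f \<star> \<^bold>1 X)"
    if "f \<in> hom B (\<one> a) (\<one> a)" "g \<in> hom B (\<one> a) (\<one> a)" for f g
    using interchange[OF that id2_closed[of X] id2_closed[of X]] id2_left[OF id2_closed[of X]] by simp
  ultimately show ?thesis
    using hcomp2_id2[of "\<one> a" X] endo_algebra[of "\<one> a"] endo_algebra[of X]
    by (auto simp: algebra_hom_on_def bulk_boundary_def endo_def)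
qed

lemma bulk_boundary_central:
  assumes X: "X \<in> mor B \<O> a"
  shows "bulk_boundary B X ` endo B (\<one> a) \<subseteq> centre_on (vcomp B) (endo B X)"
proof -
  have "bulk_boundary B X \<phi> \<in> endo B X" if "\<phi> \<in> endo B (\<one> a)" for \<phi>
    using bulk_boundary_hom[OF X] that by (simp add: algebra_hom_on_def linear_map_on_def)
  then show ?thesis
    using X by (auto simp: centre_on_def endo_def bulk_boundary_def mor_def whisker_central)
qed

end

theorem theorem3p8:
  fixes B :: "('o, 'm, 'c::ab_group_add, 'k::field, 'z) gray_monoid_with_duals_scheme" (structure)
    and \<alpha> :: 'o
  assumes duals: "linear_gray_monoid_with_duals B"
    and unit_Vect: "unit_category_equiv_Vect B"
    and traces: "\<And>\<beta> \<gamma> D \<Psi>. \<lbrakk>D \<in> mor B \<beta> \<gamma>; \<Psi> \<in> endo B D\<rbrakk>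
           \<Longrightarrow> unit_average B \<beta> (tr\<^sub>l D \<Psi>) = unit_average B \<gamma> (tr\<^sub>r D \<Psi>)"
  shows "commutative_frobenius_algebra (scl B) (endo B (\<one> \<alpha>)) (vcomp B) (\<^bold>1 (\<one> \<alpha>))
           (unit_pairing B \<alpha>)
    \<and> (\<exists>ser. calabi_yau_category (scl B) (mor B \<O> \<alpha>) (hom B) (vcomp B) (id2 B) ser
         \<and> (\<forall>X\<in>mor B \<O> \<alpha>. \<forall>Y\<in>mor B \<O> \<alpha>. \<forall>\<Phi>\<in>hom B X Y. \<forall>\<Psi>\<in>hom B Y X.
              serre_pairing (vcomp B) (id2 B) ser Y X \<Phi> \<Psi> = hom_pairing B Y X \<Phi> \<Psi>))
    \<and> (\<forall>X\<in>mor B \<O> \<alpha>.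
         linear_map_on (scl B) (scl B) (endo B (\<one> \<alpha>)) (endo B X) (bulk_boundary B X)
       \<and> linear_map_on (scl B) (scl B) (endo B X) (endo B (\<one> \<alpha>)) (boundary_bulk B X)
       \<and> algebra_hom_on (scl B) (vcomp B) (endo B (\<one> \<alpha>)) (\<^bold>1 (\<one> \<alpha>)) (endo B X) (\<^bold>1 X)
           (bulk_boundary B X)
       \<and> bulk_boundary B X ` endo B (\<one> \<alpha>) \<subseteq> centre_on (vcomp B) (endo B X)
       \<and> (\<forall>\<phi>\<in>endo B (\<one> \<alpha>). \<forall>\<Psi>\<in>endo B X.
            unit_pairing B \<alpha> (boundary_bulk B X \<Psi>) \<phi>
            = hom_pairing B X X \<Psi> (bulk_boundary B X \<phi>)))
    \<and> (\<forall>X\<in>mor B \<O> \<alpha>. \<forall>Y\<in>mor B \<O> \<alpha>. \<forall>\<Phi>\<in>endo B X. \<forall>\<Psi>\<in>endo B Y.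
         trace_on (scl B) (hom B X Y) (\<lambda>\<Omega>. \<Psi> \<cdot> \<Omega> \<cdot> \<Phi>)
         = unit_pairing B \<alpha> (boundary_bulk B Y \<Psi>) (boundary_bulk B X \<Phi>))"
proof -
  obtain V F \<mu> e where "Vect_equivalence B V F \<mu> e"
    using unit_Vect by (auto simp: unit_category_equiv_Vect_def)
  then interpret trace_compatible_gray_monoid B V F \<mu> e
    using duals traces
    by (intro trace_compatible_gray_monoid.intro gray_monoid_over_Vect.intro
        trace_compatible_gray_monoid_axioms.intro)
  show ?thesis
  proof (intro conjI ballI exI)
    show "commutative_frobenius_algebra (scl B) (endo B (\<one> \<alpha>)) (vcomp B) (\<^bold>1 (\<one> \<alpha>)) (unit_pairing B \<alpha>)"
      by (rule unit_frobenius_algebra)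
    show "calabi_yau_category (scl B) (mor B \<O> \<alpha>) (hom B) (vcomp B) (id2 B)
        (\<lambda>X Y f g. scalar_of B (tr\<^sub>l X (g \<cdot> f)))"
      by (rule hom_calabi_yau)
  next
    fix X Y \<Phi> \<Psi> assume "\<Phi> \<in> hom B X Y" "\<Psi> \<in> hom B Y X"
    then show "serre_pairing (vcomp B) (id2 B) (\<lambda>X Y f g. scalar_of B (tr\<^sub>l X (g \<cdot> f))) Y X \<Phi> \<Psi>
        = hom_pairing B Y X \<Phi> \<Psi>"
      by (rule serre_pairing_left_trace)
  next
    fix X assume X: "X \<in> mor B \<O> \<alpha>"
    show "algebra_hom_on (scl B) (vcomp B) (endo B (\<one> \<alpha>)) (\<^bold>1 (\<one> \<alpha>)) (endo B X) (\<^bold>1 X)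
           (bulk_boundary B X)"
      by (rule bulk_boundary_hom[OF X])
    then show "linear_map_on (scl B) (scl B) (endo B (\<one> \<alpha>)) (endo B X) (bulk_boundary B X)"
      by (simp add: algebra_hom_on_def)
    show "linear_map_on (scl B) (scl B) (endo B X) (endo B (\<one> \<alpha>)) (boundary_bulk B X)"
      using linear_right_trace[of X] X by (simp add: boundary_bulk_def[abs_def] endo_def mor_def)
    show "bulk_boundary B X ` endo B (\<one> \<alpha>) \<subseteq> centre_on (vcomp B) (endo B X)"
      by (rule bulk_boundary_central[OF X])
    fix \<phi> \<Psi> assume "\<phi> \<in> endo B (\<one> \<alpha>)" "\<Psi> \<in> endo B X"
    then show "unit_pairing B \<alpha> (boundary_bulk B X \<Psi>) \<phi> = hom_pairing B X X \<Psi> (bulk_boundary B X \<phi>)"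
      using boundary_bulk_adjoint[OF X]
      by (simp add: endo_def boundary_bulk_def bulk_boundary_def hom_pairing_def)
  next
    fix X Y \<Phi> \<Psi>
    assume "X \<in> mor B \<O> \<alpha>" "Y \<in> mor B \<O> \<alpha>" "\<Phi> \<in> endo B X" "\<Psi> \<in> endo B Y"
    then show "trace_on (scl B) (hom B X Y) (\<lambda>\<Omega>. \<Psi> \<cdot> \<Omega> \<cdot> \<Phi>)
         = unit_pairing B \<alpha> (boundary_bulk B Y \<Psi>) (boundary_bulk B X \<Phi>)"
      by (simp add: endo_def boundary_bulk_def cardy)
  qed
qed

end
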